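(* Let $\ell\ge2$ and $d\ge1$ be integers and set $e=d\ell$. (1) The rank generating function of the $\Phi_e$-cuspidals for the spetses of $G(\ell,1,n)$, $n\in\mathbb N$ (that is, $\sum_{n\ge0}a_nq^n$ with $a_n$ the number of $\Phi_e$-cuspidals of the $G(\ell,1,n)$-spets) is $\frac1\ell\,\mathsf r^\ell_1(q)\,\mathsf c_d(q)^\ell$. (2) The spets of $G(\ell,1,n)$ has a $\Phi_e$-cuspidal for all $n\in\mathbb N$ if and only if $e\ge4$.
   Context: $\mathbb N=\{0,1,2,\dots\}$. A partition is a $d$-core if it has no removable rim hook of length $d$; $\mathsf c_d(q)=\sum_{\lambda\ d\text{-core}}q^{|\lambda|}$. A charged $\ell$-partition $|\boldsymbol\lambda,\boldsymbol\sigma\rangle$ is a pair of an $\ell$-tuple $\boldsymbol\lambda=(\lambda^1,\dots,\lambda^\ell)$ of partitions and a charge $\boldsymbol\sigma=(\sigma_1,\dots,\sigma_\ell)\in\mathbb Z^\ell$; its symbol is $(S^{(1)},\dots,S^{(\ell)})$ with $S^{(j)}=\{\lambda^j_k-k+1+\sigma_j : k\ge1\}\subset\mathbb Z$. Charged $\ell$-partitions and their symbols are identified. Rank: let $m=\max\{z\in\mathbb Z : z\notin S^{(j)}\text{ for some }j\}$, let $c$ be the number of pairs $(\beta,j)$ with $\beta\in S^{(j)}$, $\beta\ge m$; then $\mathrm{rk}(|\boldsymbol\lambda,\boldsymbol\sigma\rangle)=\sum_{j}\sum_{\beta\in S^{(j)},\beta\ge m}\beta-cm-\left\lfloor\frac{(c-1)(c-\ell+1)}{2\ell}\right\rfloor$.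 Rank of a charge: $\mathrm{rk}(\boldsymbol\sigma)=\left\lceil\frac{Y-\ell+1}{2\ell}\right\rceil$ with $Y=\sum_i\sum_{j\ne i}\sigma_i(\sigma_i-\sigma_j)$. $\mathsf r^\ell_1(q)=\sum q^{\mathrm{rk}(\boldsymbol\sigma)}$ over $\boldsymbol\sigma\in\mathbb Z^\ell$ with $\sigma_1+\dots+\sigma_\ell=1$. A charged $\ell$-partition is a spetsial $d$-core if $\beta\in S^{(j)}$ implies $\beta-d\in S^{(j+1)}$ for all $j$ (superscripts mod $\ell$). The cyclic group of order $\ell$ acts freely on the set of charged $\ell$-partitions with $\sigma_1+\dots+\sigma_\ell=1$ by cyclically permuting the rows $S^{(1)},\dots,S^{(\ell)}$; this preserves the rank and the property of being a spetsial $d$-core. The unipotent characters of the spets of $G(\ell,1,n)$ are (labelled by) the orbits of rank $n$ under this action. With $e=d\ell$, such an orbit is a $\Phi_e$-cuspidal if its elements are spetsial $d$-cores.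
   Formalization: In the rank of a charged partition, m is taken as the minimum, not the maximum, of the integers z missing from some row S^(j): each row is bounded above, so the maximum does not exist. *)

theory Defs
  imports Complex_Main "HOL-Computational_Algebra.Formal_Power_Series"
begin

text \<open>
  A partition is its sequence of parts padded by zeros, numbered from 0:
  the part \<open>\<lambda>\<^sub>k\<close> with \<open>k \<ge> 1\<close> is \<open>p (k - 1)\<close>.
\<close>

definition is_partition :: "(nat \<Rightarrow> nat) \<Rightarrow> bool" where
  "is_partition p \<longleftrightarrow> antimono p \<and> finite {k. p k \<noteq> 0}"

definition psize :: "(nat \<Rightarrow> nat) \<Rightarrow> nat" where
  "psize p = (\<Sum>k | p k \<noteq> 0. p k)"

definition diagram :: "(nat \<Rightarrow> nat) \<Rightarrow> (nat \<times> nat) set" where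
  "diagram p = {(i, j). j < p i}"

definition adjacent :: "nat \<times> nat \<Rightarrow> nat \<times> nat \<Rightarrow> bool" where
  "adjacent a b \<longleftrightarrow> \<bar>int (fst a) - int (fst b)\<bar> + \<bar>int (snd a) - int (snd b)\<bar> = 1"

definition connected_cells :: "(nat \<times> nat) set \<Rightarrow> bool" where
  "connected_cells R \<longleftrightarrow>
     R \<noteq> {} \<and> (\<forall>a\<in>R. \<forall>b\<in>R. (a, b) \<in> {(x, y). x \<in> R \<and> y \<in> R \<and> adjacent x y}\<^sup>*)"

text \<open>
  A removable rim hook is a connected skew diagram \<open>\<lambda>/\<mu>\<close> that contains no
  2-by-2 square; its length is the number of its cells.
\<close>

definition removable_rim_hook :: "(nat \<Rightarrow> nat) \<Rightarrow> (nat \<times> nat) set \<Rightarrow> bool" where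
  "removable_rim_hook p R \<longleftrightarrow>
     (\<exists>p'. is_partition p' \<and> diagram p' \<subseteq> diagram p \<and> R = diagram p - diagram p') \<and>
     connected_cells R \<and>
     \<not> (\<exists>i j. {(i, j), (Suc i, j), (i, Suc j), (Suc i, Suc j)} \<subseteq> R)"

definition core :: "nat \<Rightarrow> (nat \<Rightarrow> nat) \<Rightarrow> bool" where
  "core d p \<longleftrightarrow> is_partition p \<and> \<not> (\<exists>R. removable_rim_hook p R \<and> card R = d)"

definition core_gf :: "nat \<Rightarrow> rat fps" where
  "core_gf d = Abs_fps (\<lambda>n. of_nat (card {p. core d p \<and> psize p = n}))"

text \<open>
  Charged \<open>\<ell>\<close>-partitions are pairs of lists of length \<open>\<ell>\<close>. Tuples, and hence the
  rows of the symbol, are indexed by \<open>0, \<dots>, \<ell> - 1\<close>.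
\<close>

type_synonym charged = "(nat \<Rightarrow> nat) list \<times> int list"

definition charged_partition :: "nat \<Rightarrow> charged \<Rightarrow> bool" where
  "charged_partition l x \<longleftrightarrow>
     length (fst x) = l \<and> length (snd x) = l \<and> (\<forall>p\<in>set (fst x). is_partition p)"

definition charge_sum :: "charged \<Rightarrow> int" where
  "charge_sum x = sum_list (snd x)"

definition symbol_row :: "charged \<Rightarrow> nat \<Rightarrow> int set" where
  "symbol_row x j = range (\<lambda>k. int ((fst x ! j) k) - int k + snd x ! j)"

text \<open>
  Every row of a symbol is bounded above and contains all sufficiently small
  integers. The rank is therefore computed relative to the smallest integer
  missing from some row; there is no largest one.
\<close>

definition gap :: "nat \<Rightarrow> charged \<Rightarrow> int" where
  "gap l x = (LEAST z. \<exists>j<l. z \<notin> symbol_row x j)"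

definition symbol_rank :: "nat \<Rightarrow> charged \<Rightarrow> int" where
  "symbol_rank l x =
     (let m = gap l x;
          c = int (card {(b, j). j < l \<and> b \<in> symbol_row x j \<and> b \<ge> m})
      in (\<Sum>j<l. \<Sum>b | b \<in> symbol_row x j \<and> b \<ge> m. b) - c * m
         - \<lfloor>(of_int ((c - 1) * (c - int l + 1)) :: rat) / of_nat (2 * l)\<rfloor>)"

definition charge_rank :: "nat \<Rightarrow> int list \<Rightarrow> int" where
  "charge_rank l s =
     (let Y = (\<Sum>i<l. \<Sum>j\<in>{..<l} - {i}. s ! i * (s ! i - s ! j))
      in \<lceil>(of_int (Y - int l + 1) :: rat) / of_nat (2 * l)\<rceil>)"

text \<open>
  No charge is lost by recording only the exponents \<open>n \<ge> 0\<close>: for charges of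
  sum 1 one has \<open>Y = \<ell> * (\<Sum>i. \<sigma>\<^sub>i\<^sup>2) - 1 \<ge> \<ell> - 1\<close>, so the rank is nonnegative
  and each value is attained finitely often.
\<close>

definition charge_rank_gf1 :: "nat \<Rightarrow> rat fps" where
  "charge_rank_gf1 l =
     Abs_fps (\<lambda>n. of_nat (card {s. length s = l \<and> sum_list s = 1 \<and> charge_rank l s = int n}))"

definition spetsial_core :: "nat \<Rightarrow> nat \<Rightarrow> charged \<Rightarrow> bool" where
  "spetsial_core l d x \<longleftrightarrow>
     charged_partition l x \<and>
     (\<forall>j<l. \<forall>b\<in>symbol_row x j. b - int d \<in> symbol_row x (Suc j mod l))"

text \<open>
  Cyclically permuting the rows of the symbol amounts to permuting the
  partitions and the charge simultaneously.
\<close>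

definition cyclic_orbit :: "charged \<Rightarrow> charged set" where
  "cyclic_orbit x = {(rotate k (fst x), rotate k (snd x)) | k. True}"

definition unipotent_characters :: "nat \<Rightarrow> nat \<Rightarrow> charged set set" where
  "unipotent_characters l n =
     cyclic_orbit ` {x. charged_partition l x \<and> charge_sum x = 1 \<and> symbol_rank l x = int n}"

text \<open>The \<open>\<Phi>\<^sub>e\<close>-cuspidals of the spets of \<open>G(\<ell>, 1, n)\<close>, for \<open>e\<close> a multiple of \<open>\<ell>\<close>.\<close>

definition Phi_cuspidals :: "nat \<Rightarrow> nat \<Rightarrow> nat \<Rightarrow> charged set set" where
  "Phi_cuspidals l e n =
     {X \<in> unipotent_characters l n. \<exists>d. e = d * l \<and> (\<forall>x\<in>X. spetsial_core l d x)}"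

end

theory Submission imports Defs "HOL-Library.Infinite_Set" "HOL-Computational_Algebra.Primes"
begin

text \<open>
  Cyclically shifting the row of an entry \<open>b\<close> of a symbol by \<open>b div
  d\<close> turns the condition that \<open>b - d\<close> lies in the next row into the
  condition that \<open>b - d\<close> lies in the same row. This is a bijection from
  spetsial \<open>d\<close>-cores to families of ordinary \<open>d\<close>-cores with
  arbitrary charge. At each level \<open>b\<close> it merely permutes the rows
  containing \<open>b\<close>, so it preserves the rank and the total charge
  (\<open>twist_bij\<close>). For total charge 1 the rank is the sum of the sizes of the
  partitions plus the rank of the charge (\<open>symbol_rank_eq\<close>,
  \<open>charge_rank_eq\<close>). Hence the generating function of spetsial cores is a
  product, and the factor \<open>1/l\<close> appears because a charge of total 1 has no
  rotational symmetry (\<open>rotate_free\<close>).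

  A cuspidal of rank \<open>n\<close> therefore exists if and only if \<open>2n +
  1\<close> is twice the total size of \<open>l\<close> cores plus a sum of
  \<open>l\<close> squares of integers with sum 1 (\<open>cuspidal_exists_iff\<close>).
  Since only the empty partition is a 1-core, the pairs \<open>(l, d) = (2, 1)\<close>
  and \<open>(3, 1)\<close> miss the ranks 1 and 3. In all other cases a representation
  comes from a theorem on quadratic forms:

  If \<open>l \<ge> 4\<close>, four charges suffice; they are an orthogonal transform of
  \<open>(1, x, y, z)\<close> with \<open>x\<close>, \<open>y\<close>, \<open>z\<close>
  odd, and Gauss's theorem that every number is a sum of three triangular numbers
  applies (\<open>three_triangular\<close>). If \<open>l < 4\<close>, then \<open>d
  \<ge> 2\<close> and two rows suffice. For \<open>d = 2\<close> the sizes of cores are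
  the triangular numbers, and every number has the form \<open>2 * tri i + tri j + tri
  k\<close> (\<open>two_triangular_and_double\<close>). For \<open>d \<ge> 4\<close> the
  same fact, rewritten as the universality of \<open>x^2 + 2 * c^2 + t * (t +
  1)\<close>, is realised on four runners of the abacus. For \<open>d = 3\<close> the
  sizes of cores are the numbers \<open>m\<close> for which \<open>3m + 1\<close> is a
  norm of an Eisenstein integer, and every number is a sum of two such norms
  (\<open>two_norms_universal\<close>).

  Both theorems on triangular numbers come from theta series. The fourth power of
  \<open>\<psi> = \<Sum> q^(tri k)\<close> is the series of divisor sums
  \<open>\<sigma>(2n + 1)\<close> (\<open>psi_4\<close>), and \<open>\<sigma>(N)\<close>
  counts the sublattices of index \<open>N\<close> in the plane. A reduction theory
  picks from each such lattice exactly one reduced basis matrix, up to sign. The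
  determinant of a reduced matrix is a square plus a function of parameters that vary
  independently of it, which exhibits \<open>\<sigma>(2n + 1)\<close> as a coefficient
  of \<open>\<psi>\<close> times an explicit series. Cancelling \<open>\<psi>\<close>
  identifies \<open>\<psi>^3\<close> with that series, whose coefficients are visibly
  positive (\<open>psi_cubed\<close>). A second reduction theory does the same for
  \<open>\<psi>(q)^2 * \<psi>(q^2)\<close> (\<open>psi2_psi_squared\<close>).
\<close>

section \<open>Reflections of integral matrices of odd determinant\<close>

text \<open>
  The tuple \<open>(p, q, r, t)\<close> stands for the matrix with rows \<open>(a,
  x)\<close> and \<open>(y, c)\<close> where \<open>p = x + y\<close>, \<open>q = 2a -
  p\<close>, \<open>r = 2c - p\<close>, \<open>t = x - y\<close>. With \<open>f\<close>
  the binary quadratic form \<open>a u^2 + p u v + c v^2\<close> one has \<open>2 f(u,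
  v) = q u^2 + r v^2 + p (u + v)^2\<close>, so \<open>p\<close>, \<open>q\<close>,
  \<open>r\<close> are the Selling parameters of \<open>f\<close>, and a matrix is
  called reduced if they all have the same sign. In these coordinates
  \<open>qform\<close> is four times the determinant; admissible means that
  \<open>a\<close>, \<open>c\<close>, \<open>x\<close> are odd integers and
  \<open>y\<close> is an even one. The map \<open>mirror\<close> negates the first
  column, and \<open>rot\<close> is the cyclic symmetry of Selling parameters.
\<close>
type_synonym quad = "int \<times> int \<times> int \<times> int"

fun rot :: "quad \<Rightarrow> quad" where "rot (p,q,r,t) = (q,r,p,t)"
fun mirror :: "quad \<Rightarrow> quad" where "mirror (p,q,r,t) = (t, -t-p-q, -t+r+p, p)"
fun qneg :: "quad \<Rightarrow> quad" where "qneg (p,q,r,t) = (-p,-q,-r,-t)"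
fun qform :: "quad \<Rightarrow> int" where "qform (p,q,r,t) = p*q + q*r + r*p + t^2"
fun admissible :: "quad \<Rightarrow> bool" where
  "admissible (p,q,r,t) \<longleftrightarrow> odd p \<and> 4 dvd q-p \<and> 4 dvd r-p \<and> 4 dvd t-p"
fun reduced :: "quad \<Rightarrow> bool" where
  "reduced (p,q,r,t) \<longleftrightarrow> (0<p \<and> 0<q \<and> 0<r) \<or> (p<0 \<and> q<0 \<and> r<0)"
text \<open>
  The reflection \<open>mirror\<close> is called an improvement of \<open>v\<close> if
  it moves \<open>v\<close> towards the reduced matrices. The sign conditions are chosen
  such that every edge of the reflection graph improves one of its ends, and every
  matrix that is not reduced has exactly one improving reflection. As improvements
  terminate, the graph is a forest whose roots are the reduced matrices.
\<close>
fun towards :: "quad \<Rightarrow> bool" where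
  "towards (p,q,r,t) \<longleftrightarrow>
     (if 0 < t then (p<0 \<and> 0<r \<and> 0<r+p) \<or> (0<p \<and> q<0 \<and> p+q<0)
      else (0<p \<and> r<0 \<and> r+p<0) \<or> (p<0 \<and> 0<q \<and> 0<p+q))"

definition median :: "int \<Rightarrow> int \<Rightarrow> int \<Rightarrow> int" where
  "median a b c = max (min a b) (min (max a b) c)"
fun size_sum :: "quad \<Rightarrow> nat" where
  "size_sum (p,q,r,t) = nat (\<bar>p\<bar> + \<bar>q\<bar> + \<bar>r\<bar> + \<bar>t\<bar>)"
fun size_mid :: "quad \<Rightarrow> nat" where
  "size_mid (p,q,r,t) = nat (median \<bar>p\<bar> \<bar>q\<bar> \<bar>r\<bar> + \<bar>t\<bar>)"

lemma admissible_nz: assumes "admissible (p,q,r,t)"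
  shows "p \<noteq> 0" "q \<noteq> 0" "r \<noteq> 0" "t \<noteq> 0" "p+q \<noteq> 0" "q+r \<noteq> 0" "r+p \<noteq> 0"
  using assms by (simp_all; presburger)+

lemma admissible_mirror: "admissible v \<Longrightarrow> admissible (mirror v)"
  by (cases v; simp; presburger)
lemma admissible_rot: "admissible (rot v) \<longleftrightarrow> admissible v"
  by (cases v; simp; presburger)
lemma admissible_qneg: "admissible (qneg v) \<longleftrightarrow> admissible v"
  by (cases v; simp; presburger)
lemma mirror_mirror: "mirror (mirror v) = v" by (cases v) simp
lemma rot3: "rot (rot (rot v)) = v" by (cases v) simp
lemma qform_mirror: "qform (mirror v) = - qform v" by (cases v) (simp add: algebra_simps power2_eq_square)
lemma qform_rot: "qform (rot v) = qform v" by (cases v) (simp add: algebra_simps power2_eq_square)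

lemma towards_mirror: assumes "admissible v" "\<not> towards v" shows "towards (mirror v)"
proof -
  obtain p q r t where v: "v = (p,q,r,t)" by (cases v)
  note nz = admissible_nz[OF assms(1)[unfolded v]]
  show ?thesis
  proof (cases "0 < t")
    case True then show ?thesis using assms(2) nz unfolding v by (cases "0 < p") auto
  next
    case False then show ?thesis using assms(2) nz unfolding v by (cases "0 < p") auto
  qed
qed
lemma towards_not_reduced: "towards v \<Longrightarrow> \<not> reduced v"
  by (cases v) (auto split: if_splits)
lemma towards_exists: assumes "admissible v" "\<not> reduced v"
  shows "towards v \<or> towards (rot v) \<or> towards (rot (rot v))"
proof -
  obtain p q r t where v: "v = (p,q,r,t)" by (cases v)
  note nz = admissible_nz[OF assms(1)[unfolded v]]
  have "(p < 0 \<or> 0 < p) \<and> (q < 0 \<or> 0 < q) \<and> (r < 0 \<or> 0 < r) \<and>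
    (p+q < 0 \<or> 0 < p+q) \<and> (q+r < 0 \<or> 0 < q+r) \<and> (r+p < 0 \<or> 0 < r+p)"
    using nz by linarith
  then show ?thesis using assms(2) unfolding v
    by (cases "0 < t") (simp_all only: towards.simps reduced.simps rot.simps if_True if_False, blast+)
qed
lemma towards_unique: assumes "towards v" shows "\<not> towards (rot v)" "\<not> towards (rot (rot v))"
proof -
  obtain p q r t where v: "v = (p,q,r,t)" by (cases v)
  show "\<not> towards (rot v)" using assms unfolding v by (cases "0 < t") auto
  show "\<not> towards (rot (rot v))" using assms unfolding v by (cases "0 < t") auto
qed

lemma median_le: "a \<le> k \<Longrightarrow> b \<le> k \<Longrightarrow> median a b c \<le> k" "a \<le> k \<Longrightarrow> c \<le> k \<Longrightarrow> median a b c \<le> k"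
  "b \<le> k \<Longrightarrow> c \<le> k \<Longrightarrow> median a b c \<le> k" by (auto simp: median_def)
lemma median_ge: "k \<le> a \<Longrightarrow> k \<le> b \<Longrightarrow> k \<le> median a b c" "k \<le> a \<Longrightarrow> k \<le> c \<Longrightarrow> k \<le> median a b c"
  "k \<le> b \<Longrightarrow> k \<le> c \<Longrightarrow> k \<le> median a b c" by (auto simp: median_def)

text \<open>
  The estimate behind the descent for one sign pattern, \<open>p\<close> and
  \<open>q\<close> being the absolute values of two Selling parameters of opposite sign.
  The sum of all absolute values grows if \<open>t\<close> is large, hence the median
  plus \<open>t\<close> is compared first.
\<close>
lemma descent_aux:
  fixes p q b t :: int
  assumes "0 < p" "p < q" "0 < t" "b \<noteq> p" "q - p \<noteq> t" "\<not> (0 < p-b-t \<and> 0 < q-p-t)"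
  shows "median \<bar>t\<bar> \<bar>p-b-t\<bar> \<bar>q-p-t\<bar> + p < median p \<bar>b\<bar> q + t \<or>
    (median \<bar>t\<bar> \<bar>p-b-t\<bar> \<bar>q-p-t\<bar> + p = median p \<bar>b\<bar> q + t \<and>
      \<bar>t\<bar> + \<bar>p-b-t\<bar> + \<bar>q-p-t\<bar> + p < p + \<bar>b\<bar> + q + t)"
  (is "?G < ?H \<or> (?G = ?H \<and> ?K < ?L)")
proof -
  have H: "p + t \<le> ?H" using median_ge(2)[of p p q "\<bar>b\<bar>"] assms by simp
  consider (a) "q - p < t" | (b) "t < q - p" "b < p" | (c) "t < q-p" "p < b" "b \<le> q" | (d) "t < q-p" "q < b" using assms(4,5) by linarith
  then show ?thesis
  proof cases
    case a
    have "?G \<le> t + p" using median_le(2)[of "\<bar>t\<bar>" t "\<bar>q-p-t\<bar>" "\<bar>p-b-t\<bar>"] a assms by simp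
    moreover have "?K < ?L" if "?G = ?H"
    proof -
      have "?H = p + t" using that H \<open>?G \<le> t + p\<close> by simp
      then have "\<bar>b\<bar> \<le> p" using median_ge(1)[of "p+1" q "\<bar>b\<bar>" p] assms by (auto simp: median_def)
      moreover have "t \<le> \<bar>p-b-t\<bar>" using that \<open>?H = p+t\<close> a assms
          median_le(3)[of "\<bar>p-b-t\<bar>" "t-1" "\<bar>q-p-t\<bar>" "\<bar>t\<bar>"] by linarith
      ultimately show ?thesis using a assms by (auto simp: abs_if split: if_splits)
    qed
    ultimately show ?thesis using H by linarith
  next
    case b
    have "\<bar>p-b-t\<bar> \<le> t" using b assms by auto
    then have "?G \<le> t + p" using median_le(1)[of "\<bar>t\<bar>" t "\<bar>p-b-t\<bar>" "\<bar>q-p-t\<bar>"] assms by simp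
    moreover have "?K < ?L" using b assms \<open>\<bar>p-b-t\<bar> \<le> t\<close> by (auto simp: abs_if split: if_splits)
    ultimately show ?thesis using H by linarith
  next
    case c
    have "?G \<le> b + t" using median_le(1)[of "\<bar>t\<bar>" "b-p+t" "\<bar>p-b-t\<bar>" "\<bar>q-p-t\<bar>"] c assms by simp
    moreover have "b + t \<le> ?H" using median_ge(3)[of b "\<bar>b\<bar>" q p] c assms by simp
    moreover have "?K < ?L" using c assms by (auto simp: abs_if split: if_splits)
    ultimately show ?thesis by linarith
  next
    case d
    have "?G < q + t" using median_le(2)[of "\<bar>t\<bar>" "q-p+t-1" "\<bar>q-p-t\<bar>" "\<bar>p-b-t\<bar>"] d assms by simp
    moreover have "q + t \<le> ?H" using median_ge(3)[of q "\<bar>b\<bar>" q p] d assms by simp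
    ultimately show ?thesis by linarith
  qed
qed

lemma descent_aux':
  fixes p q b t :: int
  assumes "0 < p" "p < q" "0 < t" "b \<noteq> p" "q - p \<noteq> t" "\<not> (0 < p-b-t \<and> 0 < q-p-t)"
    "B = \<bar>b\<bar>" "X = \<bar>p-b-t\<bar>" "Y = \<bar>q-p-t\<bar>"
  shows "median t X Y + p < median p B q + t \<or>
    (median t X Y + p = median p B q + t \<and> t + X + Y + p < p + B + q + t)"
  using descent_aux[OF assms(1-6)] assms(3,7-9) by simp

lemma median_swap: "median a b c = median a c b" by (auto simp: median_def)

lemma nat_lex: fixes g h k l :: int
  assumes "g < h \<or> (g = h \<and> k < l)" "0 < h" "0 < l"
  shows "nat g < nat h \<or> (nat g = nat h \<and> nat k < nat l)"
  using assms by auto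

text \<open>
  The four sign patterns for which \<open>mirror\<close> is an improvement reduce to one
  of them by reversing signs and exchanging the second and third parameters.
\<close>
lemma descent: assumes "admissible v" "towards v" "\<not> reduced (mirror v)"
  shows "size_mid (mirror v) < size_mid v \<or> (size_mid (mirror v) = size_mid v \<and> size_sum (mirror v) < size_sum v)"
proof -
  obtain p q r t where v: "v = (p,q,r,t)" by (cases v)
  note nz = admissible_nz[OF assms(1)[unfolded v]]
  have nz2: "t+p+q \<noteq> 0" "-t+r+p \<noteq> 0" using assms(1) unfolding v by (simp; presburger)+
  consider "t > 0" "p<0 \<and> 0<r \<and> 0<r+p" | "t > 0" "0<p \<and> q<0 \<and> p+q<0"
    | "t < 0" "0<p \<and> r<0 \<and> r+p<0" | "t < 0" "p<0 \<and> 0<q \<and> 0<p+q" using assms(2) nz(4) unfolding v by (cases "0 < t") (simp_all, blast+)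
  then have "median \<bar>t\<bar> \<bar>-t-p-q\<bar> \<bar>-t+r+p\<bar> + \<bar>p\<bar> < median \<bar>p\<bar> \<bar>q\<bar> \<bar>r\<bar> + \<bar>t\<bar> \<or>
    (median \<bar>t\<bar> \<bar>-t-p-q\<bar> \<bar>-t+r+p\<bar> + \<bar>p\<bar> = median \<bar>p\<bar> \<bar>q\<bar> \<bar>r\<bar> + \<bar>t\<bar> \<and>
     \<bar>t\<bar> + \<bar>-t-p-q\<bar> + \<bar>-t+r+p\<bar> + \<bar>p\<bar> < \<bar>p\<bar> + \<bar>q\<bar> + \<bar>r\<bar> + \<bar>t\<bar>)"
    (is "median ?T ?X ?Y + ?A < median ?A ?B ?C + ?T \<or> _")
  proof cases
    case 1
    have e: "?A = -p" "?C = r" "?T = t" using 1 by auto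
    have n: "\<not> (0 < ?A - (q) - ?T \<and> 0 < ?C - ?A - ?T)" using assms(3) 1 unfolding v e by auto
    have "median ?T ?X ?Y + ?A < median ?A ?B ?C + ?T \<or>
      (median ?T ?X ?Y + ?A = median ?A ?B ?C + ?T \<and> ?T + ?X + ?Y + ?A < ?A + ?B + ?C + ?T)"
      by (rule descent_aux'[OF _ _ _ _ _ n]) (insert 1 nz nz2, unfold e, (linarith | simp add: algebra_simps)+)
    then show ?thesis by linarith
  next
    case 2
    have e: "?A = p" "?B = -q" "?T = t" using 2 by auto
    have n: "\<not> (0 < ?A - (-r) - ?T \<and> 0 < ?B - ?A - ?T)" using assms(3) 2 unfolding v e by auto
    have "median ?T ?Y ?X + ?A < median ?A ?C ?B + ?T \<or>
      (median ?T ?Y ?X + ?A = median ?A ?C ?B + ?T \<and> ?T + ?Y + ?X + ?A < ?A + ?C + ?B + ?T)"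
      by (rule descent_aux'[OF _ _ _ _ _ n]) (insert 2 nz nz2, unfold e, (linarith | simp add: algebra_simps)+)
    then show ?thesis unfolding median_swap[of ?T ?X ?Y] median_swap[of ?A ?B ?C]
      by linarith
  next
    case 3
    have e: "?A = p" "?C = -r" "?T = -t" using 3 by auto
    have n: "\<not> (0 < ?A - (-q) - ?T \<and> 0 < ?C - ?A - ?T)" using assms(3) 3 unfolding v e by auto
    have "median ?T ?X ?Y + ?A < median ?A ?B ?C + ?T \<or>
      (median ?T ?X ?Y + ?A = median ?A ?B ?C + ?T \<and> ?T + ?X + ?Y + ?A < ?A + ?B + ?C + ?T)"
      by (rule descent_aux'[OF _ _ _ _ _ n]) (insert 3 nz nz2, unfold e, (linarith | simp add: algebra_simps)+)
    then show ?thesis by linarith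
  next
    case 4
    have e: "?A = -p" "?B = q" "?T = -t" using 4 by auto
    have n: "\<not> (0 < ?A - (r) - ?T \<and> 0 < ?B - ?A - ?T)" using assms(3) 4 unfolding v e by auto
    have "median ?T ?Y ?X + ?A < median ?A ?C ?B + ?T \<or>
      (median ?T ?Y ?X + ?A = median ?A ?C ?B + ?T \<and> ?T + ?Y + ?X + ?A < ?A + ?C + ?B + ?T)"
      by (rule descent_aux'[OF _ _ _ _ _ n]) (insert 4 nz nz2, unfold e, (linarith | simp add: algebra_simps)+)
    then show ?thesis unfolding median_swap[of ?T ?X ?Y] median_swap[of ?A ?B ?C]
      by linarith
  qed
  moreover have "0 \<le> median ?A ?B ?C" "0 < ?T" "0 \<le> ?A + ?B + ?C" using nz median_ge(1)[of 0 ?A ?B ?C] by simp_all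
  then have "0 < median ?A ?B ?C + ?T" and "0 < ?A + ?B + ?C + ?T" by (auto intro: add_nonneg_pos)
  ultimately show ?thesis unfolding v mirror.simps size_mid.simps size_sum.simps by (rule nat_lex)
qed

section \<open>Normal forms under the reflections\<close>

definition eq_pm :: "quad \<Rightarrow> quad \<Rightarrow> bool" where "eq_pm v w \<longleftrightarrow> v = w \<or> v = qneg w"

lemma qneg_qneg [simp]: "qneg (qneg v) = v" by (cases v) simp
lemma eq_pm_refl [simp]: "eq_pm v v" by (simp add: eq_pm_def)
lemma eq_pm_sym: "eq_pm v w \<Longrightarrow> eq_pm w v" by (auto simp: eq_pm_def)
lemma eq_pm_trans [trans]: "eq_pm u v \<Longrightarrow> eq_pm v w \<Longrightarrow> eq_pm u w" by (auto simp: eq_pm_def)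

text \<open>
  The conjugates of \<open>mirror\<close> by the cyclic symmetry. On matrices, the
  columns \<open>(u, v)\<close> become \<open>(u, 2u - v)\<close> and \<open>(u - 2v,
  -v)\<close>, respectively; all three reflections preserve the lattice spanned by the
  columns and negate the determinant.
\<close>
definition mirror1 :: "quad \<Rightarrow> quad" where "mirror1 v = rot (rot (mirror (rot v)))"
definition mirror2 :: "quad \<Rightarrow> quad" where "mirror2 v = rot (mirror (rot (rot v)))"

lemma mirror1_mirror1: "mirror1 (mirror1 v) = v" by (simp add: mirror1_def rot3 mirror_mirror)
lemma mirror2_mirror2: "mirror2 (mirror2 v) = v" by (simp add: mirror2_def rot3 mirror_mirror)
lemma mirror_qneg: "mirror (qneg v) = qneg (mirror v)" by (cases v) simp
lemma rot_qneg: "rot (qneg v) = qneg (rot v)" by (cases v) simp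

definition step :: "quad \<Rightarrow> quad" where
  "step v = (if towards v then mirror v else if towards (rot v) then mirror1 v else mirror2 v)"

lemma reduced_rot [simp]: "reduced (rot v) = reduced v" by (cases v) auto
lemma median_rot: "median b c a = median a b c" by (auto simp: median_def)
lemma size_rot [simp]: "size_mid (rot v) = size_mid v" "size_sum (rot v) = size_sum v"
  by (cases v; simp; subst median_rot; rule HOL.refl) (cases v; simp add: ac_simps)
lemma reduced_qneg [simp]: "reduced (qneg v) = reduced v" by (cases v) auto
lemma towards_qneg: "admissible v \<Longrightarrow> towards (qneg v) = towards v"
proof -
  assume a: "admissible v"
  obtain p q r t where v: "v = (p,q,r,t)" by (cases v)
  have "t \<noteq> 0" using admissible_nz a v by simp
  then show "towards (qneg v) = towards v" unfolding v by (cases "0 < t") (simp_all, linarith+)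
qed

lemma admissible_mirror1: "admissible v \<Longrightarrow> admissible (mirror1 v)"
  and admissible_mirror2: "admissible v \<Longrightarrow> admissible (mirror2 v)"
  by (simp_all add: mirror1_def mirror2_def admissible_rot admissible_mirror)
lemma admissible_step: "admissible v \<Longrightarrow> admissible (step v)"
  by (simp add: step_def admissible_mirror admissible_mirror1 admissible_mirror2)

lemma step_descent: assumes "admissible v" "\<not> reduced v" "\<not> reduced (step v)"
  shows "size_mid (step v) < size_mid v \<or> (size_mid (step v) = size_mid v \<and> size_sum (step v) < size_sum v)"
proof -
  consider "towards v" "step v = mirror v" | "towards (rot v)" "step v = mirror1 v" | "towards (rot (rot v))" "step v = mirror2 v"
    using towards_exists[OF assms(1,2)] by (metis step_def)
  then show ?thesis
  proof cases
    case 1 then show ?thesis using descent[of v] assms by simp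
  next
    case 2 then show ?thesis using descent[of "rot v"] assms by (simp add: mirror1_def admissible_rot)
  next
    case 3 then show ?thesis using descent[of "rot (rot v)"] assms by (simp add: mirror2_def admissible_rot)
  qed
qed

function nf :: "quad \<Rightarrow> quad" where
  "nf v = (if reduced v \<or> \<not> admissible v then v else nf (step v))"
  by auto
termination
proof (relation "measures [\<lambda>v. if reduced v then 0 else 1, size_mid, size_sum]", goal_cases)
  case 1 show ?case by simp
next
  case (2 v) then show ?case using step_descent[of v] by auto
qed
declare nf.simps [simp del]

lemma nf_reduced: "reduced v \<Longrightarrow> nf v = v" by (subst nf.simps) simp
lemma reduced_nf: "admissible v \<Longrightarrow> reduced (nf v)"
  by (induction v rule: nf.induct) (metis admissible_step nf.simps)
lemma admissible_nf: "admissible v \<Longrightarrow> admissible (nf v)"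
  by (induction v rule: nf.induct) (metis admissible_step nf.simps)
lemma nf_step: "admissible v \<Longrightarrow> \<not> reduced v \<Longrightarrow> nf (step v) = nf v"
  by (subst (2) nf.simps) simp

lemma nf_qneg: "admissible v \<Longrightarrow> nf (qneg v) = qneg (nf v)"
proof (induction v rule: nf.induct)
  case (1 v)
  show ?case
  proof (cases "reduced v")
    case True then show ?thesis by (simp add: nf_reduced)
  next
    case False
    have s: "step (qneg v) = qneg (step v)" using 1(2)
      by (simp add: step_def mirror1_def mirror2_def towards_qneg rot_qneg mirror_qneg admissible_rot)
    have "nf (qneg v) = nf (step (qneg v))" using False 1(2) by (simp add: nf_step admissible_qneg)
    also have "\<dots> = qneg (nf (step v))" using 1 False by (simp add: s admissible_step)
    finally show ?thesis using False 1(2) by (simp add: nf_step)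
  qed
qed

text \<open>
  Of \<open>v\<close> and its image one improves to the other, so both run into the same
  reduced matrix.
\<close>
lemma nf_mirror: assumes "admissible v" shows "nf (mirror v) = nf v"
proof (cases "towards v")
  case True
  then have "step v = mirror v" by (simp add: step_def)
  then show ?thesis using nf_step[OF assms] towards_not_reduced[OF True] by simp
next
  case False
  then have "towards (mirror v)" using towards_mirror assms by blast
  then have "step (mirror v) = v" by (simp add: step_def mirror_mirror)
  then show ?thesis using nf_step[OF admissible_mirror[OF assms]] towards_not_reduced[OF \<open>towards (mirror v)\<close>] by metis
qed

lemma nf_mirror1: assumes "admissible v" shows "nf (mirror1 v) = nf v"
proof -
  have *: "nf (mirror1 w) = nf w" if w: "admissible w" "towards (rot w)" for w
    using nf_step[OF w(1)] towards_not_reduced[OF w(2)] towards_unique(1)[of w] towards_unique(2)[OF w(2)] w(2)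
    by (auto simp: step_def rot3)
  show ?thesis
  proof (cases "towards (rot v)")
    case False
    then have "towards (rot (mirror1 v))" using towards_mirror[of "rot v"] assms by (simp add: mirror1_def rot3 admissible_rot)
    then show ?thesis using *[of "mirror1 v"] assms admissible_mirror1 mirror1_mirror1 by metis
  qed (use * assms in blast)
qed

lemma nf_mirror2: assumes "admissible v" shows "nf (mirror2 v) = nf v"
proof -
  have *: "nf (mirror2 w) = nf w" if w: "admissible w" "towards (rot (rot w))" for w
    using nf_step[OF w(1)] towards_not_reduced[OF w(2)] towards_unique[OF w(2)] w(2)
    by (auto simp: step_def rot3)
  show ?thesis
  proof (cases "towards (rot (rot v))")
    case False
    then have "towards (rot (rot (mirror2 v)))" using towards_mirror[of "rot (rot v)"] assms by (simp add: mirror2_def rot3 admissible_rot)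
    then show ?thesis using *[of "mirror2 v"] assms admissible_mirror2 mirror2_mirror2 by metis
  qed (use * assms in blast)
qed

section \<open>Hermite normal forms and the count of reduced matrices\<close>

lemma nf_invariant:
  assumes "admissible v"
  shows "eq_pm (nf (mirror v)) (nf v)" "eq_pm (nf (mirror1 v)) (nf v)" "eq_pm (nf (mirror2 v)) (nf v)" "eq_pm (nf (qneg v)) (nf v)"
  using assms by (auto simp: nf_mirror nf_mirror1 nf_mirror2 nf_qneg eq_pm_def)

lemma qform_qneg: "qform (qneg v) = qform v" by (cases v) simp
lemma qform_mirror1: "qform (mirror1 v) = - qform v" by (simp add: mirror1_def qform_rot qform_mirror)
lemma qform_mirror2: "qform (mirror2 v) = - qform v" by (simp add: mirror2_def qform_rot qform_mirror)

text \<open>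
  Reflections preserve the determinant only up to sign, but a reduced matrix has a
  definite symmetric part and hence positive determinant.
\<close>
lemma qform_nf: assumes "admissible v" "0 < qform v" shows "qform (nf v) = qform v"
proof -
  have *: "\<bar>qform (nf w)\<bar> = \<bar>qform w\<bar>" if "admissible w" for w
    using that
  proof (induction w rule: nf.induct)
    case (1 w)
    show ?case
    proof (cases "reduced w")
      case False
      have "\<bar>qform (step w)\<bar> = \<bar>qform w\<bar>" by (simp add: step_def qform_mirror qform_mirror1 qform_mirror2)
      then show ?thesis using 1 False by (metis nf_step admissible_step)
    qed (simp add: nf_reduced)
  qed
  obtain p q r t where n: "nf v = (p,q,r,t)" by (cases "nf v")
  have "0 < p*q" "0 < q*r" "0 < r*p" using reduced_nf[OF assms(1)] unfolding n by (auto simp: mult_pos_pos mult_neg_neg)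
  then have "0 < qform (nf v)" unfolding n qform.simps using zero_le_power2[of t] by linarith
  then show ?thesis using *[OF assms(1)] assms(2) by linarith
qed

text \<open>
  The lattice spanned by twice the columns of the matrix; the factor 2 avoids divisions.
\<close>
fun lat :: "quad \<Rightarrow> (int \<times> int) set" where
  "lat (p,q,r,t) = range (\<lambda>(i,j). (i*(p+q) + j*(p+t), i*(p-t) + j*(p+r)))"

lemma mirror1_eq: "mirror1 (p,q,r,t) = (-t+p+q, t, -t-q-r, q)" by (simp add: mirror1_def)
lemma mirror2_eq: "mirror2 (p,q,r,t) = (-t-r-p, -t+q+r, t, r)" by (simp add: mirror2_def)

lemma lat_mirror: "lat (mirror v) = lat v"
proof -
  have *: "lat (mirror v) \<subseteq> lat v" for v
  proof -
    obtain p q r t where v: "v = (p,q,r,t)" by (cases v)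
    have "\<exists>i' j'. i*(t+(-t-p-q)) + j*(t+p) = i'*(p+q) + j'*(p+t) \<and> i*(t-p) + j*(t+(-t+r+p)) = i'*(p-t) + j'*(p+r)" for i j
      by (rule exI[of _ "-i"], rule exI[of _ "j"]) (simp add: algebra_simps)
    then show ?thesis unfolding v by (auto simp: image_iff)
  qed
  show ?thesis using *[of v] *[of "mirror v"] mirror_mirror by auto
qed
lemma lat_qneg: "lat (qneg v) = lat v"
proof -
  have *: "lat (qneg v) \<subseteq> lat v" for v
  proof -
    obtain p q r t where v: "v = (p,q,r,t)" by (cases v)
    have "\<exists>i' j'. i*(-p+-q) + j*(-p+-t) = i'*(p+q) + j'*(p+t) \<and> i*(-p- -t) + j*(-p+-r) = i'*(p-t) + j'*(p+r)" for i j
      by (rule exI[of _ "-i"], rule exI[of _ "-j"]) (simp add: algebra_simps)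
    then show ?thesis unfolding v by (auto simp: image_iff)
  qed
  show ?thesis using *[of v] *[of "qneg v"] by auto
qed
lemma lat_mirror1: "lat (mirror1 v) = lat v"
proof -
  have *: "lat (mirror1 v) \<subseteq> lat v" for v
  proof -
    obtain p q r t where v: "v = (p,q,r,t)" by (cases v)
    have "\<exists>i' j'. i*(-t+p+q+t) + j*(-t+p+q+q) = i'*(p+q) + j'*(p+t) \<and> i*(-t+p+q-q) + j*(-t+p+q+(-t-q-r)) = i'*(p-t) + j'*(p+r)" for i j
      by (rule exI[of _ "i+2*j"], rule exI[of _ "-j"]) (simp add: algebra_simps)
    then show ?thesis unfolding v mirror1_eq by (auto simp: image_iff)
  qed
  show ?thesis using *[of v] *[of "mirror1 v"] mirror1_mirror1 by auto
qed
lemma lat_mirror2: "lat (mirror2 v) = lat v"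
proof -
  have *: "lat (mirror2 v) \<subseteq> lat v" for v
  proof -
    obtain p q r t where v: "v = (p,q,r,t)" by (cases v)
    have "\<exists>i' j'. i*(-t-r-p+(-t+q+r)) + j*(-t-r-p+r) = i'*(p+q) + j'*(p+t) \<and> i*(-t-r-p-r) + j*(-t-r-p+t) = i'*(p-t) + j'*(p+r)" for i j
      by (rule exI[of _ "i"], rule exI[of _ "-2*i-j"]) (simp add: algebra_simps)
    then show ?thesis unfolding v mirror2_eq by (auto simp: image_iff)
  qed
  show ?thesis using *[of v] *[of "mirror2 v"] mirror2_mirror2 by auto
qed
lemma lat_nf: "admissible v \<Longrightarrow> lat (nf v) = lat v"
proof (induction v rule: nf.induct)
  case (1 v)
  show ?case
  proof (cases "reduced v")
    case False
    have "lat (step v) = lat v" by (simp add: step_def lat_mirror lat_mirror1 lat_mirror2)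
    then show ?thesis using 1 False by (metis nf_step admissible_step)
  qed (simp add: nf_reduced)
qed

text \<open>
  The upper triangular matrix with diagonal \<open>a\<close>, \<open>N div a\<close> and
  upper right entry \<open>x\<close>.
\<close>
definition hermite :: "nat \<Rightarrow> int \<times> int \<Rightarrow> quad" where
  "hermite N = (\<lambda>(a,x). (x, 2*a-x, 2*(int N div a)-x, x))"
definition hindex :: "nat \<Rightarrow> (int \<times> int) set" where
  "hindex N = {(a,x). 0 < a \<and> a dvd int N \<and> odd x \<and> 0 < x \<and> x < 2*a}"

lemma hermite_props: assumes "odd N" "i \<in> hindex N"
  shows "admissible (hermite N i)" "qform (hermite N i) = 4 * int N"
proof -
  obtain a x where i: "i = (a,x)" by (cases i)
  obtain c where c: "int N = a * c" using assms(2) i by (auto simp: hindex_def)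
  have d: "int N div a = c" using assms(2) c i by (auto simp: hindex_def)
  have "odd a" "odd c" "odd x" using assms c i by (auto simp: hindex_def) (metis even_mult_iff even_of_nat)+
  then show "admissible (hermite N i)" unfolding i hermite_def by (simp add: d) presburger
  show "qform (hermite N i) = 4 * int N" unfolding i hermite_def by (simp add: d c algebra_simps power2_eq_square)
qed

text \<open>
  Shifting the upper right entry by \<open>2a\<close> is a product of two reflections,
  up to sign.
\<close>
lemma nf_shift:
  fixes k :: int
  assumes "odd a" "odd c" "odd x"
  shows "eq_pm (nf (x + 2*a*k, 2*a-(x+2*a*k), 2*c-(x+2*a*k), x+2*a*k)) (nf (x, 2*a-x, 2*c-x, x))"
proof -
  have 1: "eq_pm (nf (x, 2*a-x, 2*c-x, x)) (nf (x-2*a, 2*a-(x-2*a), 2*c-(x-2*a), x-2*a))" if x: "odd x" for x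
  proof -
    have a: "admissible (x, 2*a-x, 2*c-x, x)" using assms x by simp presburger
    have e: "(x-2*a, 2*a-(x-2*a), 2*c-(x-2*a), x-2*a) = mirror (qneg (mirror1 (x, 2*a-x, 2*c-x, x)))"
      by (simp add: mirror1_eq algebra_simps)
    show ?thesis unfolding e using nf_invariant a admissible_mirror1 admissible_qneg eq_pm_trans eq_pm_sym by meson
  qed
  show ?thesis
  proof (induction k rule: int_induct[of _ 0])
    case base then show ?case by simp
  next
    case (step1 k) then show ?case using 1[of "x+2*a*(k+1)"] assms by (simp add: algebra_simps) (meson eq_pm_trans)
  next
    case (step2 k) then show ?case using 1[of "x+2*a*k"] assms by (simp add: algebra_simps) (meson eq_pm_trans eq_pm_sym)
  qed
qed

text \<open>
  Euclid's algorithm on the lower row, whose entries are \<open>(p - t) / 2\<close> and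
  \<open>(p + r) / 2\<close>. They have different parity, so subtracting twice the
  smaller one from the larger one always makes progress until the lower left entry
  vanishes. The steps available are products of at most two reflections, so the reduced
  matrix stays the same.
\<close>
lemma hermite_exists:
  assumes "admissible v" "qform v = 4 * int N" "odd N"
  shows "\<exists>i \<in> hindex N. eq_pm (nf v) (nf (hermite N i))"
proof -
  have *: "\<exists>i \<in> hindex N. eq_pm (nf v) (nf (hermite N i))" if "admissible v" "\<bar>qform v\<bar> = 4 * int N" for v
    using that
  proof (induction "case v of (p,q,r,t) \<Rightarrow> nat (\<bar>p-t\<bar> + \<bar>p+r\<bar>)" arbitrary: v rule: less_induct)
    case less
    obtain p q r t where v: "v = (p,q,r,t)" by (cases v)
    note adm = less(2)
    have IH: "\<exists>i \<in> hindex N. eq_pm (nf v) (nf (hermite N i))"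
      if "eq_pm (nf w) (nf v)" "admissible w" "\<bar>qform w\<bar> = 4 * int N"
        "(case w of (p,q,r,t) \<Rightarrow> nat (\<bar>p-t\<bar> + \<bar>p+r\<bar>)) < (case v of (p,q,r,t) \<Rightarrow> nat (\<bar>p-t\<bar> + \<bar>p+r\<bar>))" for w
      using less(1)[OF that(4,2,3)] that(1) eq_pm_trans eq_pm_sym by meson
    have "4 dvd p-t" "\<not> 4 dvd p+r" using adm unfolding v by (simp_all; presburger)+
    then have nz: "p+r \<noteq> 0" "\<bar>p-t\<bar> \<noteq> \<bar>p+r\<bar>" by (auto, metis dvd_abs_iff)
    have M: "eq_pm (nf (mirror2 (mirror v))) (nf v)" "eq_pm (nf (mirror1 (mirror v))) (nf v)"
      using nf_invariant adm admissible_mirror eq_pm_trans by meson+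
    have A: "admissible (mirror2 (mirror v))" "admissible (mirror1 (mirror v))" "admissible (mirror2 v)" "admissible (mirror1 v)"
      using adm by (simp_all add: admissible_mirror admissible_mirror1 admissible_mirror2)
    have Q: "\<bar>qform (mirror2 (mirror v))\<bar> = 4 * int N" "\<bar>qform (mirror1 (mirror v))\<bar> = 4 * int N"
       "\<bar>qform (mirror2 v)\<bar> = 4 * int N" "\<bar>qform (mirror1 v)\<bar> = 4 * int N"
      using less(3) by (simp_all add: qform_mirror qform_mirror1 qform_mirror2)
    consider (z) "p = t" | (y1) "\<bar>p+r\<bar> < \<bar>p-t\<bar>" "0 < (p-t)*(p+r)" | (y2) "\<bar>p+r\<bar> < \<bar>p-t\<bar>" "(p-t)*(p+r) < 0"
      | (c1) "p \<noteq> t" "\<bar>p-t\<bar> < \<bar>p+r\<bar>" "0 < (p-t)*(p+r)" | (c2) "p \<noteq> t" "\<bar>p-t\<bar> < \<bar>p+r\<bar>" "(p-t)*(p+r) < 0"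
    proof -
      have "p = t \<or> 0 < (p-t)*(p+r) \<or> (p-t)*(p+r) < 0"
        using nz(1) by (metis linorder_neqE_linordered_idom mult_eq_0_iff right_minus_eq)
      moreover have "\<bar>p+r\<bar> < \<bar>p-t\<bar> \<or> \<bar>p-t\<bar> < \<bar>p+r\<bar>" using nz(2) by (rule neqE) blast+
      ultimately show ?thesis using that by blast
    qed
    then show ?case
    proof cases
      case y1
      show ?thesis by (rule IH[OF nf_invariant(3)[OF adm] A(3) Q(3)]) (use y1 in \<open>auto simp: v mirror2_eq zero_less_mult_iff\<close>)
    next
      case y2
      show ?thesis by (rule IH[OF M(1) A(1) Q(1)]) (use y2 in \<open>auto simp: v mirror2_eq mult_less_0_iff\<close>)
    next
      case c1
      show ?thesis by (rule IH[OF nf_invariant(2)[OF adm] A(4) Q(4)]) (use c1 in \<open>auto simp: v mirror1_eq zero_less_mult_iff\<close>)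
    next
      case c2
      show ?thesis by (rule IH[OF M(2) A(2) Q(2)]) (use c2 in \<open>auto simp: v mirror1_eq mult_less_0_iff\<close>)
    next
      case z
      have "p + q = 2 * ((p + q) div 2)" "odd ((p + q) div 2)" "p + r = 2 * ((p + r) div 2)" "odd ((p + r) div 2)"
        using adm unfolding v by (simp_all; presburger)+
      then obtain a c where a: "p + q = 2 * a" "odd a" and c: "p + r = 2 * c" "odd c" by blast
      have od: "odd p" using adm v by simp
      have "qform v = (p+q)*(p+r)" unfolding v z by (simp add: algebra_simps power2_eq_square)
      then have n: "\<bar>a * c\<bar> = int N" using less(3) a c by (simp add: abs_mult)
      \<comment> \<open>Up to reflections and sign both diagonal entries may be taken positive.\<close>
      obtain a' c' x' where w: "eq_pm (nf (x', 2*a'-x', 2*c'-x', x')) (nf v)" "odd a'" "odd c'" "odd x'" "0 < a'" "0 < c'" "a' * c' = int N"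
      proof -
        have vv: "v = (p, 2*a-p, 2*c-p, p)" using a c z v by auto
        have neg: "eq_pm (nf (-p, 2*(-a)-(-p), 2*(-c)-(-p), -p)) (nf v)"
          using nf_invariant(4)[OF adm] by (simp add: vv)
        have "mirror v = (p, 2*(-a)-p, 2*c-p, p)" by (simp add: vv)
        then have m: "eq_pm (nf (p, 2*(-a)-p, 2*c-p, p)) (nf v)"
          using nf_invariant(1)[OF adm] by simp
        have mn: "eq_pm (nf (-p, 2*a-(-p), 2*(-c)-(-p), -p)) (nf v)"
          using nf_invariant(4)[OF admissible_mirror[OF adm]] nf_invariant(1)[OF adm] eq_pm_trans by (simp add: vv)
        have nz: "a \<noteq> 0" "c \<noteq> 0" using a c by auto
        consider "a > 0" "c > 0" | "a < 0" "c < 0" | "a < 0" "c > 0" | "a > 0" "c < 0" using nz by linarith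
        then show ?thesis
        proof cases
          case 1 then show ?thesis using that[of p a c] n a c od by (auto simp: vv abs_mult)
        next case 2 then show ?thesis using that[OF neg] n a c od by (auto simp: abs_mult)
        next case 3 then show ?thesis using that[OF m] n a c od by (auto simp: abs_mult)
        next case 4 then show ?thesis using that[OF mn] n a c od by (auto simp: abs_mult)
        qed
      qed
      define x where "x = x' mod (2*a')"
      have x: "x' = x + 2*a'*(x' div (2*a'))" by (simp add: x_def)
      have ox: "odd x" using w(4) x by (metis even_add even_mult_iff even_numeral)
      then have xx: "0 < x" "x < 2*a'" using w(5) pos_mod_sign[of "2*a'" x'] pos_mod_bound[of "2*a'" x'] unfolding x_def[symmetric] by (cases "x = 0"; auto)+
      have "eq_pm (nf (x', 2*a'-x', 2*c'-x', x')) (nf (x, 2*a'-x, 2*c'-x, x))"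
        using nf_shift[OF w(2,3) ox, of "x' div (2*a')"] x by metis
      moreover have "hermite N (a', x) = (x, 2*a'-x, 2*c'-x, x)" using w(5,7) unfolding hermite_def by (auto simp flip: w(7))
      moreover have "(a',x) \<in> hindex N" using w xx ox by (auto simp: hindex_def simp flip: w(7))
      ultimately show ?thesis using w(1) eq_pm_trans eq_pm_sym by metis
    qed
  qed
  show ?thesis using *[of v] assms by simp
qed

lemma lat_eq_pm: "eq_pm v w \<Longrightarrow> lat v = lat w" by (auto simp: eq_pm_def lat_qneg)

text \<open>
  The lattice of columns is an invariant, and a triangular matrix is recovered from it.
\<close>
lemma hermite_unique:
  assumes "odd N" "i \<in> hindex N" "j \<in> hindex N" "eq_pm (nf (hermite N i)) (nf (hermite N j))"
  shows "i = j"
proof -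
  have L: "lat (hermite N i) = lat (hermite N j)" using lat_eq_pm[OF assms(4)] lat_nf hermite_props(1) assms by simp
  \<comment> \<open>Comparison of the two bases; by symmetry one inclusion suffices.\<close>
  have key: "\<exists>k l. a = k * a' \<and> c = l * c' \<and> (\<exists>m. x = m * a' + l * x')"
    if ij: "{(a,x),(a',x')} \<subseteq> hindex N" "int N = a * c" "int N = a' * c'" "lat (hermite N (a,x)) \<subseteq> lat (hermite N (a',x'))" for a x a' x' c c'
  proof -
    have pos: "a > 0" "a' > 0" using ij(1) by (auto simp: hindex_def)
    then have pos': "c' > 0" using ij(3) assms(1) by (metis odd_pos of_nat_0_less_iff zero_less_mult_pos)
    have h: "hermite N (a,x) = (x, 2*a-x, 2*c-x, x)" "hermite N (a',x') = (x', 2*a'-x', 2*c'-x', x')"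
      using pos unfolding hermite_def by (simp add: ij(2), simp add: ij(3))
    have "(1*(x+(2*a-x)) + 0*(x+x), 1*(x-x) + 0*(x+(2*c-x))) \<in> lat (hermite N (a,x))" unfolding h lat.simps by (rule range_eqI[of _ _ "(1,0)"]) simp
    then obtain k m where k: "2*a = 2*k*a' + 2*m*x'" "0 = 2*m*c'" using subsetD[OF ij(4)] unfolding h(2) by (fastforce simp: algebra_simps)
    have "(0*(x+(2*a-x)) + 1*(x+x), 0*(x-x) + 1*(x+(2*c-x))) \<in> lat (hermite N (a,x))" unfolding h lat.simps by (rule range_eqI[of _ _ "(0,1)"]) simp
    then obtain r l where r: "2*x = 2*r*a' + 2*l*x'" "2*c = 2*l*c'" using subsetD[OF ij(4)] unfolding h(2) by (fastforce simp: algebra_simps)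
    have "x = r * a' + l * x'" using r(1) by (simp add: algebra_simps)
    moreover have "a = k * a'" "c = l * c'" using k r(2) pos' by auto
    ultimately show ?thesis by blast
  qed
  obtain a x a' x' where i: "i = (a,x)" "j = (a',x')" by (cases i; cases j)
  have "a dvd int N" "a' dvd int N" using assms(2,3) i by (auto simp: hindex_def)
  then obtain c c' where c: "int N = a * c" "int N = a' * c'" unfolding dvd_def by blast
  have N: "0 < int N" using assms(1) by (simp add: odd_pos)
  have pos: "a > 0" "a' > 0" using assms i by (auto simp: hindex_def)
  then have pos2: "c > 0" "c' > 0" using c N by (metis zero_less_mult_pos)+
  obtain k l m where 1: "a = k * a'" "c = l * c'" "x = m * a' + l * x'" using key[of a x a' x' c c'] assms i c L by auto
  have "k > 0" "l > 0" using 1 pos pos2 by (metis zero_less_mult_pos2)+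
  have "k * l * (a' * c') = a' * c'" using c 1 by (simp add: ac_simps)
  then have "k * l = 1" using pos pos2 by simp
  then have kl: "k = 1" "l = 1" using \<open>k > 0\<close> \<open>l > 0\<close> by (auto simp: zmult_eq_1_iff)
  have aa: "a = a'" "x = m * a' + x'" using 1 kl by auto
  have "odd a'" using c assms(1) by (metis even_mult_iff even_of_nat)
  have xs: "odd x" "odd x'" "0 < x" "x < 2*a'" "0 < x'" "x' < 2*a'" using assms(2,3) i aa by (auto simp: hindex_def)
  have "even m" using aa xs \<open>odd a'\<close> by (metis even_add even_mult_iff)
  then obtain n where "m = 2*n" by auto
  then have "x = n * (2*a') + x'" using aa by simp
  then have "n * (2*a') < 1 * (2*a')" "(-1) * (2*a') < n * (2*a')" using xs by linarith+
  then have "n = 0" using pos by (simp only: mult_less_cancel_right) auto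
  then show ?thesis using aa i \<open>m = 2*n\<close> by simp
qed

definition positive_reduced :: "nat \<Rightarrow> quad set" where
  "positive_reduced N = {v. admissible v \<and> qform v = 4 * int N \<and> reduced v \<and> 0 < fst v}"

text \<open>
  Reduced matrices come in pairs of opposite sign; this picks one of them.
\<close>
definition pos_rep :: "quad \<Rightarrow> quad" where "pos_rep v = (if 0 < fst v then v else qneg v)"

text \<open>
  Together, existence and uniqueness say that every class under the reflections contains
  exactly one positive reduced matrix and exactly one Hermite normal form.
\<close>
theorem positive_reduced_bij: assumes "odd N" shows "bij_betw (\<lambda>i. pos_rep (nf (hermite N i))) (hindex N) (positive_reduced N)"
proof -
  have s: "eq_pm (pos_rep v) v" for v by (simp add: pos_rep_def eq_pm_def)
  have u: "v = w" if "eq_pm v w" "0 < fst v" "0 < fst w" for v w using that by (cases w) (auto simp: eq_pm_def)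
  have p: "0 < fst (pos_rep v)" if "reduced v" for v using that by (cases v) (auto simp: pos_rep_def)
  show ?thesis
  proof (rule bij_betwI')
    fix i j assume i: "i \<in> hindex N" "j \<in> hindex N"
    show "(pos_rep (nf (hermite N i)) = pos_rep (nf (hermite N j))) = (i = j)"
      using hermite_unique[OF assms i] s eq_pm_trans eq_pm_sym by metis
  next
    fix i assume i: "i \<in> hindex N"
    have "admissible (pos_rep (nf (hermite N i)))" "reduced (pos_rep (nf (hermite N i)))" "qform (pos_rep (nf (hermite N i))) = 4 * int N"
      using hermite_props[OF assms i] admissible_nf reduced_nf qform_nf assms by (auto simp: pos_rep_def admissible_qneg qform_qneg odd_pos)
    then show "pos_rep (nf (hermite N i)) \<in> positive_reduced N" using p reduced_nf hermite_props[OF assms i] by (auto simp: positive_reduced_def)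
  next
    fix v assume v: "v \<in> positive_reduced N"
    then obtain i where i: "i \<in> hindex N" "eq_pm (nf v) (nf (hermite N i))" using hermite_exists[of v N] assms by (auto simp: positive_reduced_def)
    have "nf v = v" using v by (simp add: nf_reduced positive_reduced_def)
    then have "eq_pm v (pos_rep (nf (hermite N i)))" using i(2) s eq_pm_trans eq_pm_sym by metis
    then have "v = pos_rep (nf (hermite N i))" using u p reduced_nf hermite_props(1)[OF assms i(1)] v by (auto simp: positive_reduced_def)
    then show "\<exists>i\<in>hindex N. v = pos_rep (nf (hermite N i))" using i(1) by blast
  qed
qed

section \<open>A second reduction theory, for an even off-diagonal product\<close>

text \<open>
  Here \<open>(a, c, s, t)\<close> stands for the matrix with rows \<open>(a,
  2x)\<close> and \<open>(y, c)\<close> where \<open>s = x + y\<close> and \<open>t = x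
  - y\<close>, and \<open>disc\<close> is twice its determinant. The involutions
  \<open>sideA\<close> and \<open>sideB\<close> commute up to sign, so they span squares
  \<open>v\<close>, \<open>sideA v\<close>, \<open>sideB v\<close>, \<open>sideA (sideB
  v)\<close>; their conjugates by \<open>flip\<close>, which negates the off-diagonal
  entries, span a second square at every matrix. Every square has exactly one gate up to
  sign, every matrix is a gate of one of its two squares at least, and it is reduced if
  it is a gate of both. The squares therefore form a forest rooted at the reduced
  matrices.
\<close>
fun sideA :: "quad \<Rightarrow> quad" where "sideA (a,c,s,t) = (a, s-t-c, a-t, a-s)"
fun sideB :: "quad \<Rightarrow> quad" where "sideB (a,c,s,t) = (a-s-t, -c, -t-c, c-s)"
fun flip :: "quad \<Rightarrow> quad" where "flip (a,c,s,t) = (a,c,-s,-t)"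
fun disc :: "quad \<Rightarrow> int" where "disc (a,c,s,t) = 2*a*c - s^2 + t^2"
fun adm2 :: "quad \<Rightarrow> bool" where
  "adm2 (a,c,s,t) \<longleftrightarrow> odd a \<and> odd c \<and> even (s-t) \<and> (0 < disc (a,c,s,t) \<longleftrightarrow> even s)"
fun gate :: "quad \<Rightarrow> bool" where
  "gate (a,c,s,t) \<longleftrightarrow> (0 < a \<and> 0 < c \<and> s < a \<and> s < c) \<or> (a < 0 \<and> c < 0 \<and> a < s \<and> c < s)
     \<or> (a < 0 \<and> 0 < c \<and> 0 < t) \<or> (c < 0 \<and> 0 < a \<and> t < 0)"

lemma sideA_sideA: "sideA (sideA v) = v" by (cases v) simp
lemma sideB_sideB: "sideB (sideB v) = v" by (cases v) simp
lemma sideB_sideA: "sideB (sideA v) = qneg (sideA (sideB v))" by (cases v) simp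
lemma flip_flip [simp]: "flip (flip v) = v" by (cases v) simp
lemma side_qneg: "sideA (qneg v) = qneg (sideA v)" "sideB (qneg v) = qneg (sideB v)" "flip (qneg v) = qneg (flip v)"
  by (cases v; simp)+
lemma gate_qneg [simp]: "gate (qneg v) = gate v" by (cases v) auto
lemma disc_simps [simp]: "disc (qneg v) = disc v" "disc (sideA v) = - disc v" "disc (sideB v) = - disc v" "disc (flip v) = disc v"
  by (cases v; simp add: algebra_simps power2_eq_square)+

lemma disc_nz: "odd a \<Longrightarrow> odd c \<Longrightarrow> even (s-t) \<Longrightarrow> disc (a,c,s,t) \<noteq> 0"
proof -
  assume h: "odd a" "odd c" "even (s-t)"
  then obtain k where "s - t = 2*k" by (elim evenE)
  then have "s = t + 2*k" by simp
  then have "disc (a,c,s,t) = 2*(a*c - 2*(k*t + k^2))" by (simp add: algebra_simps power2_eq_square)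
  moreover have "a*c - 2*(k*t + k^2) \<noteq> 0"
  proof
    assume "a*c - 2*(k*t + k^2) = 0"
    then have "a * c = 2*(k*t + k^2)" by simp
    then show False using h by (metis dvd_triv_left even_mult_iff)
  qed
  ultimately show ?thesis by (simp only: mult_eq_0_iff) simp
qed
lemma adm2_simps: "adm2 (qneg v) = adm2 v" "adm2 (flip v) = adm2 v"
proof -
  obtain a c s t where v: "v = (a,c,s,t)" by (cases v)
  show "adm2 (qneg v) = adm2 v" using disc_simps(1)[of v] unfolding v by (auto simp del: disc.simps)
  show "adm2 (flip v) = adm2 v" using disc_simps(4)[of v] unfolding v by (auto simp del: disc.simps)
qed
lemma adm2_sideA: "adm2 v \<Longrightarrow> adm2 (sideA v)"
proof -
  assume h: "adm2 v"
  obtain a c s t where v: "v = (a,c,s,t)" by (cases v)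
  have "disc (sideA v) = - disc v" by simp
  moreover have "disc v \<noteq> 0" using disc_nz[of a c s t] h unfolding v by (simp del: disc.simps)
  ultimately show ?thesis using h unfolding v by (auto simp del: disc.simps)
qed
lemma adm2_sideB: "adm2 v \<Longrightarrow> adm2 (sideB v)"
proof -
  assume h: "adm2 v"
  obtain a c s t where v: "v = (a,c,s,t)" by (cases v)
  have "disc (sideB v) = - disc v" by simp
  moreover have "disc v \<noteq> 0" using disc_nz[of a c s t] h unfolding v by (simp del: disc.simps)
  ultimately show ?thesis using h unfolding v by (auto simp del: disc.simps)
qed

lemma gate_unique:
  assumes "gate v" shows "\<not> gate (sideA v)" "\<not> gate (sideB v)" "\<not> gate (sideA (sideB v))"
proof -
  obtain a c s t where v: "v = (a,c,s,t)" by (cases v)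
  show "\<not> gate (sideA v)" "\<not> gate (sideB v)" "\<not> gate (sideA (sideB v))" using assms unfolding v by auto
qed

lemma sq_mono_abs: "\<bar>x\<bar> \<le> \<bar>y\<bar> \<Longrightarrow> x\<^sup>2 \<le> (y::int)\<^sup>2" by (simp add: abs_le_square_iff)

text \<open>
  The determinant of a matrix excludes the sign patterns in which no corner of the
  square would be a gate. It enters in the form \<open>disc v = t^2 + k^2 - u^2 -
  w^2\<close>, where the four squares are permuted by \<open>sideA\<close> and
  \<open>sideB\<close> up to the overall sign.
\<close>
lemma gate_exists:
  assumes "adm2 v" shows "gate v \<or> gate (sideA v) \<or> gate (sideB v) \<or> gate (sideA (sideB v))"
proof -
  obtain a c s t where v: "v = (a,c,s,t)" by (cases v)
  define k where "k = a + c - s"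
  define u where "u = a - s"
  define w where "w = c - s"
  \<comment> \<open>The representation of \<open>disc\<close> on which the sides act by permuting squares.\<close>
  have d: "disc v = t^2 + k^2 - u^2 - w^2" unfolding v by (simp add: k_def u_def w_def algebra_simps power2_eq_square)
  have s: "s = k - u - w" "a = k - w" "c = k - u" by (auto simp: k_def u_def w_def)
  have par: "odd a" "odd c" using assms v by auto
  have nz: "a \<noteq> 0" "c \<noteq> 0" "s - t - c \<noteq> 0" "a - s - t \<noteq> 0" using assms v by auto
  show ?thesis
  proof (cases "even s")
    case True
    then have "0 < disc v" using assms v by auto
    then have "\<not> (\<bar>t\<bar> \<le> \<bar>u\<bar> \<and> \<bar>k\<bar> \<le> \<bar>w\<bar>)" "\<not> (\<bar>t\<bar> \<le> \<bar>w\<bar> \<and> \<bar>k\<bar> \<le> \<bar>u\<bar>)"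
      using d sq_mono_abs[of t u] sq_mono_abs[of k w] sq_mono_abs[of t w] sq_mono_abs[of k u] by linarith+
    moreover have "u \<noteq> 0" "w \<noteq> 0" using True par by (auto simp: u_def w_def)
    ultimately show ?thesis using nz unfolding v k_def u_def w_def by simp (smt (verit))
  next
    case False
    then have "disc v \<le> 0" using assms v by auto
    moreover have "disc v \<noteq> 0" using disc_nz assms v by auto
    ultimately have "\<not> (\<bar>u\<bar> \<le> \<bar>t\<bar> \<and> \<bar>w\<bar> \<le> \<bar>k\<bar>)" "\<not> (\<bar>w\<bar> \<le> \<bar>t\<bar> \<and> \<bar>u\<bar> \<le> \<bar>k\<bar>)"
      using d sq_mono_abs[of u t] sq_mono_abs[of w k] sq_mono_abs[of w t] sq_mono_abs[of u k] by linarith+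
    moreover have "t \<noteq> 0" "k \<noteq> 0" using False par assms v by (auto simp: k_def)
    ultimately show ?thesis using nz unfolding v k_def u_def w_def by simp (smt (verit))
  qed
qed

definition red2 :: "quad \<Rightarrow> bool" where "red2 v \<longleftrightarrow> gate v \<and> gate (flip v)"

lemma gate_or: assumes "adm2 v" shows "gate v \<or> gate (flip v)"
proof -
  obtain a c s t where v: "v = (a,c,s,t)" by (cases v)
  have nz: "a \<noteq> 0" "c \<noteq> 0" using assms v by auto
  have "t \<noteq> 0" if "a * c < 0"
  proof
    assume t: "t = 0"
    have "disc v = 2*(a*c) - s^2" unfolding v t by simp
    then have "disc v < 0" using that zero_le_power2[of s] by linarith
    then show False using assms t unfolding v by auto
  qed
  note t = this
  consider "0 < a" "0 < c" | "a < 0" "c < 0" | "a < 0" "0 < c" | "0 < a" "c < 0" using nz by linarith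
  then show ?thesis
  proof cases
    case 1 then show ?thesis unfolding v by (cases "0 \<le> s") auto
  next
    case 2 then show ?thesis unfolding v by (cases "0 \<le> s") auto
  next
    case 3 then show ?thesis using t mult_neg_pos[of a c] unfolding v by auto
  next
    case 4 then show ?thesis using t mult_pos_neg[of a c] unfolding v by auto
  qed
qed

lemma red2_iff: "red2 (a,c,s,t) \<longleftrightarrow> (0 < a \<and> 0 < c \<and> \<bar>s\<bar> < a \<and> \<bar>s\<bar> < c) \<or> (a < 0 \<and> c < 0 \<and> \<bar>s\<bar> < -a \<and> \<bar>s\<bar> < -c)"
  unfolding red2_def by (cases "0 \<le> s") auto

text \<open>
  For \<open>s\<close> and \<open>t\<close> as above, \<open>\<bar>s\<bar> +
  \<bar>t\<bar>\<close> is twice the larger of \<open>\<bar>x\<bar>\<close> and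
  \<open>\<bar>y\<bar>\<close>.
\<close>
fun off_size :: "quad \<Rightarrow> nat" where "off_size (a,c,s,t) = nat (\<bar>s\<bar> + \<bar>t\<bar>)"
fun diag_size :: "quad \<Rightarrow> nat" where "diag_size (a,c,s,t) = nat (\<bar>a\<bar> + \<bar>c\<bar>)"

lemma gate_descent:
  assumes "adm2 v" "\<not> gate v" "w \<in> {sideA v, sideB v, sideA (sideB v)}" "gate w" "\<not> gate (flip w)"
  shows "off_size w < off_size v \<or> (off_size w = off_size v \<and> diag_size w < diag_size v)"
proof -
  obtain a c s t where v: "v = (a,c,s,t)" by (cases v)
  have nz: "a \<noteq> 0" "c \<noteq> 0" using assms v by auto
  have g: "gate (flip v)" using gate_or[OF assms(1)] assms(2) by blast
  have nz2: "s - t - c \<noteq> 0" "a-s-t \<noteq> 0" using assms(1) unfolding v by auto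
  consider "w = sideA v" | "w = sideB v" | "w = sideA (sideB v)" using assms(3) by auto
  then show ?thesis
  proof cases
    case 1
    show ?thesis using assms(2,4,5) g nz nz2 unfolding 1 v by simp (smt (verit))
  next
    case 2
    show ?thesis using assms(2,4,5) g nz nz2 unfolding 2 v by simp (smt (verit))
  next
    case 3
    show ?thesis using assms(2,4,5) g nz nz2 unfolding 3 v by simp (smt (verit))
  qed
qed

definition to_gate :: "quad \<Rightarrow> quad" where
  "to_gate v = (if gate v then v else if gate (sideA v) then sideA v else if gate (sideB v) then sideB v else sideA (sideB v))"

lemma to_gate_cases: "to_gate v \<in> {v, sideA v, sideB v, sideA (sideB v)}" by (auto simp: to_gate_def)
lemma gate_to_gate: "adm2 v \<Longrightarrow> gate (to_gate v)" using gate_exists[of v] by (auto simp: to_gate_def)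
lemma to_gate_qneg: "to_gate (qneg v) = qneg (to_gate v)" by (simp add: to_gate_def side_qneg)
lemma to_gate_id: "gate v \<Longrightarrow> to_gate v = v" by (simp add: to_gate_def)
lemma adm2_to_gate: "adm2 v \<Longrightarrow> adm2 (to_gate v)" by (metis to_gate_cases insert_iff empty_iff adm2_sideA adm2_sideB)

lemma eq_pm_qneg: "eq_pm (qneg v) w \<longleftrightarrow> eq_pm v w" "eq_pm v (qneg w) \<longleftrightarrow> eq_pm v w"
  by (auto simp: eq_pm_def) (metis qneg_qneg)+

lemma to_gate_sideA: assumes "adm2 v" shows "eq_pm (to_gate (sideA v)) (to_gate v)"
proof -
  have 1: "sideA (sideA v) = v" "sideB (sideA v) = qneg (sideA (sideB v))" "sideA (sideB (sideA v)) = qneg (sideB v)"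
    by (simp_all add: sideA_sideA sideB_sideA side_qneg)
  have u: "gate v \<Longrightarrow> \<not> gate (sideA v)" "gate (sideB v) \<Longrightarrow> \<not> gate (sideA (sideB v))" using gate_unique by auto
  show ?thesis unfolding to_gate_def 1 using u gate_exists[OF assms] by (auto simp: eq_pm_qneg side_qneg sideA_sideA)
qed
lemma to_gate_sideB: assumes "adm2 v" shows "eq_pm (to_gate (sideB v)) (to_gate v)"
proof -
  have 1: "sideB (sideB v) = v" "gate (sideA v) \<Longrightarrow> \<not> gate (sideA (sideB v))"
    using gate_unique(2)[of "sideA v"] by (auto simp: sideB_sideB sideB_sideA)
  have u: "gate v \<Longrightarrow> \<not> gate (sideB v)" "gate v \<Longrightarrow> \<not> gate (sideA (sideB v))" "gate (sideA v) \<Longrightarrow> \<not> gate (sideB v)"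
    using gate_unique(1,2,3)[of v] gate_unique(3)[of "sideB v"] by (auto simp: sideB_sideB)
  show ?thesis unfolding to_gate_def 1(1) using u 1(2) gate_exists[OF assms] by auto
qed

text \<open>
  A matrix that is not reduced moves to the gate of the one square of which it is not a
  gate itself.
\<close>
definition step2 :: "quad \<Rightarrow> quad" where
  "step2 v = (if gate v then flip (to_gate (flip v)) else to_gate v)"

lemma sizes_flip [simp]: "off_size (flip v) = off_size v" "diag_size (flip v) = diag_size v" by (cases v; simp)+
lemma red2_flip [simp]: "red2 (flip v) = red2 v" by (auto simp: red2_def)
lemma red2_qneg [simp]: "red2 (qneg v) = red2 v" by (auto simp: red2_def side_qneg)

lemma step2_descent: assumes "adm2 v" "\<not> red2 v" "\<not> red2 (step2 v)"
  shows "off_size (step2 v) < off_size v \<or> (off_size (step2 v) = off_size v \<and> diag_size (step2 v) < diag_size v)"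
proof -
  have *: "off_size (to_gate w) < off_size w \<or> (off_size (to_gate w) = off_size w \<and> diag_size (to_gate w) < diag_size w)"
    if w: "adm2 w" "\<not> gate w" "\<not> red2 (to_gate w)" for w
    by (rule gate_descent[OF w(1,2)]) (use to_gate_cases[of w] w gate_to_gate[OF w(1)] in \<open>auto simp: red2_def\<close>)
  show ?thesis
  proof (cases "gate v")
    case True
    then have "\<not> gate (flip v)" using assms(2) by (simp add: red2_def)
    then show ?thesis using *[of "flip v"] assms True by (simp add: step2_def adm2_simps)
  next
    case False then show ?thesis using *[of v] assms by (simp add: step2_def)
  qed
qed

lemma adm2_step2: "adm2 v \<Longrightarrow> adm2 (step2 v)" by (simp add: step2_def adm2_simps adm2_to_gate)

function nf2 :: "quad \<Rightarrow> quad" where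
  "nf2 v = (if red2 v \<or> \<not> adm2 v then v else nf2 (step2 v))"
  by auto
termination
proof (relation "measures [\<lambda>v. if red2 v then 0 else 1, off_size, diag_size]", goal_cases)
  case 1 show ?case by simp
next
  case (2 v) then show ?case using step2_descent[of v] by auto
qed
declare nf2.simps [simp del]

lemma nf2_red: "red2 v \<Longrightarrow> nf2 v = v" by (subst nf2.simps) simp
lemma red2_nf2: "adm2 v \<Longrightarrow> red2 (nf2 v)"
  by (induction v rule: nf2.induct) (metis adm2_step2 nf2.simps)
lemma adm2_nf2: "adm2 v \<Longrightarrow> adm2 (nf2 v)"
  by (induction v rule: nf2.induct) (metis adm2_step2 nf2.simps)
lemma nf2_step2: "adm2 v \<Longrightarrow> \<not> red2 v \<Longrightarrow> nf2 (step2 v) = nf2 v"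
  by (subst (2) nf2.simps) simp

text \<open>
  Both symmetries of the reduction, sign and \<open>flip\<close>, are instances.
\<close>
lemma nf2_commute:
  assumes h: "\<And>v. red2 (f v) = red2 v" "\<And>v. adm2 (f v) = adm2 v" "\<And>v. adm2 v \<Longrightarrow> \<not> red2 v \<Longrightarrow> step2 (f v) = f (step2 v)"
    and "adm2 v" shows "nf2 (f v) = f (nf2 v)"
  using assms(4)
proof (induction v rule: nf2.induct)
  case (1 v)
  show ?case
  proof (cases "red2 v")
    case True then show ?thesis using h by (simp add: nf2_red)
  next
    case False
    have "nf2 (f v) = nf2 (step2 (f v))" using nf2_step2[of "f v"] False 1(2) h(1,2) by simp
    also have "\<dots> = f (nf2 (step2 v))" using 1 False h(3) by (simp add: adm2_step2)
    finally show ?thesis using nf2_step2[OF 1(2) False] by simp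
  qed
qed

lemma nf2_qneg: "adm2 v \<Longrightarrow> nf2 (qneg v) = qneg (nf2 v)"
  by (rule nf2_commute) (auto simp: adm2_simps step2_def to_gate_qneg side_qneg)
lemma nf2_flip: "adm2 v \<Longrightarrow> nf2 (flip v) = flip (nf2 v)"
  by (rule nf2_commute) (use gate_or in \<open>auto simp: adm2_simps step2_def red2_def\<close>)

lemma nf2_eq_pm: "adm2 w \<Longrightarrow> eq_pm v w \<Longrightarrow> eq_pm (nf2 v) (nf2 w)"
  by (auto simp: eq_pm_def nf2_qneg)

lemma nf2_to_gate: "adm2 v \<Longrightarrow> nf2 (to_gate v) = nf2 v"
  using nf2_step2[of v] by (cases "gate v") (auto simp: to_gate_id step2_def red2_def)

lemma nf2_side: assumes "adm2 v" shows "eq_pm (nf2 (sideA v)) (nf2 v)" "eq_pm (nf2 (sideB v)) (nf2 v)" "eq_pm (nf2 (qneg v)) (nf2 v)"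
  "eq_pm (nf2 (flip (sideA (flip v)))) (nf2 v)" "eq_pm (nf2 (flip (sideB (flip v)))) (nf2 v)"
proof -
  have A: "eq_pm (nf2 (sideA v)) (nf2 v)" if "adm2 v" for v
    using nf2_eq_pm[OF _ to_gate_sideA[OF that]] nf2_to_gate[OF that] nf2_to_gate[OF adm2_sideA[OF that]] adm2_to_gate[OF that] by simp
  have B: "eq_pm (nf2 (sideB v)) (nf2 v)" if "adm2 v" for v
    using nf2_eq_pm[OF _ to_gate_sideB[OF that]] nf2_to_gate[OF that] nf2_to_gate[OF adm2_sideB[OF that]] adm2_to_gate[OF that] by simp
  have C: "eq_pm (flip x) (flip y) \<longleftrightarrow> eq_pm x y" for x y by (auto simp: eq_pm_def side_qneg) (metis flip_flip side_qneg(3))+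
  show "eq_pm (nf2 (sideA v)) (nf2 v)" "eq_pm (nf2 (sideB v)) (nf2 v)" using A B assms by auto
  show "eq_pm (nf2 (qneg v)) (nf2 v)" using nf2_qneg assms by (simp add: eq_pm_def)
  show "eq_pm (nf2 (flip (sideA (flip v)))) (nf2 v)"
    using A[of "flip v"] C[of "nf2 (sideA (flip v))" "flip (nf2 v)"] nf2_flip[of "sideA (flip v)"] nf2_flip[of v] assms
    by (simp add: adm2_simps adm2_sideA)
  show "eq_pm (nf2 (flip (sideB (flip v)))) (nf2 v)"
    using B[of "flip v"] C[of "nf2 (sideB (flip v))" "flip (nf2 v)"] nf2_flip[of "sideB (flip v)"] nf2_flip[of v] assms
    by (simp add: adm2_simps adm2_sideB)
qed

lemma disc_nf2: assumes "adm2 v" "0 < disc v" shows "disc (nf2 v) = disc v"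
proof -
  have g: "\<bar>disc (to_gate w)\<bar> = \<bar>disc w\<bar>" for w using to_gate_cases[of w] by auto
  have s: "\<bar>disc (step2 w)\<bar> = \<bar>disc w\<bar>" for w by (simp add: step2_def g)
  have *: "\<bar>disc (nf2 w)\<bar> = \<bar>disc w\<bar>" if "adm2 w" for w
    using that
  proof (induction w rule: nf2.induct)
    case (1 w)
    show ?case
    proof (cases "red2 w")
      case False
      then show ?thesis using 1 s by (metis nf2_step2 adm2_step2)
    qed (simp add: nf2_red)
  qed
  obtain a c s t where n: "nf2 v = (a,c,s,t)" by (cases "nf2 v")
  have r: "(0 < a \<and> 0 < c \<and> \<bar>s\<bar> < a \<and> \<bar>s\<bar> < c) \<or> (a < 0 \<and> c < 0 \<and> \<bar>s\<bar> < -a \<and> \<bar>s\<bar> < -c)"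
    using red2_nf2[OF assms(1)] unfolding n red2_iff .
  then have "\<bar>s\<bar> * \<bar>s\<bar> \<le> \<bar>a\<bar> * \<bar>c\<bar>" by (intro mult_mono) auto
  moreover have "\<bar>a\<bar> * \<bar>c\<bar> = a * c" "0 < a * c" using r by (auto simp: mult_neg_neg)
  ultimately have "s^2 \<le> a * c" "0 < a * c" by (simp_all add: power2_eq_square)
  then have "0 < disc (nf2 v)" unfolding n disc.simps using zero_le_power2[of t] by (simp only: mult.assoc)
  then show ?thesis using *[OF assms(1)] assms(2) by linarith
qed

text \<open>
  Again the lattice spanned by twice the columns.
\<close>
fun lat2 :: "quad \<Rightarrow> (int \<times> int) set" where
  "lat2 (a,c,s,t) = range (\<lambda>(i,j). (i*(2*a) + j*(2*(s+t)), i*(s-t) + j*(2*c)))"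

lemma lat2_sideA: "lat2 (sideA v) = lat2 v"
proof -
  have *: "lat2 (sideA v) \<subseteq> lat2 v" for v
  proof -
    obtain a c s t where v: "v = (a,c,s,t)" by (cases v)
    have "\<exists>i' j'. i*(2*a) + j*(2*(a-t+(a-s))) = i'*(2*a) + j'*(2*(s+t)) \<and> i*(a-t-(a-s)) + j*(2*(s-t-c)) = i'*(s-t) + j'*(2*c)" for i j
      by (rule exI[of _ "i+2*j"], rule exI[of _ "-j"]) (simp add: algebra_simps)
    then show ?thesis unfolding v by (auto simp: image_iff)
  qed
  show ?thesis using *[of v] *[of "sideA v"] sideA_sideA by auto
qed
lemma lat2_sideB: "lat2 (sideB v) = lat2 v"
proof -
  have *: "lat2 (sideB v) \<subseteq> lat2 v" for v
  proof -
    obtain a c s t where v: "v = (a,c,s,t)" by (cases v)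
    have "\<exists>i' j'. i*(2*(a-s-t)) + j*(2*(-t-c+(c-s))) = i'*(2*a) + j'*(2*(s+t)) \<and> i*(-t-c-(c-s)) + j*(2*(-c)) = i'*(s-t) + j'*(2*c)" for i j
      by (rule exI[of _ "i"], rule exI[of _ "-i-j"]) (simp add: algebra_simps)
    then show ?thesis unfolding v by (auto simp: image_iff)
  qed
  show ?thesis using *[of v] *[of "sideB v"] sideB_sideB by auto
qed
lemma lat2_qneg: "lat2 (qneg v) = lat2 v"
proof -
  have *: "lat2 (qneg v) \<subseteq> lat2 v" for v
  proof -
    obtain a c s t where v: "v = (a,c,s,t)" by (cases v)
    have "\<exists>i' j'. i*(2*(-a)) + j*(2*(-s+-t)) = i'*(2*a) + j'*(2*(s+t)) \<and> i*(-s- -t) + j*(2*(-c)) = i'*(s-t) + j'*(2*c)" for i j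
      by (rule exI[of _ "-i"], rule exI[of _ "-j"]) (simp add: algebra_simps)
    then show ?thesis unfolding v by (auto simp: image_iff)
  qed
  show ?thesis using *[of v] *[of "qneg v"] by auto
qed
lemma lat2_flip: "lat2 v = lat2 w \<Longrightarrow> lat2 (flip v) = lat2 (flip w)"
proof -
  have "lat2 (flip v) = (\<lambda>(p,q). (p,-q)) ` lat2 v" for v
  proof -
    obtain a c s t where v: "v = (a,c,s,t)" by (cases v)
    have "lat2 (flip v) = range (\<lambda>(i,j). (i*(2*a) + j*(2*(-s+-t)), i*(-s- -t) + j*(2*c)))" unfolding v by simp
    also have "\<dots> = (\<lambda>(i,j). (i*(2*a) + j*(2*(-s+-t)), i*(-s- -t) + j*(2*c))) ` range (\<lambda>(i,j). (i,-j))"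
      by (rule arg_cong[of _ _ "image _"]) (auto simp: image_iff, metis minus_minus)
    also have "\<dots> = (\<lambda>(p,q). (p,-q)) ` lat2 v" unfolding v lat2.simps image_image
      by (rule image_cong) (auto simp: algebra_simps)
    finally show ?thesis .
  qed
  then show "lat2 v = lat2 w \<Longrightarrow> lat2 (flip v) = lat2 (flip w)" by simp
qed
lemma lat2_to_gate: "lat2 (to_gate v) = lat2 v" using to_gate_cases[of v] by (auto simp: lat2_sideA lat2_sideB)
lemma lat2_step2: "lat2 (step2 v) = lat2 v"
  using lat2_flip[OF lat2_to_gate[of "flip v"]] by (simp add: step2_def lat2_to_gate)
lemma lat2_nf2: "adm2 v \<Longrightarrow> lat2 (nf2 v) = lat2 v"
proof (induction v rule: nf2.induct)
  case (1 v)
  show ?case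
  proof (cases "red2 v")
    case False
    then show ?thesis using 1 lat2_step2 by (metis nf2_step2 adm2_step2)
  qed (simp add: nf2_red)
qed
lemma lat2_eq_pm: "eq_pm v w \<Longrightarrow> lat2 v = lat2 w" by (auto simp: eq_pm_def lat2_qneg)

definition hermite2 :: "nat \<Rightarrow> int \<times> int \<Rightarrow> quad" where
  "hermite2 N = (\<lambda>(a,x). (a, int N div a, x, x))"
definition hindex2 :: "nat \<Rightarrow> (int \<times> int) set" where
  "hindex2 N = {(a,x). 0 < a \<and> a dvd int N \<and> even x \<and> 0 \<le> x \<and> x < 2*a}"

lemma hermite2_props: assumes "odd N" "i \<in> hindex2 N"
  shows "adm2 (hermite2 N i)" "disc (hermite2 N i) = 2 * int N"
proof -
  obtain a x where i: "i = (a,x)" by (cases i)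
  have a: "a dvd int N" "a > 0" "even x" using assms(2) i by (auto simp: hindex2_def)
  then obtain c where c: "int N = a * c" unfolding dvd_def by blast
  have d: "int N div a = c" using a c by auto
  have o: "odd a" "odd c" using assms(1) c by (metis even_mult_iff even_of_nat)+
  show D: "disc (hermite2 N i) = 2 * int N" unfolding i hermite2_def by (simp add: d c)
  moreover have "0 < int N" using assms(1) by (simp add: odd_pos)
  ultimately show "adm2 (hermite2 N i)" using o a unfolding i hermite2_def by (simp add: d)
qed

lemma nf2_shift:
  fixes k :: int
  assumes "odd a" "odd c" "even x" "0 < a * c"
  shows "eq_pm (nf2 (a, c, x + 2*a*k, x+2*a*k)) (nf2 (a, c, x, x))"
proof -
  have 1: "eq_pm (nf2 (a, c, x + 2*a, x + 2*a)) (nf2 (a,c,x,x))" if x: "even x" for x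
  proof -
    have a: "adm2 (a,c,x,x)" using assms x by simp
    have e: "(a, c, x + 2*a, x + 2*a) = sideA (flip (sideA (flip (a,c,x,x))))" by simp
    have "adm2 (flip (sideA (flip (a,c,x,x))))" using a adm2_simps adm2_sideA by metis
    then show ?thesis unfolding e using nf2_side(1,4) a eq_pm_trans by meson
  qed
  show ?thesis
  proof (induction k rule: int_induct[of _ 0])
    case base then show ?case by simp
  next
    case (step1 k) then show ?case using 1[of "x+2*a*k"] assms by (simp add: algebra_simps) (meson eq_pm_trans)
  next
    case (step2 k) then show ?case using 1[of "x+2*a*(k-1)"] assms by (simp add: algebra_simps) (meson eq_pm_trans eq_pm_sym)
  qed
qed

text \<open>
  Euclid's algorithm on the lower row \<open>(y, c)\<close>. It replaces
  \<open>y\<close> by \<open>y - c\<close> or \<open>y + c\<close> if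
  \<open>\<bar>c\<bar> \<le> \<bar>y\<bar>\<close>, and \<open>c\<close> by \<open>c -
  2y\<close> or \<open>c + 2y\<close> otherwise, up to sign.
\<close>
lemma hermite2_exists:
  assumes "adm2 v" "disc v = 2 * int N" "odd N"
  shows "\<exists>i \<in> hindex2 N. eq_pm (nf2 v) (nf2 (hermite2 N i))"
proof -
  have *: "\<exists>i \<in> hindex2 N. eq_pm (nf2 v) (nf2 (hermite2 N i))" if "adm2 v" "\<bar>disc v\<bar> = 2 * int N" for v
    using that
  proof (induction "case v of (a,c,s,t) \<Rightarrow> nat (\<bar>s-t\<bar> + \<bar>2*c\<bar>)" arbitrary: v rule: less_induct)
    case less
    obtain a c s t where v: "v = (a,c,s,t)" by (cases v)
    note adm = less(2)
    have IH: "\<exists>i \<in> hindex2 N. eq_pm (nf2 v) (nf2 (hermite2 N i))"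
      if "eq_pm (nf2 w) (nf2 v)" "adm2 w" "\<bar>disc w\<bar> = 2 * int N"
        "(case w of (a,c,s,t) \<Rightarrow> nat (\<bar>s-t\<bar> + \<bar>2*c\<bar>)) < (case v of (a,c,s,t) \<Rightarrow> nat (\<bar>s-t\<bar> + \<bar>2*c\<bar>))" for w
      using less(1)[OF that(4,2,3)] that(1) eq_pm_trans eq_pm_sym by meson
    have nz: "c \<noteq> 0" using adm unfolding v by auto
    have A: "adm2 (sideA v)" "adm2 (sideB v)" "adm2 (flip (sideA (flip v)))" "adm2 (flip (sideB (flip v)))"
      using adm by (simp_all add: adm2_simps adm2_sideA adm2_sideB)
    have Q: "\<bar>disc (sideA v)\<bar> = 2 * int N" "\<bar>disc (sideB v)\<bar> = 2 * int N"
       "\<bar>disc (flip (sideA (flip v)))\<bar> = 2 * int N" "\<bar>disc (flip (sideB (flip v)))\<bar> = 2 * int N"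
      using less(3) by simp_all
    consider (z) "s = t" | (y1) "\<bar>2*c\<bar> \<le> \<bar>s-t\<bar>" "0 < (s-t)*c" | (y2) "\<bar>2*c\<bar> \<le> \<bar>s-t\<bar>" "(s-t)*c < 0"
      | (c1) "s \<noteq> t" "\<bar>s-t\<bar> < \<bar>2*c\<bar>" "0 < (s-t)*c" | (c2) "s \<noteq> t" "\<bar>s-t\<bar> < \<bar>2*c\<bar>" "(s-t)*c < 0"
    proof -
      have "s = t \<or> 0 < (s-t)*c \<or> (s-t)*c < 0"
        using nz(1) by (metis linorder_neqE_linordered_idom mult_eq_0_iff right_minus_eq)
      then show ?thesis using that linorder_not_less by blast
    qed
    then show ?case
    proof cases
      case y1
      show ?thesis by (rule IH[OF nf2_side(2)[OF adm] A(2) Q(2)]) (use y1 in \<open>auto simp: v zero_less_mult_iff\<close>)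
    next
      case y2
      show ?thesis by (rule IH[OF nf2_side(5)[OF adm] A(4) Q(4)]) (use y2 in \<open>auto simp: v mult_less_0_iff\<close>)
    next
      case c1
      show ?thesis by (rule IH[OF nf2_side(1)[OF adm] A(1) Q(1)]) (use c1 in \<open>auto simp: v zero_less_mult_iff\<close>)
    next
      case c2
      show ?thesis by (rule IH[OF nf2_side(4)[OF adm] A(3) Q(3)]) (use c2 in \<open>auto simp: v mult_less_0_iff\<close>)
    next
      case z
      have od: "odd a" "odd c" using adm v by auto
      have dv: "disc v = 2*a*c" unfolding v z by simp
      then have n: "\<bar>a * c\<bar> = int N" using less(3) by (simp add: abs_mult)
      have ac0: "a * c \<noteq> 0" using od by auto
      obtain c1 x1 where w1: "eq_pm (nf2 (a, c1, x1, x1)) (nf2 v)" "odd c1" "even x1" "0 < a * c1" "a * c1 = int N"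
      proof (cases "0 < a * c")
        case True
        then have "even s" using adm dv unfolding v by (auto simp del: disc.simps simp: mult.assoc)
        then show ?thesis using that[of c s] z v od n True by auto
      next
        case False
        then have F: "a * c < 0" using ac0 by linarith
        then have "odd s" using adm z unfolding v by auto
        moreover have "sideA v = (a, -c, a-s, a-s)" using z v by simp
        ultimately show ?thesis using that[of "-c" "a-s"] nf2_side(1)[OF adm] od n F by (auto simp: abs_if)
      qed
      obtain a' c' x' where w: "eq_pm (nf2 (a', c', x', x')) (nf2 v)" "odd a'" "odd c'" "even x'" "0 < a'" "0 < c'" "a' * c' = int N"
      proof (cases "0 < a")
        case True
        then have "0 < c1" using w1(4) zero_less_mult_pos by blast
        then show ?thesis using that[OF w1(1)] od w1 True by auto
      next
        case False
        have "adm2 (a,c1,x1,x1)" using od w1 by simp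
        then have "eq_pm (nf2 (-a,-c1,-x1,-x1)) (nf2 v)" using nf2_side(3)[of "(a,c1,x1,x1)"] w1(1) eq_pm_trans by auto
        moreover have "a < 0" using False od by (cases "a = 0") auto
        moreover have "c1 < 0" using w1(4) \<open>a < 0\<close> by (simp add: zero_less_mult_iff)
        ultimately show ?thesis using that[of "-a" "-c1" "-x1"] od w1 by auto
      qed
      define x where "x = x' mod (2*a')"
      have x: "x' = x + 2*a'*(x' div (2*a'))" by (simp add: x_def)
      have ox: "even x" using w(4) x by (metis even_add even_mult_iff even_numeral)
      then have xx: "0 \<le> x" "x < 2*a'" using w(5) pos_mod_sign[of "2*a'" x'] pos_mod_bound[of "2*a'" x'] unfolding x_def[symmetric] by auto
      have "eq_pm (nf2 (a',c',x',x')) (nf2 (a',c',x,x))"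
        using nf2_shift[OF w(2,3) ox, of "x' div (2*a')"] x w by (metis mult_pos_pos)
      moreover have "hermite2 N (a', x) = (a',c',x,x)" using w(5,7) unfolding hermite2_def by (auto simp flip: w(7))
      moreover have "(a',x) \<in> hindex2 N" using w xx ox by (auto simp: hindex2_def simp flip: w(7))
      ultimately show ?thesis using w(1) eq_pm_trans eq_pm_sym by metis
    qed
  qed
  show ?thesis using *[of v] assms by simp
qed

lemma hermite2_unique:
  assumes "odd N" "i \<in> hindex2 N" "j \<in> hindex2 N" "eq_pm (nf2 (hermite2 N i)) (nf2 (hermite2 N j))"
  shows "i = j"
proof -
  have L: "lat2 (hermite2 N i) = lat2 (hermite2 N j)" using lat2_eq_pm[OF assms(4)] lat2_nf2 hermite2_props(1) assms by simp
  obtain a x a' x' where i: "i = (a,x)" "j = (a',x')" by (cases i; cases j)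
  have "a dvd int N" "a' dvd int N" using assms(2,3) i by (auto simp: hindex2_def)
  then obtain c c' where c: "int N = a * c" "int N = a' * c'" unfolding dvd_def by blast
  have N: "0 < int N" using assms(1) by (simp add: odd_pos)
  have pos: "a > 0" "a' > 0" using assms i by (auto simp: hindex2_def)
  then have pos2: "c > 0" "c' > 0" using c N by (metis zero_less_mult_pos)+
  have h: "hermite2 N i = (a,c,x,x)" "hermite2 N j = (a',c',x',x')"
    using pos unfolding i hermite2_def by (simp add: c(1), simp add: c(2))
  have "(1*(2*a) + 0*(2*(x+x)), 1*(x-x) + 0*(2*c)) \<in> lat2 (hermite2 N j)" unfolding L[symmetric] h(1) lat2.simps by (rule range_eqI[of _ _ "(1,0)"]) simp
  then obtain k m where k: "2*a = k*(2*a') + m*(2*(x'+x'))" "0 = m*(2*c')" unfolding h(2) by auto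
  have "(0*(2*a) + 1*(2*(x+x)), 0*(x-x) + 1*(2*c)) \<in> lat2 (hermite2 N j)" unfolding L[symmetric] h(1) lat2.simps by (rule range_eqI[of _ _ "(0,1)"]) simp
  then obtain r l where r: "2*(x+x) = r*(2*a') + l*(2*(x'+x'))" "2*c = l*(2*c')" unfolding h(2) by auto
  have 1: "a = k * a'" "c = l * c'" "2 * x = r * a' + 2 * l * x'" using k r pos2 by auto
  have "k > 0" "l > 0" using 1 pos pos2 by (metis zero_less_mult_pos2)+
  have "k * l * (a' * c') = a' * c'" using c 1 by (simp add: ac_simps)
  then have "k * l = 1" using pos pos2 by simp
  then have kl: "k = 1" "l = 1" using \<open>k > 0\<close> \<open>l > 0\<close> by (auto simp: zmult_eq_1_iff)
  have aa: "a = a'" "2 * x = r * a' + 2 * x'" using 1 kl by auto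
  have "odd a'" using c assms(1) by (metis even_mult_iff even_of_nat)
  have xs: "even x" "even x'" "0 \<le> x" "x < 2*a'" "0 \<le> x'" "x' < 2*a'" using assms(2,3) i aa by (auto simp: hindex2_def)
  have "4 dvd 2 * x - 2 * x'" using xs by presburger
  then have "4 dvd r * a'" using aa by simp
  moreover have "coprime 4 a'" using \<open>odd a'\<close> by (metis coprime_left_2_iff_odd coprime_mult_left_iff mult_2 numeral_Bit0)
  ultimately have "4 dvd r" by (simp add: coprime_dvd_mult_left_iff)
  then obtain n where "r = 4*n" by auto
  then have "x = n * (2*a') + x'" using aa by simp
  then have "n * (2*a') < 1 * (2*a')" "(-1) * (2*a') < n * (2*a')" using xs by linarith+
  then have "n = 0" using pos by (simp only: mult_less_cancel_right) auto
  then show ?thesis using aa i \<open>r = 4*n\<close> by simp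
qed

definition positive_reduced2 :: "nat \<Rightarrow> quad set" where
  "positive_reduced2 N = {v. adm2 v \<and> disc v = 2 * int N \<and> red2 v \<and> 0 < fst v}"

theorem positive_reduced2_bij: assumes "odd N" shows "bij_betw (\<lambda>i. pos_rep (nf2 (hermite2 N i))) (hindex2 N) (positive_reduced2 N)"
proof -
  have s: "eq_pm (pos_rep v) v" for v by (simp add: pos_rep_def eq_pm_def)
  have u: "v = w" if "eq_pm v w" "0 < fst v" "0 < fst w" for v w using that by (cases w) (auto simp: eq_pm_def)
  have p: "0 < fst (pos_rep v)" if "red2 v" for v using that by (cases v) (auto simp: pos_rep_def red2_iff)
  show ?thesis
  proof (rule bij_betwI')
    fix i j assume i: "i \<in> hindex2 N" "j \<in> hindex2 N"
    show "(pos_rep (nf2 (hermite2 N i)) = pos_rep (nf2 (hermite2 N j))) = (i = j)"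
      using hermite2_unique[OF assms i] s eq_pm_trans eq_pm_sym by metis
  next
    fix i assume i: "i \<in> hindex2 N"
    have "adm2 (pos_rep (nf2 (hermite2 N i)))" "red2 (pos_rep (nf2 (hermite2 N i)))" "disc (pos_rep (nf2 (hermite2 N i))) = 2 * int N"
      using hermite2_props[OF assms i] adm2_nf2 red2_nf2 disc_nf2 assms by (auto simp: pos_rep_def adm2_simps odd_pos)
    then show "pos_rep (nf2 (hermite2 N i)) \<in> positive_reduced2 N" using p red2_nf2 hermite2_props[OF assms i] by (auto simp: positive_reduced2_def)
  next
    fix v assume v: "v \<in> positive_reduced2 N"
    then obtain i where i: "i \<in> hindex2 N" "eq_pm (nf2 v) (nf2 (hermite2 N i))" using hermite2_exists[of v N] assms by (auto simp: positive_reduced2_def)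
    have "nf2 v = v" using v by (simp add: nf2_red positive_reduced2_def)
    then have "eq_pm v (pos_rep (nf2 (hermite2 N i)))" using i(2) s eq_pm_trans eq_pm_sym by metis
    then have "v = pos_rep (nf2 (hermite2 N i))" using u p red2_nf2 hermite2_props(1)[OF assms i(1)] v by (auto simp: positive_reduced2_def)
    then show "\<exists>i\<in>hindex2 N. v = pos_rep (nf2 (hermite2 N i))" using i(1) by blast
  qed
qed

section \<open>Generating functions of weighted sets\<close>

unbundle fps_syntax

definition gf :: "('a \<Rightarrow> nat) \<Rightarrow> 'a set \<Rightarrow> rat fps" where
  "gf w A = Abs_fps (\<lambda>n. of_nat (card {x \<in> A. w x = n}))"

lemma gf_nth: "gf w A $ n = of_nat (card {x \<in> A. w x = n})" by (simp add: gf_def)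

lemma gf_times:
  assumes "\<And>n. finite {x \<in> A. f x = n}" "\<And>n. finite {x \<in> B. g x = n}"
  shows "gf f A * gf g B = gf (\<lambda>(x,y). f x + g y) (A \<times> B)"
proof (rule fps_ext)
  fix n
  have e: "{z \<in> A \<times> B. (\<lambda>(x,y). f x + g y) z = n} = (\<Union>i\<in>{0..n}. {x\<in>A. f x = i} \<times> {y\<in>B. g y = n - i})"
    by auto
  have "card {z \<in> A \<times> B. (\<lambda>(x,y). f x + g y) z = n} = (\<Sum>i=0..n. card ({x\<in>A. f x = i} \<times> {y\<in>B. g y = n - i}))"
    unfolding e by (rule card_UN_disjoint) (use assms in auto)
  then show "(gf f A * gf g B) $ n = gf (\<lambda>(x,y). f x + g y) (A \<times> B) $ n"
    by (simp add: gf_nth fps_mult_nth card_cartesian_product)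
qed

lemma gf_bij: assumes "bij_betw h A B" "\<And>x. x \<in> A \<Longrightarrow> g (h x) = f x" shows "gf f A = gf g B"
proof -
  have "card {x \<in> A. f x = n} = card {y \<in> B. g y = n}" for n
  proof (rule bij_betw_same_card)
    show "bij_betw h {x \<in> A. f x = n} {y \<in> B. g y = n}"
      using assms unfolding bij_betw_def inj_on_def by (auto simp: image_iff)
  qed
  then show ?thesis by (simp add: gf_def)
qed

lemma gf_finite_prod:
  assumes "\<And>n. finite {x \<in> A. f x = n}" "\<And>n. finite {x \<in> B. g x = (n::nat)}"
  shows "finite {z \<in> A \<times> B. (\<lambda>(x,y). f x + g y) z = (n::nat)}"
proof -
  have e: "{z \<in> A \<times> B. (\<lambda>(x,y). f x + g y) z = n} = (\<Union>i\<in>{0..n}. {x\<in>A. f x = i} \<times> {y\<in>B. g y = n - i})"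
    by auto
  show ?thesis unfolding e using assms by auto
qed

section \<open>The fourth power of the triangular theta series\<close>

definition tri :: "nat \<Rightarrow> nat" where "tri k = k * (k+1) div 2"
lemma two_tri: "2 * tri k = k * (k+1)" by (simp add: tri_def)
lemma int_tri: "2 * int (tri k) = int k * (int k + 1)"
  using two_tri[of k] by (metis of_nat_1 of_nat_add of_nat_mult of_nat_numeral)
lemma tri_Suc: "tri (Suc k) = tri k + Suc k" by (simp add: tri_def)
lemma tri_strict_mono: "strict_mono tri" by (rule strict_mono_Suc_iff[THEN iffD2]) (simp add: tri_Suc)
lemma tri_inj: "tri j = tri k \<longleftrightarrow> j = k" using strict_mono_eq[OF tri_strict_mono] .
lemma tri_ge: "k \<le> tri k" using strict_mono_imp_increasing[OF tri_strict_mono] by simp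

definition psi :: "rat fps" where "psi = gf tri UNIV"
definition psi2 :: "rat fps" where "psi2 = gf (\<lambda>k. 2 * tri k) UNIV"
definition phi :: "rat fps" where "phi = gf (\<lambda>h::int. nat (h^2)) UNIV"

lemma finite_tri: "finite {k \<in> UNIV. tri k = n}" by (rule finite_subset[of _ "{..n}"]) (use tri_ge in auto)
lemma finite_2tri: "finite {k \<in> UNIV. 2 * tri k = n}"
  by (rule finite_subset[of _ "{..n}"], clarsimp) (metis le_add1 mult_2 order_trans tri_ge, simp)
lemma int_abs_le_square: "\<bar>h\<bar> \<le> (h::int)^2"
proof (cases "h = 0")
  case False
  then have "\<bar>h\<bar> * 1 \<le> \<bar>h\<bar> * \<bar>h\<bar>" by (intro mult_left_mono) auto
  then show ?thesis by (simp add: power2_eq_square)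
qed simp
lemma finite_sq: "finite {h::int \<in> UNIV. nat (h^2) = n}"
proof (rule finite_subset)
  show "{h::int \<in> UNIV. nat (h^2) = n} \<subseteq> {-int n..int n}"
  proof
    fix h :: int assume "h \<in> {h \<in> UNIV. nat (h^2) = n}"
    then have "h^2 = int n" by auto
    then show "h \<in> {-int n..int n}" using int_abs_le_square[of h] by auto
  qed
qed simp

text \<open>
  The substitution \<open>(a, b) = (m + h, m - h)\<close> turns \<open>tri a + tri
  b\<close> into \<open>h^2 + 2 * tri m\<close>. If \<open>m < \<bar>h\<bar>\<close>,
  one of the two values is negative; the reflection \<open>a \<mapsto> - a - 1\<close>,
  which fixes triangular numbers, makes it nonnegative and yields the pairs of different
  parity.
\<close>
lemma phi_psi2: "phi * psi2 = psi ^ 2"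
proof -
  define f :: "int \<times> nat \<Rightarrow> nat \<times> nat" where
    "f = (\<lambda>(h,m). if \<bar>h\<bar> \<le> int m then (nat (int m + h), nat (int m - h))
      else if 0 < h then (nat (h + int m), nat (h - int m - 1)) else (nat (-h - int m - 1), nat (int m - h)))"
  define g :: "nat \<times> nat \<Rightarrow> int \<times> nat" where
    "g = (\<lambda>(a,b). if even (a+b) then ((int a - int b) div 2, (a+b) div 2)
       else if b < a then ((int a + int b + 1) div 2, (a-b-1) div 2) else (- ((int a + int b + 1) div 2), (b-a-1) div 2))"
  have w: "tri (fst (f x)) + tri (snd (f x)) = nat (fst x ^ 2) + 2 * tri (snd x)" for x
  proof -
    obtain h m where x: "x = (h,m)" by (cases x)
    have "2 * int (tri (fst (f x)) + tri (snd (f x))) = 2 * int (nat (fst x ^ 2) + 2 * tri (snd x))"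
      unfolding of_nat_add of_nat_mult distrib_left int_tri of_nat_numeral
      using int_tri[of m] unfolding x f_def by (auto simp: algebra_simps power2_eq_square)
    then show ?thesis by (metis mult_cancel_left of_nat_eq_iff zero_neq_numeral)
  qed
  have gf: "g (f x) = x" for x
  proof -
    obtain h m where x: "x = (h,m)" by (cases x)
    consider "\<bar>h\<bar> \<le> int m" | "int m < h" | "h < - int m" by linarith
    then show ?thesis
    proof cases
      case 1
      then have "nat (int m + h) + nat (int m - h) = 2 * m" by linarith
      then have "even (nat (int m + h) + nat (int m - h))" "(nat (int m + h) + nat (int m - h)) div 2 = m" by simp_all
      then show ?thesis using 1 unfolding x f_def g_def by auto
    next
      case 2
      then have "odd (nat (h + int m) + nat (h - int m - 1))" by (simp add: even_nat_iff)
      then show ?thesis using 2 unfolding x f_def g_def by auto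
    next
      case 3
      then have "odd (nat (-h - int m - 1) + nat (int m - h))" by (simp add: even_nat_iff)
      then show ?thesis using 3 unfolding x f_def g_def by auto
    qed
  qed
  have fg: "f (g y) = y" for y
  proof -
    obtain a b where y: "y = (a,b)" by (cases y)
    show ?thesis
    proof (cases "even (a+b)")
      case True
      then obtain k where "a + b = 2 * k" by (elim evenE)
      then have "int a - int b = 2 * (int k - int b)" "a = 2*k - b" "b \<le> 2*k" by auto
      then show ?thesis using True \<open>a+b=2*k\<close> unfolding y g_def f_def by (auto)
    next
      case False
      then obtain k where k: "a + b + 1 = 2 * k" by (metis add.assoc even_Suc evenE Suc_eq_plus1)
      then have "(int a + int b + 1) div 2 = int k" by linarith
      moreover have "b < a \<Longrightarrow> (a-b-1) div 2 = k - b - 1" "\<not> b < a \<Longrightarrow> (b-a-1) div 2 = k - a - 1" using k by auto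
      ultimately show ?thesis using False k unfolding y g_def f_def by auto
    qed
  qed
  have b: "bij_betw f (UNIV \<times> UNIV) (UNIV \<times> UNIV)"
    by (rule bij_betwI[of _ _ _ g]) (auto simp: gf fg)
  have "phi * psi2 = gf (\<lambda>(h,m). nat (h^2) + 2 * tri m) (UNIV \<times> UNIV)"
    unfolding phi_def psi2_def by (rule gf_times[OF finite_sq finite_2tri])
  also have "\<dots> = gf (\<lambda>(a,b). tri a + tri b) (UNIV \<times> UNIV)"
    by (rule gf_bij[OF b]) (use w in \<open>auto simp: case_prod_unfold\<close>)
  also have "\<dots> = psi * psi" unfolding psi_def by (rule gf_times[symmetric, OF finite_tri finite_tri])
  finally show ?thesis by (simp add: power2_eq_square)
qed

definition sols :: "nat \<Rightarrow> (int \<times> int \<times> int) set" where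
  "sols n = {(x,y,z). x^2 + 4*y*z = 8 * int n + 5 \<and> 0 < y \<and> 0 < z}"

lemma finite_sols: "finite (sols n)"
proof (rule finite_subset)
  let ?M = "8 * int n + 5"
  show "sols n \<subseteq> {-?M..?M} \<times> {0..?M} \<times> {0..?M}"
  proof clarify
    fix x y z assume "(x,y,z) \<in> sols n"
    then have h: "x^2 + 4*y*z = ?M" "0 < y" "0 < z" by (auto simp: sols_def)
    have "0 < y * z" using h by simp
    have "\<bar>x\<bar> \<le> ?M" using h \<open>0 < y * z\<close> int_abs_le_square[of x] mult.assoc[of 4 y z] by linarith
    moreover have "y \<le> y * z" "z \<le> y * z" using h by (auto simp: mult_le_cancel_left1 mult_le_cancel_right1)
    then have "y \<le> ?M" "z \<le> ?M" using h zero_le_power2[of x] \<open>0 < y * z\<close> mult.assoc[of 4 y z] by linarith+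
    ultimately show "x \<in> {-?M..?M} \<and> (y,z) \<in> {0..?M} \<times> {0..?M}" using h by auto
  qed
qed auto

lemma sols_odd: assumes "(x,y,z) \<in> sols n" shows "odd x" "odd y" "odd z"
proof -
  have h: "x^2 + 4*(y*z) = 8 * int n + 5" using assms by (auto simp: sols_def mult.assoc)
  then have "x^2 = 2*(4 * int n + 2 - 2*(y*z)) + 1" by simp
  then have "odd (x^2)" by (metis odd_two_times_div_two_succ dvd_triv_left even_plus_one_iff)
  then show "odd x" by simp
  then obtain k where k: "x = 2*k+1" by (elim oddE)
  then have "4 * (k^2 + k + y*z) = 4 * (2 * int n + 1)" using h by (simp add: power2_eq_square algebra_simps)
  then have "k^2 + k + y*z = 2 * int n + 1" by simp
  moreover have "even (k^2 + k)" by simp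
  ultimately have "y*z = 2 * int n + 1 - (k^2+k)" "even (k^2+k)" by simp_all
  then have "odd (y*z)" by simp
  then show "odd y" "odd z" by auto
qed

text \<open>
  An involution of the type used by Zagier for sums of two squares: on the solutions
  with \<open>z - y < x\<close> the map \<open>(x, y, z) \<mapsto> (2z - x, y + x - z,
  z)\<close> negates the summand corrected by \<open>x (y^2 - z^2)\<close>, and the sum
  of the correction vanishes because it is odd in \<open>x\<close>. The other solutions
  are reached by \<open>(x, y, z) \<mapsto> (- x, z, y)\<close>.
\<close>
lemma sols_sum: "(\<Sum>(x,y,z)\<in>sols n. (y*z - x^2)*(y+z)) = 0"
proof -
  define f :: "int \<times> int \<times> int \<Rightarrow> int" where "f = (\<lambda>(x,y,z). (y*z - x^2)*(y+z))"
  define g :: "int \<times> int \<times> int \<Rightarrow> int" where "g = (\<lambda>(x,y,z). x*(y^2-z^2))"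
  define R where "R = {(x,y,z) \<in> sols n. z - y < x}"
  define R' where "R' = {(x,y,z) \<in> sols n. x < z - y}"
  have fin: "finite R" "finite R'" using finite_sols unfolding R_def R'_def by (auto intro: finite_subset)
  have split: "sum h (sols n) = sum h R + sum h R'" for h :: "int \<times> int \<times> int \<Rightarrow> int"
  proof -
    have "sols n = R \<union> R'"
    proof -
      have "x \<noteq> z - y" if "(x,y,z) \<in> sols n" for x y z using sols_odd[OF that] by auto
      then show ?thesis unfolding R_def R'_def by force
    qed
    moreover have "R \<inter> R' = {}" unfolding R_def R'_def by auto
    ultimately show ?thesis using fin by (simp add: sum.union_disjoint)
  qed
  \<comment> \<open>This symmetry exchanges the two halves.\<close>
  have turn: "sum h R' = sum h R" if "\<And>x y z. h (-x,z,y) = h (x,y,z)" for h :: "int \<times> int \<times> int \<Rightarrow> int"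
    by (rule sum.reindex_bij_witness[of _ "\<lambda>(x,y,z). (-x,z,y)" "\<lambda>(x,y,z). (-x,z,y)"])
      (auto simp: R_def R'_def sols_def that algebra_simps)
  have "sum g (sols n) = sum (\<lambda>v. - g v) (sols n)"
    by (rule sum.reindex_bij_witness[of _ "\<lambda>(x,y,z). (-x,y,z)" "\<lambda>(x,y,z). (-x,y,z)"]) (auto simp: sols_def g_def)
  then have "sum g (sols n) = 0" by (simp add: sum_negf)
  then have g0: "sum g R = 0" using split[of g] turn[of g] by (simp add: g_def algebra_simps)
  have "(\<Sum>v\<in>R. f v - g v) = (\<Sum>v\<in>R. - (f v - g v))"
  proof (rule sum.reindex_bij_witness[of _ "\<lambda>(x,y,z). (2*z-x, y+x-z, z)" "\<lambda>(x,y,z). (2*z-x, y+x-z, z)"])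
    fix v assume v: "v \<in> R"
    obtain x y z where e: "v = (x,y,z)" by (cases v)
    have "(2*z-x)^2 + 4*(y+x-z)*z = x^2 + 4*y*z" by (simp add: power2_eq_square algebra_simps)
    then show "(case v of (x,y,z) \<Rightarrow> (2*z-x, y+x-z, z)) \<in> R" using v unfolding e R_def sols_def by auto
    then show "(case v of (x,y,z) \<Rightarrow> (2*z-x, y+x-z, z)) \<in> R" .
    show "- (f (case v of (x,y,z) \<Rightarrow> (2*z-x, y+x-z, z)) - g (case v of (x,y,z) \<Rightarrow> (2*z-x, y+x-z, z))) = f v - g v"
      unfolding e f_def g_def by (simp add: power2_eq_square algebra_simps)
  qed auto
  then have "sum f R = 0" using g0 by (simp add: sum_subtractf)
  then show ?thesis using split[of f] turn[of f] by (simp add: f_def algebra_simps)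
qed

definition divisor_sum :: "nat \<Rightarrow> nat" where "divisor_sum n = (\<Sum>a | a dvd (2*n+1). a)"

lemma sum_divisor_pairs: "(\<Sum>(y,z) | 0 < y \<and> 0 < z \<and> y * z = 2 * int m + 1. y + z) = 2 * int (divisor_sum m)"
proof -
  let ?P = "{(y,z). 0 < y \<and> 0 < z \<and> y * z = 2 * int m + (1::int)}"
  have b: "(\<Sum>(y,z)\<in>?P. y) = int (divisor_sum m)"
    unfolding divisor_sum_def of_nat_sum
  proof (rule sum.reindex_bij_witness[of _ "\<lambda>a. (int a, int ((2*m+1) div a))" "\<lambda>(y,z). nat y"])
    fix v assume "v \<in> ?P"
    then obtain y z where v: "v = (y,z)" "0 < y" "0 < z" "y * z = 2 * int m + 1" by auto
    obtain y' z' where n: "y = int y'" "z = int z'" using v by (metis zero_less_imp_eq_int)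
    have e: "2*m+1 = y' * z'" using v(4) unfolding n by (metis of_nat_1 of_nat_add of_nat_eq_iff of_nat_mult of_nat_numeral)
    then show "(int (case v of (y,z) \<Rightarrow> nat y), int ((2*m+1) div (case v of (y,z) \<Rightarrow> nat y))) = v"
       "(case v of (y,z) \<Rightarrow> nat y) \<in> {a. a dvd 2*m+1}" "int (case v of (y,z) \<Rightarrow> nat y) = (case v of (y,z) \<Rightarrow> y)"
      using v unfolding e n by auto
  next
    fix a assume "a \<in> {a. a dvd 2*m+1}"
    then obtain b where b: "2*m+1 = a * b" by auto
    then have "0 < a" "0 < b" by (cases a; cases b; auto)+
    moreover have "int a * int b = 2 * int m + 1" using b by (metis of_nat_1 of_nat_add of_nat_mult of_nat_numeral)
    ultimately show "(case (int a, int ((2*m+1) div a)) of (y,z) \<Rightarrow> nat y) = a" "(int a, int ((2*m+1) div a)) \<in> ?P" unfolding b by auto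
  qed
  have "(\<Sum>(y,z)\<in>?P. z) = (\<Sum>(y,z)\<in>?P. y)"
    by (rule sum.reindex_bij_witness[of _ "\<lambda>(y,z). (z,y)" "\<lambda>(y,z). (z,y)"]) (auto simp: mult.commute)
  then show ?thesis using b by (simp add: case_prod_unfold sum.distrib)
qed

text \<open>
  For a fixed odd \<open>x = 2k + 1\<close> the solutions \<open>(y, z)\<close> are the
  factorisations of \<open>2 (n - tri k) + 1\<close>, and the first factor of the
  summand depends on \<open>x\<close> only.
\<close>
lemma divisor_sum_recursion: "(\<Sum>k | tri k \<le> n. (int n - 5 * int (tri k)) * int (divisor_sum (n - tri k))) = 0"
proof -
  let ?K = "{k. tri k \<le> n}"
  have finK: "finite ?K" by (rule finite_subset[of _ "{..n}"]) (auto intro: order_trans[OF tri_ge])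
  define P where "P = (\<lambda>m. {(y,z). 0 < y \<and> 0 < z \<and> y * z = 2 * int m + (1::int)})"
  have finP: "finite (P m)" for m
    by (rule finite_subset[of _ "{0..2*int m+1} \<times> {0..2*int m+1}"])
       (auto simp: P_def intro: order_trans[OF _ order_eq_refl] simp: mult_le_cancel_left1 mult_le_cancel_right1,
        (smt (verit) mult_le_cancel_left1 mult_le_cancel_right1)+)
  define F where "F = (\<lambda>(x,y,z). (y*z - x^2)*(y+z) :: int)"
  have sq: "(2 * int k + 1)^2 = 8 * int (tri k) + 1" for k using int_tri[of k] by (simp add: power2_eq_square algebra_simps)
  have sum_half: "(\<Sum>v | v \<in> sols n \<and> 0 < fst v. F v) = (\<Sum>k\<in>?K. \<Sum>(y,z)\<in>P (n - tri k). F (2 * int k + 1, y, z))"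
  proof -
    have "(\<Sum>k\<in>?K. \<Sum>(y,z)\<in>P (n - tri k). F (2 * int k + 1, y, z)) = (\<Sum>(k,y,z)\<in>(SIGMA k:?K. P (n - tri k)). F (2 * int k + 1, y, z))"
      using finK finP by (subst sum.Sigma) (auto simp: case_prod_unfold)
    also have "\<dots> = (\<Sum>v | v \<in> sols n \<and> 0 < fst v. F v)"
    proof (rule sum.reindex_bij_witness[of _ "\<lambda>(x,y,z). (nat ((x-1) div 2), y, z)" "\<lambda>(k,y,z). (2 * int k + 1, y, z)"])
      fix v assume "v \<in> (SIGMA k:?K. P (n - tri k))"
      then obtain k y z where v: "v = (k,y,z)" "tri k \<le> n" "0 < y" "0 < z" "y * z = 2 * int (n - tri k) + 1" by (auto simp: P_def)
      show "(case v of (k,y,z) \<Rightarrow> (2 * int k + 1, y, z)) \<in> {v. v \<in> sols n \<and> 0 < fst v}"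
        using v sq[of k] by (simp add: sols_def mult.assoc of_nat_diff)
    next
      fix v assume "v \<in> {v. v \<in> sols n \<and> 0 < fst v}"
      then obtain x y z where v: "v = (x,y,z)" "(x,y,z) \<in> sols n" "0 < x" by (cases v) auto
      obtain j where j: "x = 2*j+1" using sols_odd(1)[OF v(2)] by (elim oddE)
      then have "0 \<le> j" using v(3) by linarith
      then obtain k where "j = int k" by (rule nonneg_int_cases)
      then have k: "x = 2 * int k + 1" using j by simp
      have h: "8 * int (tri k) + 1 + 4 * (y*z) = 8 * int n + 5" "0 < y" "0 < z" using v(2) sq[of k] unfolding k sols_def by (auto simp: mult.assoc)
      then have "0 < y * z" by simp
      then have t: "tri k \<le> n" using h by linarith
      then show "(case v of (x,y,z) \<Rightarrow> (nat ((x-1) div 2), y, z)) \<in> (SIGMA k:?K. P (n - tri k))"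
        using h unfolding v k P_def by (auto simp: of_nat_diff)
      show "(case (case v of (x,y,z) \<Rightarrow> (nat ((x-1) div 2), y, z)) of (k,y,z) \<Rightarrow> (2 * int k + 1, y, z)) = v" unfolding v k by simp
    qed auto
    finally show ?thesis by simp
  qed
  have inner: "(\<Sum>(y,z)\<in>P (n - tri k). F (2 * int k + 1, y, z)) = 4 * ((int n - 5 * int (tri k)) * int (divisor_sum (n - tri k)))" if "tri k \<le> n" for k
  proof -
    have "(\<Sum>(y,z)\<in>P (n - tri k). F (2 * int k + 1, y, z)) = (\<Sum>(y,z)\<in>P (n - tri k). 2 * (int n - 5 * int (tri k)) * (y + z))"
    proof (rule sum.cong[OF HOL.refl])
      fix v assume "v \<in> P (n - tri k)"
      then obtain y z where v: "v = (y,z)" "y * z = 2 * int (n - tri k) + 1" by (auto simp: P_def)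
      have "y * z - (2 * int k + 1)^2 = 2 * (int n - 5 * int (tri k))" using v(2) sq[of k] that by (simp add: of_nat_diff)
      then show "(case v of (y,z) \<Rightarrow> F (2 * int k + 1, y, z)) = (case v of (y,z) \<Rightarrow> 2 * (int n - 5 * int (tri k)) * (y + z))"
        unfolding v F_def prod.case by (rule arg_cong)
    qed
    also have "\<dots> = 2 * (int n - 5 * int (tri k)) * (\<Sum>(y,z)\<in>P (n - tri k). y + z)" by (simp add: sum_distrib_left case_prod_unfold)
    also have "(\<Sum>(y,z)\<in>P (n - tri k). y + z) = 2 * int (divisor_sum (n - tri k))" unfolding P_def by (rule sum_divisor_pairs)
    finally show ?thesis by simp
  qed
  have "sum F (sols n) = sum F {v. v \<in> sols n \<and> 0 < fst v} + sum F {v. v \<in> sols n \<and> fst v < 0}"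
  proof -
    have "sols n = {v. v \<in> sols n \<and> 0 < fst v} \<union> {v. v \<in> sols n \<and> fst v < 0}"
    proof -
      have "x \<noteq> 0" if "(x,y,z) \<in> sols n" for x y z using sols_odd[OF that] by auto
      then show ?thesis by (force simp: not_less_iff_gr_or_eq)
    qed
    then show ?thesis using finite_sols by (subst sum.union_disjoint[symmetric]) (auto intro: finite_subset[OF _ finite_sols])
  qed
  also have "sum F {v. v \<in> sols n \<and> fst v < 0} = sum F {v. v \<in> sols n \<and> 0 < fst v}"
    by (rule sum.reindex_bij_witness[of _ "\<lambda>(x,y,z). (-x,y,z)" "\<lambda>(x,y,z). (-x,y,z)"]) (auto simp: sols_def F_def)
  finally have "sum F {v. v \<in> sols n \<and> 0 < fst v} = 0" using sols_sum[of n] by (simp add: F_def)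
  then have "(\<Sum>k\<in>?K. \<Sum>(y,z)\<in>P (n - tri k). F (2 * int k + 1, y, z)) = 0" using sum_half by simp
  then have "(\<Sum>k\<in>?K. 4 * ((int n - 5 * int (tri k)) * int (divisor_sum (n - tri k)))) = 0" using inner by simp
  then show ?thesis by (simp add: sum_distrib_left[symmetric])
qed

definition divisor_series :: "rat fps" where "divisor_series = Abs_fps (\<lambda>n. of_nat (divisor_sum n))"

lemma psi_nth: "psi $ n = (if n \<in> range tri then 1 else 0)"
proof -
  have "card {k \<in> UNIV. tri k = n} = (if n \<in> range tri then 1 else 0)"
  proof (cases "n \<in> range tri")
    case True
    then obtain k where "n = tri k" by auto
    then have "{k \<in> UNIV. tri k = n} = {k}" by (auto simp: tri_inj)
    then show ?thesis using True by simp
  next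
    case False then have "{k \<in> UNIV. tri k = n} = {}" by auto
    then show ?thesis using False by simp
  qed
  then show ?thesis by (simp add: psi_def gf_nth)
qed

text \<open>
  The recursion, read as a differential equation that \<open>psi ^ 4\<close> satisfies
  as well.
\<close>
lemma psi_ode: "psi * fps_XD divisor_series = 4 * fps_XD psi * divisor_series"
proof (rule fps_ext)
  fix n
  have tr: "{i \<in> {0..n}. i \<in> range tri} = tri ` {k. tri k \<le> n}" by auto
  have S: "(\<Sum>i=0..n. psi $ i * f i) = (\<Sum>k | tri k \<le> n. f (tri k))" for f :: "nat \<Rightarrow> rat"
  proof -
    have "(\<Sum>i=0..n. psi $ i * f i) = (\<Sum>i\<in>{i \<in> {0..n}. i \<in> range tri}. f i)"
      by (subst sum.inter_filter) (auto simp: psi_nth intro!: sum.cong)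
    also have "\<dots> = (\<Sum>k | tri k \<le> n. f (tri k))" unfolding tr by (subst sum.reindex) (auto simp: inj_on_def tri_inj)
    finally show ?thesis .
  qed
  have "(psi * fps_XD divisor_series) $ n - (4 * fps_XD psi * divisor_series) $ n = (\<Sum>i=0..n. psi $ i * (of_nat (n-i) * of_nat (divisor_sum (n-i)) - 4 * of_nat i * of_nat (divisor_sum (n - i))))"
  proof -
    have a: "(psi * fps_XD divisor_series) $ n = (\<Sum>i=0..n. psi $ i * (of_nat (n-i) * of_nat (divisor_sum (n-i))))"
      by (simp add: fps_mult_nth divisor_series_def)
    have "(4 * fps_XD psi * divisor_series) $ n = 4 * (fps_XD psi * divisor_series) $ n" by (simp add: mult.assoc numeral_fps_const)
    then have "(4 * fps_XD psi * divisor_series) $ n = (\<Sum>i=0..n. psi $ i * (4 * of_nat i * of_nat (divisor_sum (n - i))))"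
      by (simp add: fps_mult_nth divisor_series_def sum_distrib_left ac_simps)
    then show ?thesis unfolding a by (simp add: sum_subtractf[symmetric] algebra_simps)
  qed
  also have "\<dots> = (\<Sum>k | tri k \<le> n. of_int ((int n - 5 * int (tri k)) * int (divisor_sum (n - tri k))))"
    unfolding S by (rule sum.cong) (auto simp: of_nat_diff algebra_simps)
  also have "\<dots> = 0" using divisor_sum_recursion[of n] by (simp only: of_int_sum[symmetric] of_int_0)
  finally show "(psi * fps_XD divisor_series) $ n = (4 * fps_XD psi * divisor_series) $ n" by simp
qed

lemma psi_0: "psi $ 0 = 1" by (auto simp: psi_nth image_iff tri_def intro!: exI[of _ 0])

text \<open>
  A power series solution of the differential equation is determined by its constant
  term.
\<close>
theorem psi_4: "psi ^ 4 = divisor_series"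
proof -
  have d: "psi * fps_XD (psi ^ 4) = 4 * fps_XD psi * psi ^ 4"
    by (simp add: fps_XD_def fps_deriv_power eval_nat_numeral algebra_simps numeral_fps_const)
  define D where "D = divisor_series - psi ^ 4"
  have ode: "psi * fps_XD D = 4 * fps_XD psi * D" using d psi_ode unfolding D_def by (simp add: fps_XD_def algebra_simps)
  have "divisor_sum 0 = 1" by (simp add: divisor_sum_def)
  then have D0: "D $ 0 = 0" unfolding D_def by (simp add: divisor_series_def psi_0 fps_nth_power_0)
  have "D $ n = 0" for n
  proof (induction n rule: less_induct)
    case (less n)
    show ?case
    proof (cases "n = 0")
      case False
      have "(psi * fps_XD D) $ n = (\<Sum>i=0..n. psi $ i * (of_nat (n-i) * D $ (n-i)))" by (simp add: fps_mult_nth)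
      also have "\<dots> = of_nat n * D $ n" using less by (subst sum.remove[of _ 0]) (auto simp: psi_0 intro!: sum.neutral)
      finally have 1: "(psi * fps_XD D) $ n = of_nat n * D $ n" .
      have "(fps_XD psi * D) $ n = (\<Sum>i=0..n. of_nat i * psi $ i * D $ (n-i))" by (simp add: fps_mult_nth)
      also have "\<dots> = 0" using less by (intro sum.neutral) auto
      finally have "(4 * fps_XD psi * D) $ n = 0" by (simp add: mult.assoc numeral_fps_const)
      then show ?thesis using 1 ode False by simp
    qed (simp add: D0)
  qed
  then have "D = 0" by (simp add: fps_eq_iff)
  then show ?thesis by (simp add: D_def)
qed

section \<open>Sums of triangular numbers\<close>

lemma card_hindex: "card (hindex (2*n+1)) = divisor_sum n"
proof -
  let ?N = "2*n+1"
  have fin: "finite {a. a dvd ?N}" by simp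
  have "bij_betw (\<lambda>(a,j). (int a, 2 * int j + 1)) (SIGMA a:{a. a dvd ?N}. {..<a}) (hindex ?N)"
  proof (rule bij_betwI[of _ _ _ "\<lambda>(a,x). (nat a, nat ((x-1) div 2))"])
    show "(\<lambda>(a,j). (int a, 2 * int j + 1)) \<in> (SIGMA a:{a. a dvd ?N}. {..<a}) \<rightarrow> hindex ?N"
      by (auto simp: hindex_def int_dvd_int_iff[symmetric])
    show "(\<lambda>(a,x). (nat a, nat ((x-1) div 2))) \<in> hindex ?N \<rightarrow> (SIGMA a:{a. a dvd ?N}. {..<a})"
    proof
      fix v assume "v \<in> hindex ?N"
      then obtain a x where v: "v = (a,x)" "0 < a" "a dvd int ?N" "odd x" "0 < x" "x < 2*a" by (auto simp: hindex_def)
      have "nat a dvd ?N" using v(2,3) by (metis int_dvd_int_iff int_nat_eq less_imp_le)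
      then show "(case v of (a,x) \<Rightarrow> (nat a, nat ((x-1) div 2))) \<in> (SIGMA a:{a. a dvd ?N}. {..<a})" using v by auto
    qed
  qed (auto simp: hindex_def elim!: oddE)
  then have "card (hindex ?N) = card (SIGMA a:{a. a dvd ?N}. {..<a})" by (simp add: bij_betw_same_card)
  also have "\<dots> = divisor_sum n" using fin by (simp add: divisor_sum_def)
  finally show ?thesis .
qed

lemma card_hindex2: "card (hindex2 (2*n+1)) = divisor_sum n"
proof -
  have parity: "x + 1 < 2 * a" if "even x" "x < 2 * a" for x a :: int using that by presburger
  have "bij_betw (\<lambda>(a,x). (a, x + 1)) (hindex2 (2*n+1)) (hindex (2*n+1))"
    by (rule bij_betwI[of _ _ _ "\<lambda>(a,x). (a, x - 1)"]) (auto simp: hindex_def hindex2_def intro: parity)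
  then show ?thesis using bij_betw_same_card card_hindex[of n] by metis
qed

text \<open>
  The possible Selling parameters of a positive reduced matrix. As \<open>t\<close> is
  odd, \<open>t^2 = 8 * tri k + 1\<close> for some \<open>k\<close>, and determinant
  \<open>2n + 1\<close> means that the weight below and \<open>tri k\<close> add up to
  \<open>n\<close>.
\<close>
definition forms1 :: "(int \<times> int \<times> int) set" where
  "forms1 = {(p,q,r). 0 < p \<and> 0 < q \<and> 0 < r \<and> odd p \<and> 4 dvd q - p \<and> 4 dvd r - p}"
definition weight1 :: "int \<times> int \<times> int \<Rightarrow> nat" where
  "weight1 = (\<lambda>(p,q,r). nat ((p*q + q*r + r*p - 3) div 8))"

lemma forms1_weight: assumes "(p,q,r) \<in> forms1"
  shows "p*q + q*r + r*p = 8 * int (weight1 (p,q,r)) + 3"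
proof -
  have h: "0 < p" "0 < q" "0 < r" "odd p" "4 dvd q - p" "4 dvd r - p" using assms by (auto simp: forms1_def)
  obtain i j k where e: "p = 2*i+1" "q = p + 4*j" "r = p + 4*k" using h by (metis oddE dvdE add.commute diff_add_cancel)
  obtain m where m: "i * (i+1) = 2 * m" by (metis evenE even_mult_iff even_plus_one_iff)
  have "p*q + q*r + r*p = 12 * (i*(i+1)) + 8 * (j*p + k*p) + 16*(j*k) + 3" unfolding e by (simp add: algebra_simps)
  also have "\<dots> = 8 * (3 * m + j*p + k*p + 2*(j*k)) + 3" unfolding m by (simp add: algebra_simps)
  finally obtain l where d: "p*q + q*r + r*p = 8 * l + 3" by blast
  have "0 < p*q" "0 < q*r" "0 < r*p" using h by simp_all
  then have "0 \<le> l" using d by linarith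
  then show ?thesis unfolding weight1_def prod.case d by simp
qed

lemma finite_forms1: "finite {v \<in> forms1. weight1 v = n}"
proof (rule finite_subset)
  let ?M = "8 * int n + 3"
  show "{v \<in> forms1. weight1 v = n} \<subseteq> {0..?M} \<times> {0..?M} \<times> {0..?M}"
  proof clarify
    fix p q r assume v: "(p,q,r) \<in> forms1" "n = weight1 (p,q,r)"
    have h: "0 < p" "0 < q" "0 < r" using v by (auto simp: forms1_def)
    have "p \<le> p*q" "q \<le> p*q" "r \<le> r*p" "0 < q*r" "0 < r*p" "0 < p*q"
      using h by (simp_all add: mult_le_cancel_left1 mult_le_cancel_right1)
    then have "p \<le> 8 * int (weight1 (p,q,r)) + 3" "q \<le> 8 * int (weight1 (p,q,r)) + 3" "r \<le> 8 * int (weight1 (p,q,r)) + 3"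
      using forms1_weight[OF v(1)] by linarith+
    then show "p \<in> {0..8 * int (weight1 (p,q,r)) + 3} \<and> (q,r) \<in> {0..8 * int (weight1 (p,q,r)) + 3} \<times> {0..8 * int (weight1 (p,q,r)) + 3}"
      using h by simp
  qed
qed simp

text \<open>
  Of the two odd integers with absolute value \<open>2k + 1\<close> exactly one is
  congruent to a given odd number modulo 4, so admissibility fixes the sign of
  \<open>t\<close>.
\<close>
definition sgn4 :: "nat \<Rightarrow> int \<Rightarrow> int" where
  "sgn4 k p = (if 4 dvd (2 * int k + 1) - p then 2 * int k + 1 else - (2 * int k + 1))"

lemma psi_forms1: "psi * gf weight1 forms1 = divisor_series"
proof (rule fps_ext)
  fix n
  have "psi * gf weight1 forms1 = gf (\<lambda>(k,v). tri k + weight1 v) (UNIV \<times> forms1)"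
    unfolding psi_def by (rule gf_times[OF finite_tri finite_forms1])
  then have "(psi * gf weight1 forms1) $ n = of_nat (card {x \<in> UNIV \<times> forms1. (\<lambda>(k,v). tri k + weight1 v) x = n})"
    by (simp add: gf_nth)
  also have "card {x \<in> UNIV \<times> forms1. (\<lambda>(k,v). tri k + weight1 v) x = n} = card (positive_reduced (2*n+1))"
  proof (rule bij_betw_same_card)
    have sq: "(2 * int k + 1)^2 = 8 * int (tri k) + 1" for k using int_tri[of k] by (simp add: power2_eq_square algebra_simps)
    have sg: "(sgn4 k p)^2 = 8 * int (tri k) + 1" for k p using sq[of k] by (auto simp: sgn4_def power2_eq_square algebra_simps)
    have sd: "4 dvd sgn4 k p - p" if "odd p" for k p using that unfolding sgn4_def by auto presburger
    have su: "sgn4 (nat ((\<bar>t\<bar> - 1) div 2)) p = t" if "odd p" "4 dvd t - p" for t p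
    proof -
      have o: "odd t" using that by presburger
      then obtain j where j: "\<bar>t\<bar> = 2*j+1" by (metis dvd_abs_iff oddE)
      then have "2 * int (nat ((\<bar>t\<bar> - 1) div 2)) + 1 = \<bar>t\<bar>" by simp
      then show ?thesis unfolding sgn4_def using that o by (auto simp: abs_if split: if_splits) presburger+
    qed
    show "bij_betw (\<lambda>(k,(p,q,r)). (p,q,r,sgn4 k p)) {x \<in> UNIV \<times> forms1. (\<lambda>(k,v). tri k + weight1 v) x = n} (positive_reduced (2*n+1))"
    proof (rule bij_betwI[of _ _ _ "\<lambda>(p,q,r,t). (nat ((\<bar>t\<bar> - 1) div 2), (p,q,r))"])
      show "(\<lambda>(k,(p,q,r)). (p,q,r,sgn4 k p)) \<in> {x \<in> UNIV \<times> forms1. (\<lambda>(k,v). tri k + weight1 v) x = n} \<rightarrow> positive_reduced (2*n+1)"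
      proof
        fix x assume x: "x \<in> {x \<in> UNIV \<times> forms1. (\<lambda>(k,v). tri k + weight1 v) x = n}"
        obtain k p q r where e: "x = (k,(p,q,r))" by (cases x) auto
        have f: "(p,q,r) \<in> forms1" "tri k + weight1 (p,q,r) = n" using x e by auto
        then show "(case x of (k,(p,q,r)) \<Rightarrow> (p,q,r,sgn4 k p)) \<in> positive_reduced (2*n+1)"
          using forms1_weight[OF f(1)] sg[of k p] sd[of p k] unfolding e by (auto simp: positive_reduced_def forms1_def)
      qed
      show "(\<lambda>(p,q,r,t). (nat ((\<bar>t\<bar> - 1) div 2), (p,q,r))) \<in> positive_reduced (2*n+1) \<rightarrow> {x \<in> UNIV \<times> forms1. (\<lambda>(k,v). tri k + weight1 v) x = n}"
      proof
        fix v assume v: "v \<in> positive_reduced (2*n+1)"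
        obtain p q r t where e: "v = (p,q,r,t)" by (cases v)
        have f: "(p,q,r) \<in> forms1" "odd p" "4 dvd t - p" using v e by (auto simp: positive_reduced_def forms1_def)
        have q: "p*q + q*r + r*p + t^2 = 8 * int n + 4" using v e by (auto simp: positive_reduced_def)
        have "t^2 = 8 * int (tri (nat ((\<bar>t\<bar> - 1) div 2))) + 1" using sg[of "nat ((\<bar>t\<bar> - 1) div 2)" p] su[OF f(2,3)] by simp
        then have "tri (nat ((\<bar>t\<bar> - 1) div 2)) + weight1 (p,q,r) = n" using q forms1_weight[OF f(1)] by linarith
        then show "(case v of (p,q,r,t) \<Rightarrow> (nat ((\<bar>t\<bar> - 1) div 2), (p,q,r))) \<in> {x \<in> UNIV \<times> forms1. (\<lambda>(k,v). tri k + weight1 v) x = n}"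
          using f unfolding e by auto
      qed
      show "\<And>x. (case (case x of (k,(p,q,r)) \<Rightarrow> (p,q,r,sgn4 k p)) of (p,q,r,t) \<Rightarrow> (nat ((\<bar>t\<bar> - 1) div 2), (p,q,r))) = x"
        by (auto simp: sgn4_def)
      show "(case (case v of (p,q,r,t) \<Rightarrow> (nat ((\<bar>t\<bar> - 1) div 2), (p,q,r))) of (k,(p,q,r)) \<Rightarrow> (p,q,r,sgn4 k p)) = v"
        if "v \<in> positive_reduced (2*n+1)" for v
        using that su by (cases v) (auto simp: positive_reduced_def)
    qed
  qed
  also have "\<dots> = divisor_sum n" using bij_betw_same_card[OF positive_reduced_bij[of "2*n+1"]] card_hindex[of n] by simp
  finally show "(psi * gf weight1 forms1) $ n = divisor_series $ n" by (simp add: divisor_series_def)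
qed

theorem psi_cubed: "psi ^ 3 = gf weight1 forms1"
proof -
  have "psi * psi ^ 3 = psi * gf weight1 forms1" using psi_forms1 psi_4 by (simp add: eval_nat_numeral mult.assoc)
  moreover have "psi \<noteq> 0" using psi_0 by auto
  ultimately show ?thesis by simp
qed

text \<open>
  The Selling parameters \<open>(1, 1, 4n + 1)\<close> show that the coefficient of
  \<open>psi ^ 3\<close> is not zero.
\<close>
theorem three_triangular: "\<exists>i j k. n = tri i + tri j + tri k"
proof -
  have "psi ^ 3 = gf (\<lambda>(x,y). tri x + (\<lambda>(x,y). tri x + tri y) y) (UNIV \<times> (UNIV \<times> UNIV))"
    unfolding psi_def power3_eq_cube mult.assoc
    unfolding gf_times[OF finite_tri finite_tri]
    by (rule gf_times[OF finite_tri gf_finite_prod[OF finite_tri finite_tri]])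
  moreover have "psi ^ 3 $ n \<noteq> 0"
  proof -
    have e: "(1, 1, 4 * int n + 1) \<in> forms1" by (auto simp: forms1_def)
    then have "weight1 (1, 1, 4 * int n + 1) = n" using forms1_weight[OF e] by simp
    then have "{v \<in> forms1. weight1 v = n} \<noteq> {}" using e by blast
    then have "card {v \<in> forms1. weight1 v = n} \<noteq> 0" using finite_forms1[of n] by simp
    then show ?thesis by (simp add: psi_cubed gf_nth)
  qed
  ultimately have "card {x. (\<lambda>(x,y). tri x + (\<lambda>(x,y). tri x + tri y) y) x = n} \<noteq> 0" by (auto simp: gf_nth)
  then have "{x. (\<lambda>(x,y). tri x + (\<lambda>(x,y). tri x + tri y) y) x = n} \<noteq> {}" by (metis card.empty)
  then show ?thesis by (auto simp: add.assoc)
qed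

text \<open>
  The data \<open>(a, c, b)\<close> with \<open>s = 2b\<close> of a positive reduced
  matrix; \<open>t = 2h\<close> is arbitrary and contributes the square
  \<open>h^2\<close>.
\<close>
definition forms2 :: "(int \<times> int \<times> int) set" where
  "forms2 = {(a,c,b). odd a \<and> odd c \<and> \<bar>2*b\<bar> < a \<and> \<bar>2*b\<bar> < c}"
definition weight2 :: "int \<times> int \<times> int \<Rightarrow> nat" where
  "weight2 = (\<lambda>(a,c,b). nat ((a*c - 2*b^2 - 1) div 2))"

lemma forms2_weight: assumes "(a,c,b) \<in> forms2"
  shows "a*c - 2*b^2 = 2 * int (weight2 (a,c,b)) + 1" "a * c \<le> 2 * (a*c - 2*b^2)"
proof -
  have h: "odd a" "odd c" "\<bar>2*b\<bar> < a" "\<bar>2*b\<bar> < c" using assms by (auto simp: forms2_def)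
  have "\<bar>2*b\<bar> * \<bar>2*b\<bar> \<le> a * c" using h by (intro mult_mono) auto
  then have q: "4 * b^2 \<le> a * c" by (simp add: power2_eq_square)
  then show "a * c \<le> 2 * (a*c - 2*b^2)" by simp
  have "0 < a * c" using h by (intro mult_pos_pos) auto
  then have p: "0 < a*c - 2*b^2" using q by linarith
  obtain m where "a * c = 2*m+1" using h by (metis even_mult_iff oddE)
  then show "a*c - 2*b^2 = 2 * int (weight2 (a,c,b)) + 1" using p by (simp add: weight2_def)
qed

lemma finite_forms2: "finite {v \<in> forms2. weight2 v = n}"
proof (rule finite_subset)
  let ?M = "4 * int n + 2"
  show "{v \<in> forms2. weight2 v = n} \<subseteq> {0..?M} \<times> {0..?M} \<times> {-?M..?M}"
  proof
    fix v assume v: "v \<in> {v \<in> forms2. weight2 v = n}"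
    obtain a c b where e: "v = (a,c,b)" by (cases v)
    have f: "(a,c,b) \<in> forms2" "weight2 (a,c,b) = n" using v e by auto
    have h: "0 < a" "0 < c" "\<bar>2*b\<bar> < a" using f by (auto simp: forms2_def)
    have "a \<le> a * c" "c \<le> a * c" using h by (simp_all add: mult_le_cancel_left1 mult_le_cancel_right1)
    moreover have "a * c \<le> ?M" using forms2_weight[OF f(1)] f(2) by simp
    ultimately have "a \<le> ?M" "c \<le> ?M" by linarith+
    then show "v \<in> {0..?M} \<times> {0..?M} \<times> {-?M..?M}" using h unfolding e by auto
  qed
qed simp

lemma phi_forms2: "phi * gf weight2 forms2 = divisor_series"
proof (rule fps_ext)
  fix n
  have "phi * gf weight2 forms2 = gf (\<lambda>(h,v). nat (h^2) + weight2 v) (UNIV \<times> forms2)"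
    unfolding phi_def by (rule gf_times[OF finite_sq finite_forms2])
  then have "(phi * gf weight2 forms2) $ n = of_nat (card {x \<in> UNIV \<times> forms2. (\<lambda>(h,v). nat (h^2) + weight2 v) x = n})"
    by (simp add: gf_nth)
  also have "card {x \<in> UNIV \<times> forms2. (\<lambda>(h,v). nat (h^2) + weight2 v) x = n} = card (positive_reduced2 (2*n+1))"
  proof (rule bij_betw_same_card)
    show "bij_betw (\<lambda>(h,(a,c,b)). (a,c,2*b,2*h)) {x \<in> UNIV \<times> forms2. (\<lambda>(h,v). nat (h^2) + weight2 v) x = n} (positive_reduced2 (2*n+1))"
    proof (rule bij_betwI[of _ _ _ "\<lambda>(a,c,s,t). (t div 2, (a,c,s div 2))"])
      show "(\<lambda>(h,(a,c,b)). (a,c,2*b,2*h)) \<in> {x \<in> UNIV \<times> forms2. (\<lambda>(h,v). nat (h^2) + weight2 v) x = n} \<rightarrow> positive_reduced2 (2*n+1)"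
      proof
        fix x assume x: "x \<in> {x \<in> UNIV \<times> forms2. (\<lambda>(h,v). nat (h^2) + weight2 v) x = n}"
        obtain h a c b where e: "x = (h,(a,c,b))" by (cases x) auto
        have f: "(a,c,b) \<in> forms2" "nat (h^2) + weight2 (a,c,b) = n" using x e by auto
        have "int n = h^2 + int (weight2 (a,c,b))" using f(2) by auto
        then have d: "disc (a,c,2*b,2*h) = 2 * int (2*n+1)" using forms2_weight(1)[OF f(1)] by (simp add: power2_eq_square algebra_simps)
        then show "(case x of (h,(a,c,b)) \<Rightarrow> (a,c,2*b,2*h)) \<in> positive_reduced2 (2*n+1)"
          using f(1) unfolding e by (auto simp: positive_reduced2_def forms2_def red2_iff simp del: disc.simps)
      qed
      show "(\<lambda>(a,c,s,t). (t div 2, (a,c,s div 2))) \<in> positive_reduced2 (2*n+1) \<rightarrow> {x \<in> UNIV \<times> forms2. (\<lambda>(h,v). nat (h^2) + weight2 v) x = n}"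
      proof
        fix v assume v: "v \<in> positive_reduced2 (2*n+1)"
        obtain a c s t where e: "v = (a,c,s,t)" by (cases v)
        have d: "disc (a,c,s,t) = 2 * int (2*n+1)" "adm2 (a,c,s,t)" "red2 (a,c,s,t)" "0 < a" using v e by (auto simp: positive_reduced2_def simp del: disc.simps adm2.simps)
        then have "even s" "even t" by (auto simp del: disc.simps)
        then obtain b h where bh: "s = 2*b" "t = 2*h" by (elim evenE)
        have f: "(a,c,b) \<in> forms2" using d bh by (auto simp: forms2_def red2_iff simp del: disc.simps)
        have "a*c - 2*b^2 + 2*h^2 = 2 * int n + 1" using d(1) unfolding bh by (simp add: power2_eq_square)
        then have "h^2 + int (weight2 (a,c,b)) = int n" using forms2_weight(1)[OF f] by linarith
        then have "int (nat (h^2) + weight2 (a,c,b)) = int n" by simp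
        then have "nat (h^2) + weight2 (a,c,b) = n" by (simp only: of_nat_eq_iff)
        then show "(case v of (a,c,s,t) \<Rightarrow> (t div 2, (a,c,s div 2))) \<in> {x \<in> UNIV \<times> forms2. (\<lambda>(h,v). nat (h^2) + weight2 v) x = n}"
          using f unfolding e bh by simp
      qed
      show "\<And>x :: int \<times> int \<times> int \<times> int. (case (case x of (h,(a,c,b)) \<Rightarrow> (a,c,2*b,2*h)) of (a,c,s,t) \<Rightarrow> (t div 2, (a,c,s div 2))) = x" by auto
      show "(case (case v of (a,c,s,t) \<Rightarrow> (t div 2, (a,c,s div 2))) of (h,(a,c,b)) \<Rightarrow> (a,c,2*b,2*h)) = v"
        if "v \<in> positive_reduced2 (2*n+1)" for v
        using that by (cases v) (auto simp: positive_reduced2_def simp del: disc.simps)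
    qed
  qed
  also have "\<dots> = divisor_sum n" using bij_betw_same_card[OF positive_reduced2_bij[of "2*n+1"]] card_hindex2[of n] by simp
  finally show "(phi * gf weight2 forms2) $ n = divisor_series $ n" by (simp add: divisor_series_def)
qed

theorem psi2_psi_squared: "psi2 * psi ^ 2 = gf weight2 forms2"
proof -
  have "phi * (psi2 * psi ^ 2) = psi ^ 4" by (simp add: mult.assoc[symmetric] phi_psi2 flip: power_add)
  then have "phi * (psi2 * psi ^ 2) = phi * gf weight2 forms2" using phi_forms2 psi_4 by simp
  moreover have "phi \<noteq> 0" using phi_psi2 psi_0 by (metis fps_nonzero_nth fps_zero_nth mult_zero_left power_not_zero zero_neq_one)
  ultimately show ?thesis by simp
qed

text \<open>
  The data \<open>(1, 2n + 1, 0)\<close> show that the coefficient is not zero.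
\<close>
theorem two_triangular_and_double: "\<exists>i j k. n = 2 * tri i + tri j + tri k"
proof -
  have "psi2 * psi ^ 2 = gf (\<lambda>(x,y). 2 * tri x + (\<lambda>(x,y). tri x + tri y) y) (UNIV \<times> (UNIV \<times> UNIV))"
    unfolding psi_def psi2_def power2_eq_square gf_times[OF finite_tri finite_tri]
    by (rule gf_times[OF finite_2tri gf_finite_prod[OF finite_tri finite_tri]])
  moreover have "(psi2 * psi ^ 2) $ n \<noteq> 0"
  proof -
    have e: "(1, 2 * int n + 1, 0) \<in> forms2" by (auto simp: forms2_def)
    then have "weight2 (1, 2 * int n + 1, 0) = n" using forms2_weight(1)[OF e] by simp
    then have "{v \<in> forms2. weight2 v = n} \<noteq> {}" using e by blast
    then have "card {v \<in> forms2. weight2 v = n} \<noteq> 0" using finite_forms2[of n] by simp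
    then show ?thesis by (simp add: psi2_psi_squared gf_nth)
  qed
  ultimately have "card {x. (\<lambda>(x,y). 2 * tri x + (\<lambda>(x,y). tri x + tri y) y) x = n} \<noteq> 0" by (auto simp: gf_nth)
  then have "{x. (\<lambda>(x,y). 2 * tri x + (\<lambda>(x,y). tri x + tri y) y) x = n} \<noteq> {}" by (metis card.empty)
  then show ?thesis by (auto simp: add.assoc)
qed

section \<open>Partitions and beta sets\<close>

definition beta :: "(nat \<Rightarrow> nat) \<Rightarrow> int \<Rightarrow> nat \<Rightarrow> int" where
  "beta p s k = int (p k) - int k + s"

definition is_beta :: "int set \<Rightarrow> bool" where
  "is_beta S \<longleftrightarrow> (\<exists>m. {..<m} \<subseteq> S) \<and> (\<exists>M. S \<subseteq> {..M})"

lemma symbol_row_beta: "symbol_row x j = range (beta (fst x ! j) (snd x ! j))"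
  by (simp add: symbol_row_def beta_def[abs_def])

lemma beta_decreasing: assumes "is_partition p" "j < k" shows "beta p s k < beta p s j"
proof -
  have "p k \<le> p j" using assms unfolding is_partition_def antimono_def by auto
  then show ?thesis using assms(2) by (simp add: beta_def)
qed

lemma decreasing_iff:
  fixes f :: "nat \<Rightarrow> int" assumes "\<And>j k. j < k \<Longrightarrow> f k < f j"
  shows "f k < f j \<longleftrightarrow> j < k" "f k = f j \<longleftrightarrow> j = k"
  using assms[of j k] assms[of k j] by (cases j k rule: linorder_cases; simp)+

text \<open>
  The value at \<open>k\<close> is the element of the range with exactly
  \<open>k\<close> larger ones.
\<close>
lemma decreasing_unique:
  fixes f g :: "nat \<Rightarrow> int"
  assumes f: "\<And>j k. j < k \<Longrightarrow> f k < f j" and g: "\<And>j k. j < k \<Longrightarrow> g k < g j" and r: "range f = range g"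
  shows "f = g"
proof
  fix k
  have c: "card {b \<in> range h. h k < b} = k \<and> finite {b \<in> range h. h k < b}" if h: "\<And>j k. j < k \<Longrightarrow> h k < h j" for h :: "nat \<Rightarrow> int"
  proof -
    have "{b \<in> range h. h k < b} = h ` {..<k}" using decreasing_iff(1)[of h, OF h] by auto
    moreover have "inj_on h {..<k}" using decreasing_iff(2)[of h, OF h] by (auto simp: inj_on_def)
    ultimately show ?thesis by (simp add: card_image)
  qed
  have *: "\<not> u k < v k" if u: "\<And>j k. j < k \<Longrightarrow> u k < u j" and v: "\<And>j k. j < k \<Longrightarrow> v k < v j" and "range u = range v" for u v :: "nat \<Rightarrow> int"
  proof
    assume l: "u k < v k"
    have "insert (v k) {b \<in> range v. v k < b} \<subseteq> {b \<in> range u. u k < b}" using l that(3) by auto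
    then have "card (insert (v k) {b \<in> range v. v k < b}) \<le> card {b \<in> range u. u k < b}" using c[of u, OF u] by (intro card_mono) auto
    then show False using c[of u, OF u] c[of v, OF v] by simp
  qed
  show "f k = g k" using *[of f g] *[of g f] assms by force
qed

lemma partition_zero: assumes "is_partition p" obtains N where "\<And>k. N \<le> k \<Longrightarrow> p k = 0"
proof -
  have "finite {k. p k \<noteq> 0}" using assms by (simp add: is_partition_def)
  then obtain N where "\<forall>k\<in>{k. p k \<noteq> 0}. k < N" using finite_nat_set_iff_bounded by blast
  then show ?thesis using that[of N] by (metis (mono_tags, lifting) linorder_not_less mem_Collect_eq)
qed

lemma is_beta_range: assumes "is_partition p" shows "is_beta (range (beta p s))"
proof -
  obtain N where N: "\<And>k. N \<le> k \<Longrightarrow> p k = 0" using partition_zero[OF assms] by blast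
  have "{..<s - int N} \<subseteq> range (beta p s)"
  proof
    fix z assume "z \<in> {..<s - int N}"
    then have "z = beta p s (nat (s - z))" using N[of "nat (s - z)"] by (simp add: beta_def le_nat_iff)
    then show "z \<in> range (beta p s)" by blast
  qed
  moreover have "range (beta p s) \<subseteq> {..int (p 0) + s}"
  proof -
    have "p k \<le> p 0" for k using assms by (auto simp: is_partition_def antimono_def)
    then have "int (p k) \<le> int (p 0)" for k by simp
    then have "beta p s k \<le> int (p 0) + s" for k unfolding beta_def by (smt (verit) of_nat_0_le_iff)
    then show ?thesis by auto
  qed
  ultimately show ?thesis unfolding is_beta_def by blast
qed

text \<open>
  Once the decreasing sequence has passed a level below which the beta set is full, it
  must run through all integers. Comparison with its eventual values \<open>s -
  k\<close> tells where this begins.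
\<close>
lemma beta_level:
  assumes p: "is_partition p" and full: "{..<m} \<subseteq> range (beta p s)"
  shows "m \<le> s + 1" "{b \<in> range (beta p s). m \<le> b} = beta p s ` {..<nat (s - m + 1)}"
    "\<And>k. nat (s - m + 1) \<le> k \<Longrightarrow> p k = 0"
proof -
  let ?f = "beta p s"
  have dec: "\<And>j k. j < k \<Longrightarrow> ?f k < ?f j" using beta_decreasing[OF p] .
  obtain N where N: "\<And>k. N \<le> k \<Longrightarrow> p k = 0" using partition_zero[OF p] by blast
  define K where "K = (LEAST k. ?f k < m)"
  have "?f (N + nat (s - m + 1)) < m" using N by (simp add: beta_def)
  then have K: "?f K < m" unfolding K_def by (rule LeastI)
  have lt: "?f k < m \<longleftrightarrow> K \<le> k" for k
  proof
    assume "?f k < m" then show "K \<le> k" unfolding K_def by (rule Least_le)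
  next
    assume "K \<le> k" then show "?f k < m" using K dec[of K k] by (cases "K = k") auto
  qed
  have "(\<lambda>i. ?f (K + i)) = (\<lambda>i. m - 1 - int i)"
  proof (rule decreasing_unique)
    show "range (\<lambda>i. ?f (K + i)) = range (\<lambda>i. m - 1 - int i)"
    proof
      show "range (\<lambda>i. ?f (K + i)) \<subseteq> range (\<lambda>i. m - 1 - int i)"
      proof clarify
        fix i have "?f (K+i) < m" using lt by simp
        then have "?f (K+i) = m - 1 - int (nat (m - 1 - ?f (K+i)))" by simp
        then show "?f (K+i) \<in> range (\<lambda>i. m - 1 - int i)" by blast
      qed
      show "range (\<lambda>i. m - 1 - int i) \<subseteq> range (\<lambda>i. ?f (K + i))"
      proof clarify
        fix i :: nat
        have "m - 1 - int i \<in> range ?f" using full by auto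
        then obtain k where k: "m - 1 - int i = ?f k" by auto
        then have "K \<le> k" using lt[of k] by simp
        then have "k = K + (k - K)" by simp
        then show "m - 1 - int i \<in> range (\<lambda>i. ?f (K + i))" using k by (metis rangeI)
      qed
    qed
  qed (use dec in auto)
  then have eq: "?f (K + i) = m - 1 - int i" for i by metis
  have "?f (K + N) = s - int (K + N)" using N by (simp add: beta_def)
  then have Ks: "int K = s - m + 1" using eq[of N] by simp
  then show "m \<le> s + 1" by linarith
  have nK: "nat (s - m + 1) = K" using Ks by linarith
  show "{b \<in> range ?f. m \<le> b} = ?f ` {..<nat (s - m + 1)}" unfolding nK using lt by (auto simp: not_less[symmetric])
  show "p k = 0" if "nat (s - m + 1) \<le> k" for k
  proof -
    have "?f k = m - 1 - int (k - K)" using eq[of "k - K"] that nK by simp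
    then show ?thesis using that nK Ks by (simp add: beta_def of_nat_diff)
  qed
qed

lemma beta_level_card:
  assumes "is_partition p" "{..<m} \<subseteq> range (beta p s)"
  shows "finite {b \<in> range (beta p s). m \<le> b}" "int (card {b \<in> range (beta p s). m \<le> b}) = s - m + 1"
    "(\<Sum>b | b \<in> range (beta p s) \<and> m \<le> b. b) = int (psize p) + (\<Sum>k<nat (s - m + 1). s - int k)"
proof -
  let ?n = "nat (s - m + 1)"
  note L = beta_level[OF assms]
  have inj: "inj_on (beta p s) A" for A
    by (rule inj_onI) (simp add: decreasing_iff(2)[of "beta p s", OF beta_decreasing[OF assms(1)]])
  show "finite {b \<in> range (beta p s). m \<le> b}" unfolding L(2) by simp
  show "int (card {b \<in> range (beta p s). m \<le> b}) = s - m + 1" unfolding L(2) using L(1) by (simp add: card_image inj)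
  have "psize p = (\<Sum>k<?n. p k)" unfolding psize_def
  proof (rule sum.mono_neutral_left)
    show "{k. p k \<noteq> 0} \<subseteq> {..<?n}" using L(3) by (metis (mono_tags, lifting) lessThan_iff mem_Collect_eq not_le subsetI)
  qed auto
  moreover have "(\<Sum>b | b \<in> range (beta p s) \<and> m \<le> b. b) = (\<Sum>k<?n. beta p s k)"
    unfolding L(2) by (subst sum.reindex) (auto simp: inj)
  ultimately show "(\<Sum>b | b \<in> range (beta p s) \<and> m \<le> b. b) = int (psize p) + (\<Sum>k<?n. s - int k)"
    by (simp add: beta_def sum.distrib[symmetric] algebra_simps)
qed

lemma beta_inj:
  assumes p: "is_partition p" and q: "is_partition q" and e: "range (beta p s) = range (beta q t)"
  shows "p = q \<and> s = t"
proof -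
  obtain m where m: "{..<m} \<subseteq> range (beta p s)" using is_beta_range[OF p, of s] unfolding is_beta_def by blast
  have st: "s = t" using beta_level_card(2)[OF p m] beta_level_card(2)[OF q m[unfolded e]] e by simp
  have "beta p s = beta q t" by (rule decreasing_unique[OF beta_decreasing[OF p] beta_decreasing[OF q] e])
  then have "beta p s k = beta q t k" for k by simp
  then show ?thesis using st by (auto simp: beta_def)
qed

text \<open>
  The part \<open>p k\<close> counts the gaps below the \<open>k\<close>-th largest
  element. Writing elements as \<open>M - n\<close> allows for the increasing
  enumeration of a set of natural numbers.
\<close>
lemma beta_surj:
  assumes "is_beta S" obtains p s where "is_partition p" "range (beta p s) = S"
proof -
  \<comment> \<open>Elements are counted downwards from the upper bound \<open>M\<close>.\<close>
  obtain m M where mM: "{..<m} \<subseteq> S" "S \<subseteq> {..M}" using assms by (auto simp: is_beta_def)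
  define A where "A = {n. M - int n \<in> S}"
  have co: "- A \<subseteq> {..nat (M - m)}"
  proof
    fix n assume "n \<in> - A"
    then have "\<not> M - int n < m" using mM(1) by (auto simp: A_def)
    then show "n \<in> {..nat (M - m)}" by auto
  qed
  then have fin: "finite (- A)" using finite_subset by blast
  then have inf: "infinite A" using finite_UnI[of A "- A"] by (auto simp: Compl_partition)
  define e where "e = enumerate A"
  have e: "strict_mono e" "range e = A" unfolding e_def using strict_mono_enumerate[OF inf] range_enumerate[OF inf] by auto
  define p where "p k = card {n \<in> - A. e k < n}" for k
  define s where "s = M - int (card (- A))"
  have "antimono p" unfolding antimono_def p_def
  proof (intro allI impI card_mono)
    fix j k :: nat assume "j \<le> k"
    then have "e j \<le> e k" using e(1) by (simp add: strict_mono_less_eq)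
    then show "{n \<in> - A. e k < n} \<subseteq> {n \<in> - A. e j < n}" by auto
  next
    fix j :: nat show "finite {n \<in> - A. e j < n}" by (rule finite_subset[OF _ fin]) auto
  qed
  moreover have "{k. p k \<noteq> 0} \<subseteq> {..nat (M - m)}"
  proof
    fix k assume "k \<in> {k. p k \<noteq> 0}"
    then have "{n \<in> - A. e k < n} \<noteq> {}" unfolding p_def by (metis (mono_tags) card.empty mem_Collect_eq)
    then obtain n where "n \<in> - A" "e k < n" by auto
    then show "k \<in> {..nat (M - m)}" using co strict_mono_imp_increasing[OF e(1), of k] by (metis atMost_iff le_trans less_imp_le subsetD)
  qed
  then have "finite {k. p k \<noteq> 0}" using finite_subset by blast
  ultimately have part: "is_partition p" by (simp add: is_partition_def)
  have "beta p s k = M - int (e k)" for k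
  proof -
    have a: "A \<inter> {..<e k} = e ` {..<k}" using e by (auto simp: strict_mono_less)
    have "card (A \<inter> {..<e k}) = k" unfolding a using e(1) by (simp add: card_image strict_mono_imp_inj_on inj_on_subset)
    moreover have "card (A \<inter> {..<e k} \<union> - A \<inter> {..<e k}) = card (A \<inter> {..<e k}) + card (- A \<inter> {..<e k})"
      by (rule card_Un_disjoint) auto
    moreover have "A \<inter> {..<e k} \<union> - A \<inter> {..<e k} = {..<e k}" by auto
    moreover have "card (- A) = card (- A \<inter> {..<e k}) + card {n \<in> - A. e k < n}"
    proof -
      have "e k \<in> A" using e by auto
      then have eq: "- A = (- A \<inter> {..<e k}) \<union> {n \<in> - A. e k < n}" by (auto simp: not_less le_less)
      have "card ((- A \<inter> {..<e k}) \<union> {n \<in> - A. e k < n}) = card (- A \<inter> {..<e k}) + card {n \<in> - A. e k < n}"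
        by (rule card_Un_disjoint) (auto intro: finite_subset[OF _ fin])
      then show ?thesis unfolding eq[symmetric] .
    qed
    ultimately show ?thesis by (simp add: beta_def p_def s_def)
  qed
  then have "range (beta p s) = (\<lambda>n. M - int n) ` A" unfolding e(2)[symmetric] by auto
  also have "\<dots> = S"
  proof
    show "S \<subseteq> (\<lambda>n. M - int n) ` A"
    proof
      fix z assume "z \<in> S"
      then have "z = M - int (nat (M - z))" using mM(2) by auto
      then show "z \<in> (\<lambda>n. M - int n) ` A" using \<open>z \<in> S\<close> unfolding A_def by (metis (mono_tags, lifting) image_eqI mem_Collect_eq)
    qed
  qed (auto simp: A_def)
  finally show ?thesis using that part by blast
qed

section \<open>Cores\<close>

definition closed_down :: "nat \<Rightarrow> int set \<Rightarrow> bool" where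
  "closed_down d S \<longleftrightarrow> (\<forall>b\<in>S. b - int d \<in> S)"

lemma connected_crossing:
  assumes "connected_cells R" "a \<in> R" "b \<in> R" "fst a \<le> m" "m < fst b"
  shows "\<exists>c. (m,c) \<in> R \<and> (Suc m, c) \<in> R"
proof -
  have "(a,b) \<in> {(x, y). x \<in> R \<and> y \<in> R \<and> adjacent x y}\<^sup>*" using assms by (auto simp: connected_cells_def)
  then show ?thesis using assms(5)
  proof (induction rule: rtrancl_induct)
    case base then show ?case using assms(4) by simp
  next
    case (step y z)
    show ?case
    proof (cases "m < fst y")
      case False
      have "fst y = m" "fst z = Suc m" "snd y = snd z" using False step(2,4) by (auto simp: adjacent_def)
      then show ?thesis using step(2) by (metis (mono_tags, lifting) case_prodD mem_Collect_eq prod.collapse)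
    qed (use step in auto)
  qed
qed

lemma card_skew:
  assumes "is_partition p" "\<And>k. p' k \<le> p k" "\<And>k. k \<notin> {i..j} \<Longrightarrow> p' k = p k"
  shows "card (diagram p - diagram p') = (\<Sum>k\<in>{i..j}. p k - p' k)"
proof -
  have "diagram p - diagram p' = (SIGMA k:{i..j}. {p' k..<p k})"
    using assms(3) by (auto simp: diagram_def) (metis atLeastAtMost_iff less_irrefl not_le order.strict_trans2)+
  then show ?thesis by simp
qed

lemma strip_sum:
  fixes f f' :: "nat \<Rightarrow> int"
  assumes "i \<le> j" "\<And>m. i \<le> m \<Longrightarrow> m < j \<Longrightarrow> f' m = f (Suc m)"
  shows "(\<Sum>k\<in>{i..j}. f k - f' k) = f i - f' j"
  using assms
proof (induction j rule: dec_induct)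
  case (step n)
  have "f' n = f (Suc n)" using step by simp
  then show ?case using step by simp
qed simp

text \<open>
  Connectedness and the absence of 2-by-2 squares force consecutive rows of a rim hook
  to overlap in exactly one column. In terms of beta sets the rows \<open>i, ...,
  j\<close> shift by one index, so that removing the hook replaces the single entry
  \<open>b\<close> of row \<open>i\<close> by \<open>b - card R\<close>.
\<close>
lemma rim_hook_not_closed:
  assumes p: "is_partition p" and R: "removable_rim_hook p R"
  shows "\<not> closed_down (card R) (range (beta p s))"
proof -
  obtain p' where p': "is_partition p'" "diagram p' \<subseteq> diagram p" "R = diagram p - diagram p'"
    and con: "connected_cells R" and no: "\<not> (\<exists>i j. {(i, j), (Suc i, j), (i, Suc j), (Suc i, Suc j)} \<subseteq> R)"
    using R by (auto simp: removable_rim_hook_def)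
  have le: "p' k \<le> p k" for k
  proof (rule ccontr)
    assume "\<not> p' k \<le> p k"
    then have "(k, p k) \<in> diagram p' - diagram p" by (simp add: diagram_def)
    then show False using p'(2) by auto
  qed
  have anti: "antimono p" "antimono p'" using p p' by (auto simp: is_partition_def)
  define I where "I = {k. p' k < p k}"
  have mem: "(k,c) \<in> R \<longleftrightarrow> p' k \<le> c \<and> c < p k" for k c unfolding p'(3) by (auto simp: diagram_def)
  have finI: "finite I" by (rule finite_subset[of _ "{k. p k \<noteq> 0}"]) (use p in \<open>auto simp: I_def is_partition_def\<close>)
  have "R \<noteq> {}" using con by (simp add: connected_cells_def)
  then obtain k c where "(k,c) \<in> R" by auto
  then have neI: "I \<noteq> {}" using mem by (auto simp: I_def intro: le_less_trans)
  define i where "i = Min I"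
  define j where "j = Max I"
  have ij: "i \<in> I" "j \<in> I" "i \<le> j" using finI neI by (auto simp: i_def j_def)
  have out: "p' k = p k" if "k \<notin> {i..j}" for k
  proof -
    have "k \<notin> I" using that finI by (auto simp: i_def j_def)
    then show ?thesis using le[of k] by (simp add: I_def)
  qed
  have strip: "p (Suc m) = Suc (p' m)" if "i \<le> m" "m < j" for m
  proof -
    have "(i, p' i) \<in> R" "(j, p' j) \<in> R" using ij mem by (auto simp: I_def)
    then have "\<exists>c. (m,c) \<in> R \<and> (Suc m,c) \<in> R"
      by (rule connected_crossing[OF con]) (use that in simp_all)
    then obtain c where c: "(m,c) \<in> R" "(Suc m,c) \<in> R" by blast
    then have 1: "p' m < p (Suc m)" using mem by (metis le_less_trans)
    have "p' (Suc m) \<le> p' m" "p (Suc m) \<le> p m" using anti by (auto simp: antimono_def)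
    have "\<not> Suc (p' m) < p (Suc m)"
    proof
      assume "Suc (p' m) < p (Suc m)"
      then have "{(m, p' m), (Suc m, p' m), (m, Suc (p' m)), (Suc m, Suc (p' m))} \<subseteq> R"
        using \<open>p' (Suc m) \<le> p' m\<close> \<open>p (Suc m) \<le> p m\<close> by (simp add: mem)
      then show False using no by blast
    qed
    then show ?thesis using 1 by simp
  qed
  let ?f = "beta p s" and ?f' = "beta p' s"
  have d: "int (card R) = ?f i - ?f' j"
  proof -
    have "int (card R) = (\<Sum>k\<in>{i..j}. ?f k - ?f' k)"
      using card_skew[OF p le out] unfolding p'(3) by (simp add: beta_def of_nat_diff le)
    also have "\<dots> = ?f i - ?f' j" by (rule strip_sum[OF ij(3)]) (simp add: beta_def strip)
    finally show ?thesis .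
  qed
  have "?f' j \<notin> range ?f"
  proof
    assume "?f' j \<in> range ?f"
    then obtain k where k: "?f' j = ?f k" by auto
    have "?f k < ?f j" using k[symmetric] ij(2) by (simp add: beta_def I_def)
    then have "j < k" using decreasing_iff(1)[of ?f k j, OF beta_decreasing[OF p]] by simp
    then have "?f k \<le> ?f (Suc j)" using beta_decreasing[OF p, of "Suc j" k s] by (cases "k = Suc j") auto
    also have "?f (Suc j) = ?f' (Suc j)" using out[of "Suc j"] by (simp add: beta_def)
    also have "\<dots> < ?f' j" using beta_decreasing[OF p'(1)] by simp
    finally show False using k by simp
  qed
  moreover have "?f i - int (card R) = ?f' j" using d by simp
  ultimately show ?thesis unfolding closed_down_def by (metis rangeI)
qed

text \<open>
  Conversely, an entry \<open>b\<close> with \<open>b - d\<close> missing can be moved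
  there. The cells removed by this form a strip from the row \<open>i\<close> of
  \<open>b\<close> to the last row whose entry exceeds \<open>b - d\<close>.
\<close>
lemma not_closed_rim_hook:
  assumes p: "is_partition p" and d: "\<not> closed_down d (range (beta p s))"
  shows "\<exists>R. removable_rim_hook p R \<and> card R = d"
proof -
  let ?f = "beta p s"
  note dec = beta_decreasing[OF p]
  obtain i where i: "?f i - int d \<notin> range ?f" using d by (auto simp: closed_down_def)
  define b where "b = ?f i - int d"
  have d0: "0 < d" using i by (cases d) auto
  define r where "r = (LEAST k. ?f k < b)"
  obtain N where N: "\<And>k. N \<le> k \<Longrightarrow> p k = 0" using partition_zero[OF p] by blast
  have "?f (N + nat (s - b + 1)) < b" using N by (simp add: beta_def)
  then have r: "?f r < b" unfolding r_def by (rule LeastI)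
  have rl: "b < ?f k" if "k < r" for k
  proof -
    have "\<not> ?f k < b" using that not_less_Least unfolding r_def by blast
    moreover have "?f k \<noteq> b" using i unfolding b_def by (metis rangeI)
    ultimately show ?thesis by linarith
  qed
  have "?f r < ?f i" using r d0 unfolding b_def by linarith
  then have ir: "i < r" using decreasing_iff(1)[of ?f r i, OF dec] by simp
  define j where "j = r - 1"
  have ij: "i \<le> j" "r = Suc j" using ir by (auto simp: j_def)
  have pos: "0 < p k" if "k \<le> j" for k
  proof (rule ccontr)
    assume "\<not> 0 < p k"
    then have z: "p m = 0" if "k \<le> m" for m using p that unfolding is_partition_def antimono_def by (metis le_zero_eq not_gr_zero)
    have "b < ?f k" using rl[of k] that ij by simp
    then have "b = ?f (nat (s - b))" using z[of "nat (s - b)"] z[of k] by (simp add: beta_def le_nat_iff)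
    then show False using i unfolding b_def by (metis rangeI)
  qed
  have bj: "s - int j \<le> b" using r ij by (simp add: beta_def)
  define p' where "p' m = (if m < i \<or> j < m then p m else if m = j then nat (b + int j - s) else p (Suc m) - 1)" for m
  let ?f' = "beta p' s"
  have f': "?f' m = (if m < i \<or> j < m then ?f m else if m = j then b else ?f (Suc m))" for m
    using bj pos[of "Suc m"] by (auto simp: beta_def p'_def of_nat_diff)
  have dec': "?f' (Suc m) < ?f' m" for m
  proof -
    have b: "b < ?f m" if "m \<le> j" for m using rl that ij by simp
    have c: "?f (Suc j) < b" using r ij by simp
    note dd = dec[of m "Suc m"] dec[of "Suc m" "Suc (Suc m)"] dec[of m "Suc (Suc m)"]
    consider "Suc m < i" | "Suc m = i" | "i \<le> m" "Suc m < j" | "i \<le> m" "Suc m = j" | "m = j" | "j < m"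
      using ij by linarith
    then show ?thesis unfolding f' by cases (use b[of m] b[of "Suc m"] c dd ij in auto)
  qed
  have anti': "antimono p'"
  proof (rule antimonoI)
    have s: "p' (Suc m) \<le> p' m" for m using dec'[of m] by (simp add: beta_def)
    show "p' y \<le> p' x" if "x \<le> y" for x y using that by (induction rule: dec_induct) (use s le_trans in blast)+
  qed
  have "{k. p' k \<noteq> 0} \<subseteq> {k. p k \<noteq> 0} \<union> {..j}" by (auto simp: p'_def)
  then have part': "is_partition p'" using p anti' by (auto simp: is_partition_def intro: finite_subset)
  have lt: "p' m < p m" if "i \<le> m" "m \<le> j" for m
  proof -
    have "?f' m < ?f m" using f'[of m] that dec[of m "Suc m"] rl[of m] ij by auto
    then show ?thesis by (simp add: beta_def)
  qed
  have out: "p' k = p k" if "k \<notin> {i..j}" for k using that by (auto simp: p'_def)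
  have le: "p' k \<le> p k" for k using lt[of k] out[of k] by (cases "k \<in> {i..j}") auto
  have strip: "p (Suc m) = Suc (p' m)" if "i \<le> m" "m < j" for m
    using that pos[of "Suc m"] by (auto simp: p'_def)
  define R where "R = diagram p - diagram p'"
  have mem: "(k,c) \<in> R \<longleftrightarrow> i \<le> k \<and> k \<le> j \<and> p' k \<le> c \<and> c < p k" for k c
    using out[of k] unfolding R_def by (auto simp: diagram_def) (metis atLeastAtMost_iff not_less)+
  have "int (card R) = ?f i - ?f' j"
  proof -
    have "int (card R) = (\<Sum>k\<in>{i..j}. ?f k - ?f' k)"
      using card_skew[OF p le out] unfolding R_def by (simp add: beta_def of_nat_diff le)
    also have "\<dots> = ?f i - ?f' j" by (rule strip_sum[OF ij(1)]) (simp add: beta_def strip)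
    finally show ?thesis .
  qed
  then have card: "card R = d" using f'[of j] ij by (simp add: b_def)
  let ?E = "{(x, y). x \<in> R \<and> y \<in> R \<and> adjacent x y}"
  have row: "((k,c),(k,p' k)) \<in> ?E\<^sup>*" if "(k,c) \<in> R" for k c
  proof -
    have "p' k \<le> c" using that mem by auto
    then show ?thesis using that
    proof (induction c rule: dec_induct)
      case (step n)
      have n: "(k,n) \<in> R" using step mem by auto
      then have "((k, Suc n), (k,n)) \<in> ?E" using step by (simp add: adjacent_def)
      then show ?case using step.IH[OF n] by (rule converse_rtrancl_into_rtrancl)
    qed simp
  qed
  have sym: "sym (?E\<^sup>*)" by (rule sym_rtrancl) (auto simp: sym_def adjacent_def)
  have col: "((k, p' k), (i, p' i)) \<in> ?E\<^sup>*" if "i \<le> k" "k \<le> j" for k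
    using that
  proof (induction k rule: dec_induct)
    case (step n)
    have s: "p (Suc n) = Suc (p' n)" using strip step by simp
    have "p' (Suc n) < p (Suc n)" using lt step by simp
    then have a: "(Suc n, p' n) \<in> R" using s step mem by auto
    have bb: "(n, p' n) \<in> R" using lt[of n] step mem by auto
    have "((Suc n, p' n), (n, p' n)) \<in> ?E" using a bb by (simp add: adjacent_def)
    moreover have "((Suc n, p' (Suc n)), (Suc n, p' n)) \<in> ?E\<^sup>*" using row[OF a] sym by (auto dest: symD)
    ultimately show ?case using step by (meson Suc_leD rtrancl.rtrancl_into_rtrancl rtrancl_trans)
  qed simp
  have "connected_cells R"
  proof -
    have "(a, (i, p' i)) \<in> ?E\<^sup>*" if a: "a \<in> R" for a
    proof -
      obtain k c where e: "a = (k,c)" by (cases a)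
      have "((k,c),(k,p' k)) \<in> ?E\<^sup>*" using row a e by simp
      moreover have "((k, p' k), (i, p' i)) \<in> ?E\<^sup>*" using col[of k] mem[of k c] a e by simp
      ultimately show ?thesis unfolding e by (rule rtrancl_trans)
    qed
    note to_i = this
    have "(a,b) \<in> ?E\<^sup>*" if "a \<in> R" "b \<in> R" for a b
      by (rule rtrancl_trans[OF to_i[OF that(1)]]) (rule symD[OF sym to_i[OF that(2)]])
    moreover have "(i, p' i) \<in> R" using mem[of i "p' i"] lt[of i] ij by auto
    ultimately show ?thesis unfolding connected_cells_def by blast
  qed
  moreover have "\<not> (\<exists>i j. {(i, j), (Suc i, j), (i, Suc j), (Suc i, Suc j)} \<subseteq> R)"
  proof
    assume "\<exists>i j. {(i, j), (Suc i, j), (i, Suc j), (Suc i, Suc j)} \<subseteq> R"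
    then obtain k c where h: "(k,c) \<in> R" "(Suc k, Suc c) \<in> R" by auto
    then have "p (Suc k) = Suc (p' k)" using strip mem by auto
    then show False using h mem by auto
  qed
  moreover have "diagram p' \<subseteq> diagram p" using le by (auto simp: diagram_def intro: less_le_trans)
  ultimately show ?thesis using card part' R_def unfolding removable_rim_hook_def by blast
qed

theorem core_iff_closed: "core d p \<longleftrightarrow> is_partition p \<and> closed_down d (range (beta p s))"
  unfolding core_def using rim_hook_not_closed not_closed_rim_hook by metis

section \<open>The rank of a symbol\<close>

text \<open>
  \<open>Least\<close> on the integers is meaningful for predicates bounded below.
\<close>
lemma int_Least:
  fixes P :: "int \<Rightarrow> bool"
  assumes "P z" "\<And>z. P z \<Longrightarrow> B \<le> z" shows "P (Least P)" "\<And>z. P z \<Longrightarrow> Least P \<le> z"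
proof -
  define n where "n = (LEAST n. P (B + int n))"
  have "P (B + int (nat (z - B)))" using assms(1) assms(2)[of z] by simp
  then have n: "P (B + int n)" unfolding n_def by (rule LeastI)
  have le: "B + int n \<le> z" if "P z" for z
  proof -
    have "P (B + int (nat (z - B)))" using that assms(2)[of z] by simp
    then have "n \<le> nat (z - B)" unfolding n_def by (rule Least_le)
    then show ?thesis using assms(2)[OF that] by linarith
  qed
  have e: "Least P = B + int n" by (rule Least_equality) (use n le in auto)
  show "P (Least P)" unfolding e by (rule n)
  show "\<And>z. P z \<Longrightarrow> Least P \<le> z" unfolding e by (rule le)
qed

lemma charged_row: assumes "charged_partition l x" "j < l" shows "is_partition (fst x ! j)"
  using assms by (auto simp: charged_partition_def)

lemma charge_sum_eq: "charged_partition l x \<Longrightarrow> charge_sum x = (\<Sum>j<l. snd x ! j)"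
  by (simp add: charged_partition_def charge_sum_def sum_list_sum_nth lessThan_atLeast0)

lemma gap_full: assumes "charged_partition l x" "j < l" shows "{..<gap l x} \<subseteq> symbol_row x j"
proof -
  let ?P = "\<lambda>z. \<exists>j<l. z \<notin> symbol_row x j"
  have b: "is_beta (symbol_row x j)" if "j < l" for j
    unfolding symbol_row_beta by (rule is_beta_range[OF charged_row[OF assms(1) that]])
  have "\<forall>j. \<exists>m. j < l \<longrightarrow> {..<m} \<subseteq> symbol_row x j" using b by (auto simp: is_beta_def)
  then obtain f where f: "\<And>j. j < l \<Longrightarrow> {..<f j} \<subseteq> symbol_row x j" by metis
  define B where "B = Min (f ` {..<l})"
  have lb: "B \<le> z" if P: "?P z" for z
  proof -
    obtain i where i: "i < l" "z \<notin> symbol_row x i" using P by auto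
    then have "f i \<le> z" using f[OF i(1)] by (metis lessThan_iff linorder_not_less subsetD)
    moreover have "B \<le> f i" unfolding B_def using i(1) by (intro Min_le) auto
    ultimately show ?thesis by simp
  qed
  have "\<exists>z. z \<notin> symbol_row x j"
  proof -
    obtain M where "symbol_row x j \<subseteq> {..M}" using b[OF assms(2)] by (auto simp: is_beta_def)
    then have "M + 1 \<notin> symbol_row x j" by auto
    then show ?thesis by blast
  qed
  then obtain z0 where z0: "?P z0" using assms(2) by blast
  show ?thesis
  proof
    fix z assume z: "z \<in> {..<gap l x}"
    show "z \<in> symbol_row x j"
    proof (rule ccontr)
      assume "z \<notin> symbol_row x j"
      then have "?P z" using assms(2) by blast
      have "\<And>w. ?P w \<Longrightarrow> Least ?P \<le> w" by (rule int_Least(2)[of ?P z0 B]) (use z0 lb in blast)+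
      then have "gap l x \<le> z" using \<open>?P z\<close> unfolding gap_def by blast
      then show False using z by simp
    qed
  qed
qed

definition upper :: "nat \<Rightarrow> charged \<Rightarrow> (int \<times> nat) set" where
  "upper l x = {(b, j). j < l \<and> b \<in> symbol_row x j \<and> gap l x \<le> b}"

lemma upper_facts:
  assumes "charged_partition l x"
  shows "finite (upper l x)" "int (card (upper l x)) = charge_sum x + int l * (1 - gap l x)"
    "(\<Sum>(b,j)\<in>upper l x. b) = (\<Sum>j<l. \<Sum>b | b \<in> symbol_row x j \<and> b \<ge> gap l x. b)"
proof -
  let ?m = "gap l x"
  let ?S = "SIGMA j:{..<l}. {b \<in> symbol_row x j. ?m \<le> b}"
  have fin: "finite {b \<in> symbol_row x j. ?m \<le> b}" and card: "int (card {b \<in> symbol_row x j. ?m \<le> b}) = snd x ! j - ?m + 1" if "j < l" for j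
    using beta_level_card(1,2)[OF charged_row[OF assms that] gap_full[OF assms that, unfolded symbol_row_beta]]
    unfolding symbol_row_beta by auto
  have b: "bij_betw (\<lambda>(j,b). (b,j)) ?S (upper l x)"
    by (rule bij_betwI[of _ _ _ "\<lambda>(b,j). (j,b)"]) (auto simp: upper_def)
  show "finite (upper l x)" using bij_betw_finite[OF b] fin by auto
  have "card (upper l x) = card ?S" using bij_betw_same_card[OF b] by simp
  then have "int (card (upper l x)) = (\<Sum>j<l. int (card {b \<in> symbol_row x j. ?m \<le> b}))" using fin by simp
  also have "\<dots> = (\<Sum>j<l. snd x ! j - ?m + 1)" using card by simp
  also have "\<dots> = charge_sum x + int l * (1 - ?m)" unfolding charge_sum_eq[OF assms] by (simp add: sum.distrib sum_subtractf algebra_simps)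
  finally show "int (card (upper l x)) = charge_sum x + int l * (1 - gap l x)" .
  have "(\<Sum>(b,j)\<in>upper l x. b) = (\<Sum>(j,b)\<in>?S. b)"
    using sum.reindex_bij_betw[OF b, of "\<lambda>(b,j). b"] by (simp add: case_prod_unfold)
  also have "\<dots> = (\<Sum>j<l. \<Sum>b | b \<in> symbol_row x j \<and> b \<ge> ?m. b)" using fin by (subst sum.Sigma[symmetric]) auto
  finally show "(\<Sum>(b,j)\<in>upper l x. b) = (\<Sum>j<l. \<Sum>b | b \<in> symbol_row x j \<and> b \<ge> gap l x. b)" .
qed

lemma symbol_rank_upper: "charged_partition l x \<Longrightarrow> symbol_rank l x = (\<Sum>(b,j)\<in>upper l x. b) - int (card (upper l x)) * gap l x
    - \<lfloor>(of_int ((int (card (upper l x)) - 1) * (int (card (upper l x)) - int l + 1)) :: rat) / of_nat (2 * l)\<rfloor>"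
  unfolding symbol_rank_def Let_def upper_facts(3) by (simp add: upper_def)

text \<open>
  The rank and the total charge depend only on the number of rows containing
  \<open>b\<close>, for every \<open>b\<close>.
\<close>
lemma level_permutation:
  assumes x: "charged_partition l x" and y: "charged_partition l y"
    and p: "\<And>b. \<exists>\<pi>. bij_betw \<pi> {..<l} {..<l} \<and> (\<forall>j<l. b \<in> symbol_row y j \<longleftrightarrow> b \<in> symbol_row x (\<pi> j))"
  shows "symbol_rank l y = symbol_rank l x" "charge_sum y = charge_sum x"
proof -
  obtain \<pi> where \<pi>: "\<And>b. bij_betw (\<pi> b) {..<l} {..<l}" "\<And>b j. j < l \<Longrightarrow> b \<in> symbol_row y j \<longleftrightarrow> b \<in> symbol_row x (\<pi> b j)"
    using p by metis
  have lt: "\<pi> b j < l" if "j < l" for b j using \<pi>(1)[of b] that by (auto simp: bij_betw_def)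
  have "(\<exists>j<l. z \<notin> symbol_row y j) \<longleftrightarrow> (\<exists>j<l. z \<notin> symbol_row x j)" for z
  proof
    show "\<exists>j<l. z \<notin> symbol_row y j \<Longrightarrow> \<exists>j<l. z \<notin> symbol_row x j" using \<pi>(2) lt by blast
    assume "\<exists>j<l. z \<notin> symbol_row x j"
    then obtain j where j: "j < l" "z \<notin> symbol_row x j" by auto
    then obtain i where "i < l" "\<pi> z i = j" using bij_betw_imp_surj_on[OF \<pi>(1)[of z]] by (metis imageE lessThan_iff)
    then show "\<exists>j<l. z \<notin> symbol_row y j" using \<pi>(2)[of i z] j by auto
  qed
  then have g: "gap l y = gap l x" by (simp add: gap_def)
  have b: "bij_betw (\<lambda>(b,j). (b, \<pi> b j)) (upper l y) (upper l x)"
  proof (rule bij_betwI')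
    fix u v assume "u \<in> upper l y" "v \<in> upper l y"
    then show "((case u of (b,j) \<Rightarrow> (b, \<pi> b j)) = (case v of (b,j) \<Rightarrow> (b, \<pi> b j))) = (u = v)"
      using bij_betw_imp_inj_on[OF \<pi>(1)] by (auto simp: upper_def inj_on_def)
  next
    fix u assume "u \<in> upper l y"
    then show "(case u of (b,j) \<Rightarrow> (b, \<pi> b j)) \<in> upper l x" using \<pi>(2) lt g by (auto simp: upper_def)
  next
    fix v assume v: "v \<in> upper l x"
    obtain b j where e: "v = (b,j)" by (cases v)
    have j: "j < l" "b \<in> symbol_row x j" "gap l x \<le> b" using v e by (auto simp: upper_def)
    then obtain i where "i < l" "\<pi> b i = j" using bij_betw_imp_surj_on[OF \<pi>(1)[of b]] by (metis imageE lessThan_iff)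
    then show "\<exists>u\<in>upper l y. v = (case u of (b,j) \<Rightarrow> (b, \<pi> b j))" using \<pi>(2) j g e by (intro bexI[of _ "(b,i)"]) (auto simp: upper_def)
  qed
  have c: "card (upper l y) = card (upper l x)" using b by (rule bij_betw_same_card)
  have s: "(\<Sum>(b,j)\<in>upper l y. b) = (\<Sum>(b,j)\<in>upper l x. b)"
    using sum.reindex_bij_betw[OF b, of "\<lambda>(b,j). b"] by (simp add: case_prod_unfold)
  show "symbol_rank l y = symbol_rank l x" unfolding symbol_rank_upper[OF x] symbol_rank_upper[OF y] c s g ..
  show "charge_sum y = charge_sum x" using upper_facts(2)[OF x] upper_facts(2)[OF y] c g by simp
qed

lemma sum_descending: "0 \<le> n \<Longrightarrow> 2 * (\<Sum>k<nat n. s - int k) = n * (2 * s - n + 1)"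
proof -
  have "2 * (\<Sum>k<m. s - int k) = int m * (2 * s - int m + 1)" for m
    by (induction m) (simp_all add: algebra_simps)
  then show "0 \<le> n \<Longrightarrow> ?thesis" by simp
qed

lemma floor_cancel: "0 < l \<Longrightarrow> \<lfloor>(of_int (2 * int l * k) :: rat) / of_nat (2 * l)\<rfloor> = k"
proof -
  assume "0 < l"
  then have "(of_int (2 * int l * k) :: rat) / of_nat (2 * l) = of_int k" by simp
  then show ?thesis by (simp only: floor_of_int)
qed

text \<open>
  Relative to the gap \<open>m\<close>, a row with charge \<open>s\<close> has \<open>s
  - m + 1\<close> entries, so there are \<open>c = 1 + l (1 - m)\<close> in total. This
  makes the fraction in the definition of the rank an integer, and the terms in
  \<open>m\<close> cancel.
\<close>
theorem symbol_rank_eq: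
  assumes x: "charged_partition l x" and l: "0 < l" and s: "charge_sum x = 1"
  shows "2 * symbol_rank l x = 2 * (\<Sum>j<l. int (psize (fst x ! j))) + ((\<Sum>j<l. (snd x ! j)^2) - 1)"
proof -
  define m where "m = gap l x"
  define u where "u = 1 - m"
  define Q where "Q = (\<Sum>j<l. (snd x ! j)^2)"
  define c where "c = int (card (upper l x))"
  have full: "{..<m} \<subseteq> range (beta (fst x ! j) (snd x ! j))" if "j < l" for j
    using gap_full[OF x that] by (simp add: m_def symbol_row_beta)
  note part = charged_row[OF x]
  have c: "c = 1 + int l * u" using upper_facts(2)[OF x] s by (simp add: c_def u_def m_def)
  have S: "(\<Sum>j<l. snd x ! j) = 1" using charge_sum_eq[OF x] s by simp
  have row: "2 * (\<Sum>b | b \<in> symbol_row x j \<and> b \<ge> m. b) = 2 * int (psize (fst x ! j)) + (snd x ! j + u) * (snd x ! j + m)" if "j < l" for j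
  proof -
    have "m \<le> snd x ! j + 1" using beta_level(1)[OF part[OF that] full[OF that]] .
    then show ?thesis unfolding symbol_row_beta beta_level_card(3)[OF part[OF that] full[OF that]] distrib_left
      by (subst sum_descending) (auto simp: u_def algebra_simps)
  qed
  have "2 * (\<Sum>j<l. \<Sum>b | b \<in> symbol_row x j \<and> b \<ge> m. b) = (\<Sum>j<l. 2 * int (psize (fst x ! j)) + (snd x ! j + u) * (snd x ! j + m))"
    by (subst sum_distrib_left) (simp add: row)
  also have "\<dots> = 2 * (\<Sum>j<l. int (psize (fst x ! j))) + (\<Sum>j<l. (snd x ! j)^2 + snd x ! j + (1-m)*m)"
  proof -
    have "(\<Sum>j<l. 2 * int (psize (fst x ! j)) + (snd x ! j + u) * (snd x ! j + m)) =
        (\<Sum>j<l. 2 * int (psize (fst x ! j)) + ((snd x ! j)^2 + snd x ! j + (1-m)*m))"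
      by (rule sum.cong) (simp_all add: u_def power2_eq_square algebra_simps)
    then show ?thesis by (simp only: sum.distrib sum_distrib_left)
  qed
  also have "(\<Sum>j<l. (snd x ! j)^2 + snd x ! j + (1-m)*m) = Q + 1 + int l * (u * m)"
    unfolding sum.distrib S Q_def by (simp add: u_def)
  finally have tot: "2 * (\<Sum>j<l. \<Sum>b | b \<in> symbol_row x j \<and> b \<ge> m. b) = 2 * (\<Sum>j<l. int (psize (fst x ! j))) + (Q + 1 + int l * (u * m))" .
  obtain w where w: "u * (u - 1) = 2 * w" by (metis evenE even_mult_iff even_diff even_plus_one_iff diff_add_cancel)
  have "(c - 1) * (c - int l + 1) = (2 * int l) * (int l * w + u)"
  proof -
    have "(c - 1) * (c - int l + 1) = int l * (int l * (u * (u - 1)) + 2 * u)" unfolding c by (simp add: algebra_simps)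
    then show ?thesis unfolding w by (simp add: algebra_simps)
  qed
  then have fl: "\<lfloor>(of_int ((c - 1) * (c - int l + 1)) :: rat) / of_nat (2 * l)\<rfloor> = int l * w + u"
    using l by (simp only: floor_cancel)
  have "symbol_rank l x = (\<Sum>j<l. \<Sum>b | b \<in> symbol_row x j \<and> b \<ge> m. b) - c * m - (int l * w + u)"
    unfolding symbol_rank_upper[OF x] upper_facts(3)[OF x] c_def[symmetric] m_def[symmetric] fl ..
  then have "2 * symbol_rank l x = 2 * (\<Sum>j<l. int (psize (fst x ! j))) + (Q + 1 + int l * (u * m)) - 2 * (c * m) - (int l * (u * (u - 1)) + 2 * u)"
    using tot w by simp
  then show ?thesis unfolding Q_def[symmetric] c by (simp add: u_def algebra_simps)
qed

lemma sum_square_parity: fixes l :: nat shows "even ((\<Sum>j<l. (f j)^2) - (\<Sum>j<l. f j :: int))"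
  by (induction l) auto

theorem charge_rank_eq:
  assumes "length s = l" "sum_list s = 1" "0 < l"
  shows "2 * charge_rank l s = (\<Sum>j<l. (s ! j)^2) - 1"
proof -
  define Q where "Q = (\<Sum>j<l. (s ! j)^2)"
  have S: "(\<Sum>j<l. s ! j) = 1" using assms by (simp add: sum_list_sum_nth lessThan_atLeast0)
  have "(\<Sum>j\<in>{..<l} - {i}. s ! i * (s ! i - s ! j)) = (\<Sum>j<l. s ! i * (s ! i - s ! j))" for i
    by (rule sum.mono_neutral_left) auto
  then have "(\<Sum>i<l. \<Sum>j\<in>{..<l} - {i}. s ! i * (s ! i - s ! j)) = (\<Sum>i<l. \<Sum>j<l. s ! i * (s ! i - s ! j))" by simp
  also have "\<dots> = (\<Sum>i<l. int l * (s ! i)^2 - s ! i * (\<Sum>j<l. s ! j))"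
    by (simp add: right_diff_distrib sum_subtractf sum_distrib_left power2_eq_square)
  also have "\<dots> = int l * Q - 1" unfolding S Q_def by (simp add: sum_subtractf sum_distrib_left[symmetric] S)
  finally have Y: "(\<Sum>i<l. \<Sum>j\<in>{..<l} - {i}. s ! i * (s ! i - s ! j)) = int l * Q - 1" .
  have "even (Q - 1)" using sum_square_parity[of "\<lambda>j. s ! j" l] unfolding S Q_def .
  then obtain k where k: "Q - 1 = 2 * k" by (elim evenE)
  have "int l * Q - 1 - int l + 1 = (2 * int l) * k" using k by (simp add: algebra_simps flip: k)
  then have "charge_rank l s = k" unfolding charge_rank_def Let_def Y using assms(3) by simp
  then show ?thesis using k by (simp add: Q_def)
qed

lemma charge_rank_nonneg: assumes "length s = l" "sum_list s = 1" "0 < l" shows "0 \<le> charge_rank l s"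
proof -
  have "\<exists>j<l. s ! j \<noteq> 0"
  proof (rule ccontr)
    assume "\<not> ?thesis"
    then have "(\<Sum>j<l. s ! j) = 0" by simp
    then show False using assms by (simp add: sum_list_sum_nth lessThan_atLeast0)
  qed
  then obtain j where j: "j < l" "s ! j \<noteq> 0" by auto
  then have "1 \<le> (s ! j)^2" by (simp add: int_one_le_iff_zero_less)
  also have "\<dots> \<le> (\<Sum>j<l. (s ! j)^2)" using j by (intro member_le_sum) auto
  finally show ?thesis using charge_rank_eq[OF assms] by linarith
qed

section \<open>Straightening spetsial cores\<close>

definition from_rows :: "nat \<Rightarrow> (nat \<Rightarrow> int set) \<Rightarrow> charged" where
  "from_rows l R = (let D = \<lambda>S. SOME z. is_partition (fst z) \<and> range (beta (fst z) (snd z)) = S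
     in (map (\<lambda>j. fst (D (R j))) [0..<l], map (\<lambda>j. snd (D (R j))) [0..<l]))"

text \<open>
  By \<open>beta_surj\<close> the choice in the definition succeeds for every beta set.
\<close>
lemma from_rows: assumes "\<And>j. j < l \<Longrightarrow> is_beta (R j)"
  shows "charged_partition l (from_rows l R)" "\<And>j. j < l \<Longrightarrow> symbol_row (from_rows l R) j = R j"
proof -
  define D where "D S = (SOME z. is_partition (fst z) \<and> range (beta (fst z) (snd z)) = S)" for S
  have D: "is_partition (fst (D S)) \<and> range (beta (fst (D S)) (snd (D S))) = S" if S: "is_beta S" for S
  proof -
    obtain p s where "is_partition p" "range (beta p s) = S" using beta_surj[OF S] by blast
    then have "is_partition (fst (p,s)) \<and> range (beta (fst (p,s)) (snd (p,s))) = S" by simp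
    then show ?thesis unfolding D_def by (rule someI)
  qed
  have e: "from_rows l R = (map (\<lambda>j. fst (D (R j))) [0..<l], map (\<lambda>j. snd (D (R j))) [0..<l])"
    by (simp add: from_rows_def D_def Let_def)
  show "charged_partition l (from_rows l R)" using D assms unfolding e charged_partition_def by auto
  show "\<And>j. j < l \<Longrightarrow> symbol_row (from_rows l R) j = R j" using D assms unfolding e symbol_row_beta by simp
qed

lemma rows_inj:
  assumes x: "charged_partition l x" and y: "charged_partition l y" and e: "\<And>j. j < l \<Longrightarrow> symbol_row x j = symbol_row y j"
  shows "x = y"
proof -
  have "fst x ! j = fst y ! j \<and> snd x ! j = snd y ! j" if "j < l" for j
    using beta_inj[OF charged_row[OF x that] charged_row[OF y that]] e[OF that] by (simp add: symbol_row_beta)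
  then show ?thesis using x y by (intro prod_eqI nth_equalityI) (auto simp: charged_partition_def)
qed

lemma row_is_beta: "charged_partition l x \<Longrightarrow> j < l \<Longrightarrow> is_beta (symbol_row x j)"
  unfolding symbol_row_beta by (rule is_beta_range[OF charged_row])

text \<open>
  Row indices are taken modulo \<open>l\<close>; integer arguments allow for shifts in
  both directions.
\<close>
definition cyc :: "nat \<Rightarrow> int \<Rightarrow> nat" where "cyc l z = nat (z mod int l)"

lemma cyc_less: "0 < l \<Longrightarrow> cyc l z < l" by (simp add: cyc_def nat_less_iff)
lemma cyc_id: "j < l \<Longrightarrow> cyc l (int j) = j" by (simp add: cyc_def)
lemma cyc_add: "0 < l \<Longrightarrow> cyc l (int (cyc l z) + w) = cyc l (z + w)" by (simp add: cyc_def mod_add_left_eq)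
lemma cyc_Suc: "0 < l \<Longrightarrow> Suc j mod l = cyc l (int j + 1)" by (simp add: cyc_def) (metis add.commute nat_int of_nat_Suc zmod_int)
lemma cyc_bij: "0 < l \<Longrightarrow> bij_betw (\<lambda>j. cyc l (int j + w)) {..<l} {..<l}"
  by (rule bij_betwI[of _ _ _ "\<lambda>j. cyc l (int j - w)"]) (auto simp: cyc_less cyc_add cyc_id cyc_add[of l _ "- w", simplified])

text \<open>
  An entry \<open>b\<close> in row \<open>j\<close> moves to row \<open>j - w b\<close>
  modulo \<open>l\<close>.
\<close>
definition twist :: "nat \<Rightarrow> (int \<Rightarrow> int) \<Rightarrow> charged \<Rightarrow> charged" where
  "twist l w x = from_rows l (\<lambda>t. {b. b \<in> symbol_row x (cyc l (int t + w b))})"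

lemma twist:
  assumes x: "charged_partition l x" and l: "0 < l"
  shows "charged_partition l (twist l w x)"
    "\<And>t. t < l \<Longrightarrow> symbol_row (twist l w x) t = {b. b \<in> symbol_row x (cyc l (int t + w b))}"
    "symbol_rank l (twist l w x) = symbol_rank l x" "charge_sum (twist l w x) = charge_sum x"
proof -
  have b: "is_beta {b. b \<in> symbol_row x (cyc l (int t + w b))}" for t
  proof -
    have "\<forall>j. \<exists>M. j < l \<longrightarrow> symbol_row x j \<subseteq> {..M}" using row_is_beta[OF x] by (auto simp: is_beta_def)
    then obtain M where M: "\<And>j. j < l \<Longrightarrow> symbol_row x j \<subseteq> {..M j}" by metis
    have "{b. b \<in> symbol_row x (cyc l (int t + w b))} \<subseteq> {..Max (M ` {..<l})}"
    proof
      fix b assume "b \<in> {b. b \<in> symbol_row x (cyc l (int t + w b))}"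
      then have "b \<le> M (cyc l (int t + w b))" using M[OF cyc_less[OF l]] by auto
      also have "\<dots> \<le> Max (M ` {..<l})" using cyc_less[OF l] by (intro Max_ge) auto
      finally show "b \<in> {..Max (M ` {..<l})}" by simp
    qed
    moreover have "{..<gap l x} \<subseteq> {b. b \<in> symbol_row x (cyc l (int t + w b))}"
      using gap_full[OF x cyc_less[OF l]] by auto
    ultimately show ?thesis unfolding is_beta_def by blast
  qed
  show c: "charged_partition l (twist l w x)" and r: "\<And>t. t < l \<Longrightarrow> symbol_row (twist l w x) t = {b. b \<in> symbol_row x (cyc l (int t + w b))}"
    unfolding twist_def using from_rows[of l, OF b] by auto
  have p: "\<exists>\<pi>. bij_betw \<pi> {..<l} {..<l} \<and> (\<forall>j<l. b \<in> symbol_row (twist l w x) j \<longleftrightarrow> b \<in> symbol_row x (\<pi> j))" for b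
    using cyc_bij[OF l, of "w b"] r by (intro exI[of _ "\<lambda>j. cyc l (int j + w b)"]) auto
  show "symbol_rank l (twist l w x) = symbol_rank l x" "charge_sum (twist l w x) = charge_sum x"
    using level_permutation[OF x c p] by auto
qed

lemma twist_untwist: assumes x: "charged_partition l x" and l: "0 < l" shows "twist l (\<lambda>b. - w b) (twist l w x) = x"
proof (rule rows_inj[OF twist(1)[OF twist(1)[OF x l] l] x])
  fix j assume j: "j < l"
  have e: "cyc l (int (cyc l (int j + - w b)) + w b) = j" for b using cyc_add[OF l, of "int j + - w b" "w b"] cyc_id[OF j] by simp
  show "symbol_row (twist l (\<lambda>b. - w b) (twist l w x)) j = symbol_row x j"
    unfolding twist(2)[OF twist(1)[OF x l] l j] twist(2)[OF x l cyc_less[OF l]] by (simp add: e[simplified])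
qed

definition ordinary_core :: "nat \<Rightarrow> nat \<Rightarrow> charged \<Rightarrow> bool" where
  "ordinary_core l d x \<longleftrightarrow> charged_partition l x \<and> (\<forall>p\<in>set (fst x). core d p)"

lemma ordinary_core_iff: "ordinary_core l d x \<longleftrightarrow> charged_partition l x \<and> (\<forall>j<l. closed_down d (symbol_row x j))"
proof (cases "charged_partition l x")
  case True
  then have "(\<forall>p\<in>set (fst x). core d p) \<longleftrightarrow> (\<forall>j<l. core d (fst x ! j))" by (simp add: charged_partition_def) (metis in_set_conv_nth)
  also have "\<dots> \<longleftrightarrow> (\<forall>j<l. closed_down d (symbol_row x j))"
  proof -
    have "core d (fst x ! j) \<longleftrightarrow> closed_down d (symbol_row x j)" if "j < l" for j
      using core_iff_closed[of d "fst x ! j" "snd x ! j"] charged_row[OF True that] by (simp add: symbol_row_beta)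
    then show ?thesis by simp
  qed
  finally show ?thesis using True by (simp add: ordinary_core_def)
qed (simp add: ordinary_core_def)

text \<open>
  Subtracting \<open>d\<close> lowers \<open>b div d\<close> by one, which cancels the
  step to the next row.
\<close>
lemma twist_core:
  assumes l: "0 < l" and d: "0 < d"
  shows "spetsial_core l d x \<Longrightarrow> ordinary_core l d (twist l (\<lambda>b. - (b div int d)) x)"
    "ordinary_core l d y \<Longrightarrow> spetsial_core l d (twist l (\<lambda>b. b div int d) y)"
proof -
  have dv: "(b - int d) div int d = b div int d - 1" for b
    using div_mult_self1[of "int d" b "-1"] d by simp
  { assume x: "spetsial_core l d x"
    then have c: "charged_partition l x" by (simp add: spetsial_core_def)
    show "ordinary_core l d (twist l (\<lambda>b. - (b div int d)) x)"
      unfolding ordinary_core_iff closed_down_def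
    proof (intro conjI allI impI ballI)
      show "charged_partition l (twist l (\<lambda>b. - (b div int d)) x)" by (rule twist(1)[OF c l])
      fix j b assume j: "j < l" and "b \<in> symbol_row (twist l (\<lambda>b. - (b div int d)) x) j"
      then have "b \<in> symbol_row x (cyc l (int j - b div int d))" unfolding twist(2)[OF c l j] by simp
      then have "b - int d \<in> symbol_row x (Suc (cyc l (int j - b div int d)) mod l)" using x cyc_less[OF l] by (simp add: spetsial_core_def)
      also have "Suc (cyc l (int j - b div int d)) mod l = cyc l (int j + - ((b - int d) div int d))"
        unfolding cyc_Suc[OF l] cyc_add[OF l] dv by (simp add: algebra_simps)
      finally show "b - int d \<in> symbol_row (twist l (\<lambda>b. - (b div int d)) x) j" unfolding twist(2)[OF c l j] by simp
    qed }
  { assume y: "ordinary_core l d y"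
    then have c: "charged_partition l y" by (simp add: ordinary_core_def)
    show "spetsial_core l d (twist l (\<lambda>b. b div int d) y)"
      unfolding spetsial_core_def
    proof (intro conjI allI impI ballI)
      show "charged_partition l (twist l (\<lambda>b. b div int d) y)" by (rule twist(1)[OF c l])
      fix j b assume j: "j < l" and "b \<in> symbol_row (twist l (\<lambda>b. b div int d) y) j"
      then have "b \<in> symbol_row y (cyc l (int j + b div int d))" unfolding twist(2)[OF c l j] by simp
      then have "b - int d \<in> symbol_row y (cyc l (int j + b div int d))" using y cyc_less[OF l] by (simp add: ordinary_core_iff closed_down_def)
      also have "cyc l (int j + b div int d) = cyc l (int (Suc j mod l) + (b - int d) div int d)"
        unfolding cyc_Suc[OF l] cyc_add[OF l] dv by (simp add: algebra_simps)
      finally show "b - int d \<in> symbol_row (twist l (\<lambda>b. b div int d) y) (Suc j mod l)"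
        using l by (subst twist(2)[OF c l]) auto
    qed }
qed

definition spetsial_set :: "nat \<Rightarrow> nat \<Rightarrow> nat \<Rightarrow> charged set" where
  "spetsial_set l d n = {x. spetsial_core l d x \<and> charge_sum x = 1 \<and> symbol_rank l x = int n}"
definition ordinary_set :: "nat \<Rightarrow> nat \<Rightarrow> nat \<Rightarrow> charged set" where
  "ordinary_set l d n = {x. ordinary_core l d x \<and> charge_sum x = 1 \<and> symbol_rank l x = int n}"

theorem twist_bij: assumes l: "0 < l" and d: "0 < d"
  shows "bij_betw (twist l (\<lambda>b. - (b div int d))) (spetsial_set l d n) (ordinary_set l d n)"
proof (rule bij_betwI[of _ _ _ "twist l (\<lambda>b. b div int d)"])
  show "twist l (\<lambda>b. - (b div int d)) \<in> spetsial_set l d n \<rightarrow> ordinary_set l d n"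
    using twist_core(1)[OF l d] twist(3,4)[OF _ l] by (auto simp: spetsial_set_def ordinary_set_def spetsial_core_def)
  show "twist l (\<lambda>b. b div int d) \<in> ordinary_set l d n \<rightarrow> spetsial_set l d n"
    using twist_core(2)[OF l d] twist(3,4)[OF _ l] by (auto simp: spetsial_set_def ordinary_set_def ordinary_core_def)
  show "twist l (\<lambda>b. b div int d) (twist l (\<lambda>b. - (b div int d)) x) = x" if "x \<in> spetsial_set l d n" for x
    using twist_untwist[OF _ l, of x "\<lambda>b. - (b div int d)"] that by (simp add: spetsial_set_def spetsial_core_def)
  show "twist l (\<lambda>b. - (b div int d)) (twist l (\<lambda>b. b div int d) x) = x" if "x \<in> ordinary_set l d n" for x
    using twist_untwist[OF _ l, of x "\<lambda>b. b div int d"] that by (simp add: ordinary_set_def ordinary_core_def)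
qed

section \<open>The generating function of ordinary cores\<close>

lemma finite_partitions: "finite {p. is_partition p \<and> psize p = n}"
proof (rule finite_subset)
  show "finite {p. \<forall>k. (k \<in> {..<n} \<longrightarrow> p k \<in> {..n}) \<and> (k \<notin> {..<n} \<longrightarrow> p k = (0::nat))}"
    by (rule finite_set_of_finite_funs) auto
  show "{p. is_partition p \<and> psize p = n} \<subseteq> {p. \<forall>k. (k \<in> {..<n} \<longrightarrow> p k \<in> {..n}) \<and> (k \<notin> {..<n} \<longrightarrow> p k = 0)}"
  proof clarify
    fix p k assume p: "is_partition p"
    have fin: "finite {j. p j \<noteq> 0}" and anti: "\<And>i j. i \<le> j \<Longrightarrow> p j \<le> p i" using p by (auto simp: is_partition_def antimono_def)
    have "p k \<le> psize p"
    proof (cases "p k = 0")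
      case False then show ?thesis unfolding psize_def using fin by (intro member_le_sum) auto
    qed simp
    moreover have "p k = 0" if "psize p \<le> k"
    proof (rule ccontr)
      assume nz: "p k \<noteq> 0"
      then have sub: "{..k} \<subseteq> {j. p j \<noteq> 0}" using anti by fastforce
      have "Suc k \<le> (\<Sum>j\<in>{..k}. p j)"
      proof -
        have "(\<Sum>j\<in>{..k}. 1) \<le> (\<Sum>j\<in>{..k}. p j)" using sub by (intro sum_mono) (auto simp: Suc_le_eq)
        then show ?thesis by simp
      qed
      also have "\<dots> \<le> psize p" unfolding psize_def using fin sub by (intro sum_mono2) auto
      finally show False using that by simp
    qed
    ultimately show "(k \<in> {..<psize p} \<longrightarrow> p k \<in> {..psize p}) \<and> (k \<notin> {..<psize p} \<longrightarrow> p k = 0)" by auto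
  qed
qed

lemma finite_cores: "finite {p \<in> {p. core d p}. psize p = n}"
  by (rule finite_subset[OF _ finite_partitions[of n]]) (auto simp: core_def)

definition tuples :: "nat \<Rightarrow> 'a set \<Rightarrow> 'a list set" where "tuples l A = {xs. length xs = l \<and> set xs \<subseteq> A}"

lemma tuples_Suc: "bij_betw (\<lambda>(x,xs). x # xs) (A \<times> tuples l A) (tuples (Suc l) A)"
  by (rule bij_betwI[of _ _ _ "\<lambda>xs. (hd xs, tl xs)"]) (auto simp: tuples_def length_Suc_conv)

text \<open>
  Finiteness is part of the induction, since \<open>gf_times\<close> needs it for both
  factors.
\<close>
lemma gf_power:
  assumes fin: "\<And>n. finite {x \<in> A. f x = (n::nat)}"
  shows "(\<forall>n. finite {xs \<in> tuples l A. sum_list (map f xs) = n}) \<and> gf f A ^ l = gf (\<lambda>xs. sum_list (map f xs)) (tuples l A)"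
proof (induction l)
  case 0
  have e: "{xs \<in> tuples 0 A. sum_list (map f xs) = n} = (if n = 0 then {[]} else {})" for n by (auto simp: tuples_def)
  show ?case unfolding gf_def e by (auto simp: fps_eq_iff)
next
  case (Suc l)
  have F: "\<And>n. finite {xs \<in> tuples l A. sum_list (map f xs) = n}" using Suc by blast
  have "gf f A ^ Suc l = gf (\<lambda>(x,xs). f x + sum_list (map f xs)) (A \<times> tuples l A)"
    using Suc gf_times[OF fin F] by simp
  also have "\<dots> = gf (\<lambda>xs. sum_list (map f xs)) (tuples (Suc l) A)"
    by (rule gf_bij[OF tuples_Suc]) auto
  finally have 1: "gf f A ^ Suc l = gf (\<lambda>xs. sum_list (map f xs)) (tuples (Suc l) A)" .
  have "finite {xs \<in> tuples (Suc l) A. sum_list (map f xs) = n}" for n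
  proof (rule finite_subset)
    show "finite ((\<lambda>(x,xs). x # xs) ` {z \<in> A \<times> tuples l A. (\<lambda>(x,xs). f x + sum_list (map f xs)) z = n})"
      using gf_finite_prod[OF fin F] by (rule finite_imageI)
    show "{xs \<in> tuples (Suc l) A. sum_list (map f xs) = n} \<subseteq> (\<lambda>(x,xs). x # xs) ` {z \<in> A \<times> tuples l A. (\<lambda>(x,xs). f x + sum_list (map f xs)) z = n}"
    proof
      fix xs assume "xs \<in> {xs \<in> tuples (Suc l) A. sum_list (map f xs) = n}"
      then obtain y ys where "xs = y # ys" "y \<in> A" "ys \<in> tuples l A" "f y + sum_list (map f ys) = n" by (auto simp: tuples_def length_Suc_conv)
      then show "xs \<in> (\<lambda>(x,xs). x # xs) ` {z \<in> A \<times> tuples l A. (\<lambda>(x,xs). f x + sum_list (map f xs)) z = n}" by force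
    qed
  qed
  then show ?case using 1 by blast
qed

definition charges :: "nat \<Rightarrow> int list set" where "charges l = {s. length s = l \<and> sum_list s = 1}"

text \<open>
  A charge of rank \<open>n\<close> has sum of squares \<open>2n + 1\<close>, which
  bounds its entries.
\<close>
lemma finite_charges: assumes l: "0 < l" shows "finite {s \<in> charges l. nat (charge_rank l s) = n}"
proof (rule finite_subset)
  let ?M = "2 * int n + 1"
  show "finite {s. set s \<subseteq> {-?M..?M} \<and> length s = l}" by (rule finite_lists_length_eq) simp
  show "{s \<in> charges l. nat (charge_rank l s) = n} \<subseteq> {s. set s \<subseteq> {-?M..?M} \<and> length s = l}"
  proof clarify
    fix s assume s: "s \<in> charges l" "n = nat (charge_rank l s)"
    then have h: "length s = l" "sum_list s = 1" by (auto simp: charges_def)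
    have Q: "(\<Sum>j<l. (s ! j)^2) = 2 * int (nat (charge_rank l s)) + 1"
      using charge_rank_eq[OF h l] charge_rank_nonneg[OF h l] by simp
    have "x \<in> {-(2 * int (nat (charge_rank l s)) + 1)..2 * int (nat (charge_rank l s)) + 1}" if x: "x \<in> set s" for x
    proof -
      obtain j where j: "j < l" "x = s ! j" using x h by (metis in_set_conv_nth)
      have "x^2 \<le> (\<Sum>j<l. (s ! j)^2)" unfolding j(2) using j(1) by (intro member_le_sum) auto
      then show ?thesis using int_abs_le_square[of x] Q by auto
    qed
    then show "set s \<subseteq> {-(2 * int (nat (charge_rank l s)) + 1)..2 * int (nat (charge_rank l s)) + 1} \<and> length s = l" using h by blast
  qed
qed

lemma charge_rank_gf1_eq: assumes l: "0 < l" shows "charge_rank_gf1 l = gf (\<lambda>s. nat (charge_rank l s)) (charges l)"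
proof -
  have "{s. length s = l \<and> sum_list s = 1 \<and> charge_rank l s = int n} = {s \<in> charges l. nat (charge_rank l s) = n}" for n
    using charge_rank_nonneg[OF _ _ l] by (auto simp: charges_def)
  then show ?thesis by (simp add: charge_rank_gf1_def gf_def)
qed

lemma core_gf_eq: "core_gf d = gf psize {p. core d p}"
  by (simp add: core_gf_def gf_def)

theorem ordinary_gf:
  assumes l: "0 < l"
  shows "finite (ordinary_set l d n)" "of_nat (card (ordinary_set l d n)) = (charge_rank_gf1 l * core_gf d ^ l) $ n"
proof -
  let ?f = "\<lambda>s. nat (charge_rank l s)" and ?g = "\<lambda>ps. sum_list (map psize ps)"
  let ?P = "{z \<in> charges l \<times> tuples l {p. core d p}. (\<lambda>(s,ps). ?f s + ?g ps) z = n}"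
  have G: "\<And>n. finite {xs \<in> tuples l {p. core d p}. ?g xs = n}" and P: "core_gf d ^ l = gf ?g (tuples l {p. core d p})"
    using gf_power[of "{p. core d p}" psize l, OF finite_cores] unfolding core_gf_eq by auto
  have b: "bij_betw (\<lambda>(s,ps). (ps,s)) ?P (ordinary_set l d n)"
  proof (rule bij_betwI[of _ _ _ "\<lambda>(ps,s). (s,ps)"])
    have key: "(s,ps) \<in> ?P \<longleftrightarrow> (ps,s) \<in> ordinary_set l d n" for s ps
    proof (cases "length s = l \<and> length ps = l \<and> sum_list s = 1 \<and> (\<forall>p\<in>set ps. core d p)")
      case True
      then have c: "charged_partition l (ps,s)" "charge_sum (ps,s) = 1" by (auto simp: charged_partition_def charge_sum_def core_def)
      have "2 * symbol_rank l (ps,s) = 2 * (\<Sum>j<l. int (psize (ps ! j))) + 2 * charge_rank l s"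
        using symbol_rank_eq[OF c(1) l c(2)] charge_rank_eq[of s l] True l by simp
      moreover have "int (?g ps) = (\<Sum>j<l. int (psize (ps ! j)))"
        using True by (simp add: sum_list_sum_nth lessThan_atLeast0)
      moreover have "int (?f s) = charge_rank l s" using charge_rank_nonneg[of s l] True l by simp
      ultimately have "symbol_rank l (ps,s) = int (?f s + ?g ps)" by simp
      then show ?thesis using True c by (auto simp: charges_def tuples_def ordinary_set_def ordinary_core_def)
    next
      case False
      then show ?thesis by (auto simp: charges_def tuples_def ordinary_set_def ordinary_core_def charged_partition_def charge_sum_def)
    qed
    show "(\<lambda>(s,ps). (ps,s)) \<in> ?P \<rightarrow> ordinary_set l d n" using key by auto
    show "(\<lambda>(ps,s). (s,ps)) \<in> ordinary_set l d n \<rightarrow> ?P"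
    proof
      fix v assume v: "v \<in> ordinary_set l d n"
      obtain ps s where "v = (ps,s)" by (cases v)
      then show "(case v of (ps,s) \<Rightarrow> (s,ps)) \<in> ?P" using key[of s ps] v by simp
    qed
  qed auto
  show "finite (ordinary_set l d n)" using bij_betw_finite[OF b] gf_finite_prod[OF finite_charges[OF l] G] by simp
  have "(charge_rank_gf1 l * core_gf d ^ l) $ n = of_nat (card ?P)"
    unfolding charge_rank_gf1_eq[OF l] P gf_times[OF finite_charges[OF l] G] by (simp add: gf_nth)
  then show "of_nat (card (ordinary_set l d n)) = (charge_rank_gf1 l * core_gf d ^ l) $ n"
    using bij_betw_same_card[OF b] by simp
qed

section \<open>Cyclic orbits\<close>

definition rot_charged :: "nat \<Rightarrow> charged \<Rightarrow> charged" where
  "rot_charged k x = (rotate k (fst x), rotate k (snd x))"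

lemma cyclic_orbit_rot: "cyclic_orbit x = range (\<lambda>k. rot_charged k x)"
  by (auto simp: cyclic_orbit_def rot_charged_def)
lemma rot_charged_add: "rot_charged i (rot_charged j x) = rot_charged (i + j) x" by (simp add: rot_charged_def rotate_rotate)
lemma rot_charged_mod: "charged_partition l x \<Longrightarrow> rot_charged (k mod l) x = rot_charged k x"
  by (simp add: rot_charged_def charged_partition_def) (metis rotate_conv_mod)
lemma charged_rot: "charged_partition l x \<Longrightarrow> charged_partition l (rot_charged k x)"
  by (simp add: rot_charged_def charged_partition_def)
lemma row_rot: "charged_partition l x \<Longrightarrow> j < l \<Longrightarrow> symbol_row (rot_charged k x) j = symbol_row x ((j + k) mod l)"
  by (simp add: symbol_row_def rot_charged_def charged_partition_def nth_rotate add.commute)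

lemma rot_invariants: assumes x: "charged_partition l x" and l: "0 < l"
  shows "symbol_rank l (rot_charged k x) = symbol_rank l x" "charge_sum (rot_charged k x) = charge_sum x"
proof -
  have "bij_betw (\<lambda>j. cyc l (int j + int k)) {..<l} {..<l}" by (rule cyc_bij[OF l])
  moreover have "cyc l (int j + int k) = (j + k) mod l" for j by (simp add: cyc_def flip: of_nat_add zmod_int)
  ultimately have b: "bij_betw (\<lambda>j. (j + k) mod l) {..<l} {..<l}" by simp
  have "\<exists>\<pi>. bij_betw \<pi> {..<l} {..<l} \<and> (\<forall>j<l. z \<in> symbol_row (rot_charged k x) j \<longleftrightarrow> z \<in> symbol_row x (\<pi> j))" for z
    using b row_rot[OF x] by blast
  then show "symbol_rank l (rot_charged k x) = symbol_rank l x" "charge_sum (rot_charged k x) = charge_sum x"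
    using level_permutation[OF x charged_rot[OF x]] by blast+
qed

lemma spetsial_rot: assumes "spetsial_core l d x" "0 < l" shows "spetsial_core l d (rot_charged k x)"
proof -
  have x: "charged_partition l x" using assms by (simp add: spetsial_core_def)
  show ?thesis unfolding spetsial_core_def
  proof (intro conjI allI impI ballI)
    show "charged_partition l (rot_charged k x)" by (rule charged_rot[OF x])
    fix j b assume j: "j < l" "b \<in> symbol_row (rot_charged k x) j"
    then have "b - int d \<in> symbol_row x (Suc ((j + k) mod l) mod l)" using assms row_rot[OF x] by (simp add: spetsial_core_def)
    also have "Suc ((j + k) mod l) mod l = (Suc j mod l + k) mod l" by (simp add: mod_Suc_eq mod_add_left_eq)
    finally show "b - int d \<in> symbol_row (rot_charged k x) (Suc j mod l)" using row_rot[OF x] assms(2) by simp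
  qed
qed

lemma spetsial_set_rot: "x \<in> spetsial_set l d n \<Longrightarrow> 0 < l \<Longrightarrow> rot_charged k x \<in> spetsial_set l d n"
  using spetsial_rot[of l d x k] rot_invariants[of l x k] unfolding spetsial_set_def by (simp add: spetsial_core_def[of l d x])

text \<open>
  If rotation by \<open>k\<close> fixes the list, so does rotation by the greatest
  common divisor \<open>g\<close> of \<open>k\<close> and the length. The list is then a
  repetition of its first \<open>g\<close> entries, and the number of repetitions
  divides the sum 1.
\<close>
lemma rotate_free:
  fixes s :: "int list"
  assumes s: "sum_list s = 1" and k: "0 < k" "k < length s" shows "rotate k s \<noteq> s"
proof
  assume r: "rotate k s = s"
  let ?l = "length s"
  define g where "g = gcd k ?l"
  have pw: "rotate (k * a) s = s" for a
    by (induction a) (simp_all add: rotate_rotate[symmetric] r)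
  obtain a b where ab: "k * a = ?l * b + g" using bezout_nat[of k ?l] k by (auto simp: g_def)
  have "rotate g s = s"
  proof -
    have "rotate (k * a) s = rotate g s" unfolding ab by (metis mod_mult_self4 rotate_conv_mod mult.commute)
    then show ?thesis using pw by simp
  qed
  define f where "f j = s ! (j mod ?l)" for j
  have per: "f (j + g) = f j" for j
  proof -
    have "s ! (j mod ?l) = rotate g s ! (j mod ?l)" using \<open>rotate g s = s\<close> by simp
    also have "\<dots> = s ! ((g + j mod ?l) mod ?l)" by (rule nth_rotate, rule mod_less_divisor) (use k in linarith)
    finally show ?thesis by (simp add: f_def mod_add_right_eq add.commute)
  qed
  have per': "f (m * g + j) = f j" for m j
  proof (induction m)
    case (Suc m) then show ?case using per[of "m * g + j"] by (simp add: algebra_simps)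
  qed simp
  obtain h where h: "?l = h * g" by (metis dvdE g_def gcd_dvd2 mult.commute)
  have "1 = (\<Sum>j<?l. f j)" using s by (simp add: sum_list_sum_nth lessThan_atLeast0 f_def)
  also have "\<dots> = (\<Sum>m<h. sum f {m * g..<m * g + g})" unfolding h by (rule sum.nat_group[symmetric])
  also have "\<dots> = (\<Sum>m<h. sum f {..<g})"
  proof (rule sum.cong[OF HOL.refl])
    fix m
    have "sum f {m * g..<m * g + g} = sum (\<lambda>j. f (m * g + j)) {..<g}"
      using sum.shift_bounds_nat_ivl[of f 0 "m * g" g] by (simp add: add.commute lessThan_atLeast0)
    then show "sum f {m * g..<m * g + g} = sum f {..<g}" by (simp add: per')
  qed
  also have "\<dots> = int h * sum f {..<g}" by simp
  finally have "int h * sum f {..<g} = 1" by simp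
  then have "h = 1" by (simp add: zmult_eq_1_iff)
  then have "?l = g" using h by simp
  moreover have "g \<le> k" using k by (auto simp: g_def intro: gcd_le1_nat)
  ultimately show False using k by simp
qed

lemma card_orbit: assumes x: "charged_partition l x" "charge_sum x = 1" and l: "0 < l" shows "card (cyclic_orbit x) = l"
proof -
  have e: "cyclic_orbit x = (\<lambda>k. rot_charged k x) ` {..<l}"
  proof
    show "cyclic_orbit x \<subseteq> (\<lambda>k. rot_charged k x) ` {..<l}"
      unfolding cyclic_orbit_rot using rot_charged_mod[OF x(1)] l by (force intro: image_eqI[of _ _ "_ mod l"])
  qed (auto simp: cyclic_orbit_rot)
  have "inj_on (\<lambda>k. rot_charged k x) {..<l}"
  proof -
    have no: "rot_charged i x \<noteq> rot_charged j x" if ij: "i < j" "j < l" for i j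
    proof
      assume "rot_charged i x = rot_charged j x"
      then have "rotate i (snd x) = rotate i (rotate (j - i) (snd x))" using ij by (simp add: rot_charged_def rotate_rotate)
      then have "rotate (l - i) (rotate i (snd x)) = rotate (l - i) (rotate i (rotate (j - i) (snd x)))" by simp
      then have "rotate l (snd x) = rotate l (rotate (j - i) (snd x))" using ij by (simp add: rotate_rotate)
      moreover have "length (snd x) = l" using x(1) by (simp add: charged_partition_def)
      ultimately have "snd x = rotate (j - i) (snd x)" by (simp del: rotate_rotate)
      moreover have "0 < j - i" "j - i < length (snd x)" "sum_list (snd x) = 1"
        using ij x by (auto simp: charge_sum_def charged_partition_def)
      ultimately show False using rotate_free[of "snd x" "j - i"] by metis
    qed
    show ?thesis using no by (metis inj_onI lessThan_iff linorder_neqE_nat)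
  qed
  then show ?thesis unfolding e by (simp add: card_image)
qed

lemma orbit_eq: assumes x: "charged_partition l x" and l: "0 < l" and y: "y \<in> cyclic_orbit x" shows "cyclic_orbit y = cyclic_orbit x"
proof -
  obtain k where k: "y = rot_charged k x" using y by (auto simp: cyclic_orbit_rot)
  have "x = rot_charged (l - k mod l) y"
  proof -
    have "(l - k mod l + k) mod l = 0" using l by (metis add.commute le_add_diff_inverse mod_add_left_eq mod_le_divisor mod_less_divisor mod_self less_imp_le)
    then have "rot_charged (l - k mod l + k) x = rot_charged 0 x" using rot_charged_mod[OF x, of "l - k mod l + k"] by simp
    then show ?thesis unfolding k rot_charged_add by (simp add: rot_charged_def)
  qed
  then have "rot_charged m x = rot_charged (m + (l - k mod l)) y" for m by (metis rot_charged_add)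
  then show ?thesis unfolding cyclic_orbit_rot using k rot_charged_add by (auto simp: image_iff) metis+
qed

text \<open>
  The integer \<open>d\<close> in the definition of a cuspidal is determined by
  \<open>e\<close>, and an orbit consists of spetsial cores as soon as one of its
  elements is a spetsial core.
\<close>
lemma Phi_cuspidals_eq: assumes l: "0 < l" shows "Phi_cuspidals l (d * l) n = cyclic_orbit ` spetsial_set l d n"
proof
  show "Phi_cuspidals l (d * l) n \<subseteq> cyclic_orbit ` spetsial_set l d n"
  proof
    fix X assume "X \<in> Phi_cuspidals l (d * l) n"
    then obtain x d' where x: "charged_partition l x" "charge_sum x = 1" "symbol_rank l x = int n" "X = cyclic_orbit x"
      and d: "d * l = d' * l" "\<forall>x\<in>X. spetsial_core l d' x" by (auto simp: Phi_cuspidals_def unipotent_characters_def)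
    have "x \<in> X" unfolding x(4) cyclic_orbit_rot by (rule range_eqI[of _ _ 0]) (simp add: rot_charged_def)
    then show "X \<in> cyclic_orbit ` spetsial_set l d n" using x d l by (auto simp: spetsial_set_def)
  qed
  show "cyclic_orbit ` spetsial_set l d n \<subseteq> Phi_cuspidals l (d * l) n"
    using spetsial_rot l by (auto simp: Phi_cuspidals_def unipotent_characters_def spetsial_set_def spetsial_core_def cyclic_orbit_rot)
qed

theorem cuspidal_count:
  assumes l: "0 < l" and d: "0 < d"
  shows "finite (Phi_cuspidals l (d * l) n)" "l * card (Phi_cuspidals l (d * l) n) = card (ordinary_set l d n)"
proof -
  have fin: "finite (spetsial_set l d n)" using bij_betw_finite[OF twist_bij[OF l d]] ordinary_gf(1)[OF l] by blast
  then show f: "finite (Phi_cuspidals l (d * l) n)" unfolding Phi_cuspidals_eq[OF l] by simp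
  let ?C = "cyclic_orbit ` spetsial_set l d n"
  have U: "\<Union>?C = spetsial_set l d n"
  proof
    show "\<Union>?C \<subseteq> spetsial_set l d n" using spetsial_set_rot l by (auto simp: cyclic_orbit_rot)
    show "spetsial_set l d n \<subseteq> \<Union>?C"
    proof
      fix x assume "x \<in> spetsial_set l d n"
      moreover have "x \<in> cyclic_orbit x" unfolding cyclic_orbit_rot by (rule range_eqI[of _ _ 0]) (simp add: rot_charged_def)
      ultimately show "x \<in> \<Union>?C" by blast
    qed
  qed
  have ch: "charged_partition l x" "charge_sum x = 1" if "x \<in> spetsial_set l d n" for x using that by (auto simp: spetsial_set_def spetsial_core_def)
  have "l * card ?C = card (\<Union>?C)"
  proof (rule card_partition)
    show "finite ?C" using fin by simp
    show "finite (\<Union>?C)" unfolding U by (rule fin)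
    show "card c = l" if "c \<in> ?C" for c using that card_orbit ch l by auto
    show "c1 \<inter> c2 = {}" if "c1 \<in> ?C" "c2 \<in> ?C" "c1 \<noteq> c2" for c1 c2
    proof (rule ccontr)
      assume "c1 \<inter> c2 \<noteq> {}"
      then obtain z where z: "z \<in> c1" "z \<in> c2" by auto
      then have "cyclic_orbit z = c1" "cyclic_orbit z = c2" using that(1,2) orbit_eq ch l by blast+
      then show False using that(3) by simp
    qed
  qed
  then show "l * card (Phi_cuspidals l (d * l) n) = card (ordinary_set l d n)"
    unfolding Phi_cuspidals_eq[OF l] U using bij_betw_same_card[OF twist_bij[OF l d]] by simp
qed

theorem cuspidal_gf:
  assumes l: "0 < l" and d: "0 < d"
  shows "Abs_fps (\<lambda>n. rat_of_nat (card (Phi_cuspidals l (d * l) n))) = fps_const (1 / rat_of_nat l) * charge_rank_gf1 l * core_gf d ^ l"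
proof (rule fps_ext)
  fix n
  have "rat_of_nat l * rat_of_nat (card (Phi_cuspidals l (d * l) n)) = (charge_rank_gf1 l * core_gf d ^ l) $ n"
    unfolding ordinary_gf(2)[OF l, symmetric] of_nat_mult[symmetric] cuspidal_count(2)[OF l d] ..
  then show "Abs_fps (\<lambda>n. rat_of_nat (card (Phi_cuspidals l (d * l) n))) $ n = (fps_const (1 / rat_of_nat l) * charge_rank_gf1 l * core_gf d ^ l) $ n"
    using l by (simp add: mult.assoc) (simp add: field_simps)
qed

lemma cuspidal_exists_iff:
  assumes l: "0 < l" and d: "0 < d"
  shows "Phi_cuspidals l (d * l) n \<noteq> {} \<longleftrightarrow>
    (\<exists>s ps. length s = l \<and> length ps = l \<and> sum_list s = (1::int) \<and> (\<forall>p\<in>set ps. core d p) \<and>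
       2 * int n = 2 * (\<Sum>j<l. int (psize (ps ! j))) + (\<Sum>j<l. (s ! j)^2) - 1)"
proof -
  have "Phi_cuspidals l (d * l) n \<noteq> {} \<longleftrightarrow> ordinary_set l d n \<noteq> {}"
    using cuspidal_count[OF l d, of n] ordinary_gf(1)[OF l, of d n] l by (metis card_0_eq mult_is_0 neq0_conv)
  also have "\<dots> \<longleftrightarrow> (\<exists>s ps. (ps,s) \<in> ordinary_set l d n)" by auto
  also have "\<dots> \<longleftrightarrow> (\<exists>s ps. length s = l \<and> length ps = l \<and> sum_list s = (1::int) \<and> (\<forall>p\<in>set ps. core d p) \<and>
       2 * int n = 2 * (\<Sum>j<l. int (psize (ps ! j))) + (\<Sum>j<l. (s ! j)^2) - 1)"
  proof (intro ex_cong1)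
    fix s ps
    have "(ps,s) \<in> ordinary_set l d n \<longleftrightarrow> (length s = l \<and> length ps = l \<and> sum_list s = 1 \<and> (\<forall>p\<in>set ps. core d p)) \<and> symbol_rank l (ps,s) = int n"
      by (auto simp: ordinary_set_def ordinary_core_def charged_partition_def charge_sum_def core_def)
    moreover have "2 * symbol_rank l (ps,s) = 2 * (\<Sum>j<l. int (psize (ps ! j))) + (\<Sum>j<l. (s ! j)^2) - 1"
      if "length s = l \<and> length ps = l \<and> sum_list s = 1 \<and> (\<forall>p\<in>set ps. core d p)"
      using symbol_rank_eq[of l "(ps,s)"] l that by (auto simp: charged_partition_def charge_sum_def core_def)
    ultimately show "(ps,s) \<in> ordinary_set l d n \<longleftrightarrow> length s = l \<and> length ps = l \<and> sum_list s = 1 \<and> (\<forall>p\<in>set ps. core d p) \<and>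
       2 * int n = 2 * (\<Sum>j<l. int (psize (ps ! j))) + (\<Sum>j<l. (s ! j)^2) - 1" by auto
  qed
  finally show ?thesis .
qed

section \<open>Sums of two norms of Eisenstein integers\<close>

definition eisenstein_norm :: "int \<Rightarrow> int \<Rightarrow> int" where
  "eisenstein_norm x y = x^2 + x*y + y^2"

definition two_norms :: "int \<Rightarrow> bool" where
  "two_norms n \<longleftrightarrow> (\<exists>x y z w. n = eisenstein_norm x y + eisenstein_norm z w)"

lemma two_normsI: "two_norms (eisenstein_norm x y + eisenstein_norm z w)"
  unfolding two_norms_def by blast

lemma eisenstein_norm_square: "4 * eisenstein_norm x y = (2*x + y)^2 + 3 * y^2"
  by (simp add: eisenstein_norm_def power2_eq_square algebra_simps)

lemma eisenstein_norm_nonneg: "0 \<le> eisenstein_norm x y"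
  using eisenstein_norm_square[of x y] zero_le_power2[of "2*x+y"] zero_le_power2[of y] by linarith

lemma eisenstein_norm_eq_0: "eisenstein_norm x y = 0 \<longleftrightarrow> x = 0 \<and> y = 0"
proof
  assume "eisenstein_norm x y = 0"
  then have "(2*x + y)^2 = 0" "y^2 = 0"
    using eisenstein_norm_square[of x y] zero_le_power2[of "2*x+y"] zero_le_power2[of y] by linarith+
  then show "x = 0 \<and> y = 0" by simp
qed (simp add: eisenstein_norm_def)

text \<open>
  The norm is multiplicative on the quaternion algebra of pairs of Eisenstein integers.
  The variables with primes enter through the conjugate, so that all components of the
  product except the first one vanish when both factors agree.
\<close>
lemma quaternion_norm_mult:
  "(eisenstein_norm x y + eisenstein_norm z w) * (eisenstein_norm x' y' + eisenstein_norm z' w') =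
   eisenstein_norm (x*x' + x*y' + y*y' + z*z' + z*w' + w*w') (y*x' - x*y' + w*z' - z*w') +
   eisenstein_norm (z*x' - w*y' - x*z' + y*w') (z*y' + w*x' + w*y' - x*w' - y*z' - y*w')"
  unfolding eisenstein_norm_def by algebra

lemma two_norms_mult: "two_norms a \<Longrightarrow> two_norms b \<Longrightarrow> two_norms (a * b)"
  unfolding two_norms_def using quaternion_norm_mult by metis

lemma centred_residue:
  fixes m :: int assumes "0 < m" obtains t' where "m dvd t - t'" "\<bar>2*t' + c\<bar> \<le> m"
proof
  let ?q = "(2*t + c + m) div (2*m)"
  show "m dvd t - (t - m * ?q)" by simp
  have "2*t + c + m = 2*m * ?q + (2*t + c + m) mod (2*m)" by simp
  moreover have "0 \<le> (2*t + c + m) mod (2*m)" "(2*t + c + m) mod (2*m) < 2*m" using assms by simp_all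
  ultimately show "\<bar>2 * (t - m * ?q) + c\<bar> \<le> m" by (simp add: right_diff_distrib mult.assoc)
qed

text \<open>
  Centring \<open>y\<close> first and then \<open>2x + y\<close> beats centring both
  coordinates, which would only give \<open>3/4\<close> in place of \<open>7/16\<close>;
  a constant below \<open>1/2\<close> makes the descent work.
\<close>
lemma eisenstein_reduction:
  fixes m :: int assumes "0 < m"
  obtains x' y' where "m dvd x - x'" "m dvd y - y'" "16 * eisenstein_norm x' y' \<le> 7 * m^2"
proof -
  obtain y' where y: "m dvd y - y'" "\<bar>2*y' + 0\<bar> \<le> m" using centred_residue[OF assms] .
  obtain x' where x: "m dvd x - x'" "\<bar>2*x' + y'\<bar> \<le> m" using centred_residue[OF assms] .
  have "\<bar>2*y'\<bar> \<le> \<bar>m\<bar>" "\<bar>2*x' + y'\<bar> \<le> \<bar>m\<bar>" using x y assms by simp_all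
  then have "(2*y')^2 \<le> m^2" "(2*x' + y')^2 \<le> m^2" by (simp_all only: abs_le_square_iff)
  then have "16 * eisenstein_norm x' y' \<le> 7 * m^2" using eisenstein_norm_square[of x' y'] by (simp add: power_mult_distrib)
  then show ?thesis using that x y by blast
qed

text \<open>
  Reduce the four coordinates modulo \<open>m\<close>. The product with the conjugate of
  the reduced quaternion is divisible by \<open>m\<close>, and dividing it leaves the
  norm \<open>m' * p\<close>.
\<close>
lemma quaternion_descent:
  fixes m p :: int
  assumes m: "1 < m" and np: "\<not> m dvd p" and s: "two_norms (m * p)"
  obtains m' where "0 < m'" "m' < m" "two_norms (m' * p)"
proof -
  obtain x y z w where v: "m * p = eisenstein_norm x y + eisenstein_norm z w" using s by (auto simp: two_norms_def)
  have m0: "0 < m" using m by simp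
  obtain x' y' where xy: "m dvd x - x'" "m dvd y - y'" "16 * eisenstein_norm x' y' \<le> 7 * m^2" using eisenstein_reduction[OF m0] .
  obtain z' w' where zw: "m dvd z - z'" "m dvd w - w'" "16 * eisenstein_norm z' w' \<le> 7 * m^2" using eisenstein_reduction[OF m0] .
  obtain a b c d where abcd: "x = x' + m*a" "y = y' + m*b" "z = z' + m*c" "w = w' + m*d"
    using xy zw by (metis add.commute diff_add_cancel dvdE)
  let ?Q = "eisenstein_norm x' y' + eisenstein_norm z' w'"
  have "m dvd ?Q"
  proof -
    have "?Q = m * (p - (2*x'*a + m*a^2 + x'*b + a*y' + m*a*b + 2*y'*b + m*b^2 + 2*z'*c + m*c^2 + z'*d + c*w' + m*c*d + 2*w'*d + m*d^2))"
      unfolding right_diff_distrib v unfolding abcd eisenstein_norm_def by algebra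
    then show ?thesis by simp
  qed
  then obtain m' where m': "?Q = m * m'" by (elim dvdE)
  have "16 * (m * m') \<le> 14 * m^2" using xy zw unfolding m'[symmetric] by simp
  then have "m * (16 * m') \<le> m * (14 * m)" by (simp add: power2_eq_square)
  then have "16 * m' \<le> 14 * m" using m0 by simp
  then have lt: "m' < m" using m0 by linarith
  have "0 \<le> m * m'" using m' eisenstein_norm_nonneg[of x' y'] eisenstein_norm_nonneg[of z' w'] by linarith
  then have ge: "0 \<le> m'" using m0 by (simp add: zero_le_mult_iff)
  have "m' \<noteq> 0"
  proof
    assume "m' = 0"
    then have "eisenstein_norm x' y' = 0" "eisenstein_norm z' w' = 0"
      using m' eisenstein_norm_nonneg[of x' y'] eisenstein_norm_nonneg[of z' w'] by auto
    then have "x = m*a" "y = m*b" "z = m*c" "w = m*d" using abcd by (auto simp: eisenstein_norm_eq_0)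
    then have "m * p = m * (m * (eisenstein_norm a b + eisenstein_norm c d))" unfolding v by (simp add: eisenstein_norm_def power2_eq_square algebra_simps)
    then have "p = m * (eisenstein_norm a b + eisenstein_norm c d)" using m0 by simp
    then show False using np by simp
  qed
  moreover have "two_norms (m' * p)"
  proof -
    let ?A = "x*x' + x*y' + y*y' + z*z' + z*w' + w*w'" and ?B = "y*x' - x*y' + w*z' - z*w'"
    let ?C = "z*x' - w*y' - x*z' + y*w'" and ?D = "z*y' + w*x' + w*y' - x*w' - y*z' - y*w'"
    have "?A = ?Q + m * (a*x' + a*y' + b*y' + c*z' + c*w' + d*w')" unfolding abcd eisenstein_norm_def by algebra
    then obtain A where A: "?A = m * A" unfolding m' by (metis distrib_left)
    have "?B = m * (b*x' - a*y' + d*z' - c*w')" unfolding abcd by algebra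
    then obtain B where B: "?B = m * B" by blast
    have "?C = m * (c*x' - d*y' - a*z' + b*w')" unfolding abcd by algebra
    then obtain C where C: "?C = m * C" by blast
    have "?D = m * (c*y' + d*x' + d*y' - a*w' - b*z' - b*w')" unfolding abcd by algebra
    then obtain D where D: "?D = m * D" by blast
    have "(m * p) * (m * m') = eisenstein_norm (m*A) (m*B) + eisenstein_norm (m*C) (m*D)"
      unfolding v m'[symmetric] quaternion_norm_mult A B C D ..
    then have "(m * m) * (m' * p) = (m * m) * (eisenstein_norm A B + eisenstein_norm C D)"
      by (simp add: eisenstein_norm_def power2_eq_square algebra_simps)
    then have "m' * p = eisenstein_norm A B + eisenstein_norm C D" using m0 by simp
    then show ?thesis using two_normsI by simp
  qed
  ultimately show ?thesis using that ge lt by (metis less_le)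
qed

text \<open>
  Pigeonhole: the squares and the values \<open>- 4 - 3 b^2\<close> each occupy more
  than half of the residues modulo \<open>p\<close>.
\<close>
lemma square_plus_three_square:
  fixes p :: int assumes p: "prime p" "p \<noteq> 2" "p \<noteq> 3" shows "\<exists>a b. p dvd a^2 + 3*b^2 + 4"
proof -
  have p0: "3 < p" using p prime_ge_2_int[of p] by linarith
  have odd: "odd p" using p primes_dvd_imp_eq[of 2 p] by auto
  then obtain h where h: "p = 2*h + 1" by (elim oddE)
  have key: "a = b" if "p dvd a^2 - b^2" "a \<in> {0..h}" "b \<in> {0..h}" for a b
  proof -
    have "p dvd (a - b) * (a + b)" using that(1) by (simp add: power2_eq_square algebra_simps)
    then have "p dvd a - b \<or> p dvd a + b" using p(1) by (simp add: prime_dvd_mult_iff)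
    then show ?thesis
    proof
      assume "p dvd a - b"
      moreover have "\<bar>a - b\<bar> < p" using that h by auto
      ultimately show ?thesis using zdvd_not_zless[of "\<bar>a - b\<bar>" p] by force
    next
      assume "p dvd a + b" then show ?thesis using that h zdvd_not_zless[of "a + b" p] by (cases "a + b = 0") auto
    qed
  qed
  let ?A = "(\<lambda>a. a^2 mod p) ` {0..h}" and ?B = "(\<lambda>b. (- 4 - 3*b^2) mod p) ` {0..h}"
  have "card ?A = nat (h + 1)"
    by (subst card_image) (auto intro!: inj_onI key simp: mod_eq_dvd_iff h)
  moreover have "card ?B = nat (h + 1)"
  proof (subst card_image)
    show "inj_on (\<lambda>b. (- 4 - 3*b^2) mod p) {0..h}"
    proof (rule inj_onI)
      fix a b assume ab: "a \<in> {0..h}" "b \<in> {0..h}" "(- 4 - 3*a^2) mod p = (- 4 - 3*b^2) mod p"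
      then have "p dvd 3 * (b^2 - a^2)" by (simp add: mod_eq_dvd_iff algebra_simps)
      moreover have "\<not> p dvd 3" using p0 zdvd_not_zless[of 3 p] by auto
      ultimately have "p dvd b^2 - a^2" using prime_dvd_multD[OF p(1)] by blast
      then show "a = b" using key ab by blast
    qed
  qed simp
  moreover have "card (?A \<union> ?B) \<le> card {0..<p}" by (rule card_mono) (use p0 in auto)
  ultimately have "?A \<inter> ?B \<noteq> {}" using card_Un_disjoint[of ?A ?B] p0 h by auto
  then obtain a b where "a^2 mod p = (- 4 - 3*b^2) mod p" by auto
  then have "p dvd a^2 - (- 4 - 3*b^2)" by (simp add: mod_eq_dvd_iff)
  then show ?thesis by (intro exI[of _ a] exI[of _ b]) (simp add: algebra_simps)
qed

lemma two_norms_prime: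
  fixes p :: int assumes p: "prime p" shows "two_norms p"
proof (cases "p = 2 \<or> p = 3")
  case True
  then show ?thesis using two_normsI[of 1 0 1 0] two_normsI[of 1 1 0 0] by (auto simp: eisenstein_norm_def)
next
  case False
  have p2: "2 \<le> p" using prime_ge_2_int[OF p] .
  have odd: "odd p" using p False primes_dvd_imp_eq[of 2 p] by auto
  obtain a b where ab: "p dvd a^2 + 3*b^2 + 4" using square_plus_three_square p False by blast
  obtain z where z: "p dvd 1 + eisenstein_norm z b"
  proof -
    obtain a' where a': "p dvd a'^2 + 3*b^2 + 4" "even (a' - b)"
    proof (cases "even (a - b)")
      case False
      have "(a + p)^2 + 3*b^2 + 4 = (a^2 + 3*b^2 + 4) + p * (2*a + p)" by (simp add: power2_eq_square algebra_simps)
      then have "p dvd (a + p)^2 + 3*b^2 + 4" using ab by (metis dvd_add dvd_triv_left)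
      then show ?thesis using that[of "a + p"] False odd by simp
    qed (use that ab in blast)
    then obtain z where "a' = 2*z + b" by (metis diff_eq_eq evenE)
    then have "p dvd 4 * (1 + eisenstein_norm z b)" using a'(1) eisenstein_norm_square[of z b] by (simp add: algebra_simps)
    moreover have "coprime p 4"
      using odd by (metis coprime_right_2_iff_odd coprime_power_right_iff power2_eq_square mult_2_right numeral_Bit0 mult.commute one_add_one mult_2)
    ultimately have "p dvd 1 + eisenstein_norm z b" by (simp only: coprime_dvd_mult_right_iff)
    then show ?thesis using that by blast
  qed
  have p0: "0 < p" using p2 by simp
  obtain z' b' where r: "p dvd z - z'" "p dvd b - b'" "16 * eisenstein_norm z' b' \<le> 7 * p^2" using eisenstein_reduction[OF p0] .
  have "p dvd eisenstein_norm z b - eisenstein_norm z' b'"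
  proof -
    have "eisenstein_norm z b - eisenstein_norm z' b' = (z - z') * (z + z' + b) + (b - b') * (z' + b + b')"
      by (simp add: eisenstein_norm_def power2_eq_square algebra_simps)
    then show ?thesis using r by simp
  qed
  then have "p dvd 1 + eisenstein_norm z' b'" using dvd_diff[OF z] by fastforce
  then obtain m where m: "1 + eisenstein_norm z' b' = p * m" by (elim dvdE)
  have "0 < p * m" using m eisenstein_norm_nonneg[of z' b'] by linarith
  then have m0: "0 < m" using p0 by (simp add: zero_less_mult_iff)
  have "4 \<le> p^2" using p2 power_mono[of 2 p 2] by simp
  then have "p * m < p^2" using r(3) m by linarith
  then have "p * m < p * p" by (simp only: power2_eq_square)
  then have mp: "m < p" using p0 by simp
  have ex: "\<exists>m. 0 < m \<and> m < p \<and> two_norms (m * p)"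
    using m m0 mp two_normsI[of 1 0 z' b'] by (intro exI[of _ m]) (simp add: eisenstein_norm_def mult.commute)
  have "two_norms p" if "0 < m" "m < p" "two_norms (m * p)" for m
    using that
  proof (induction "nat m" arbitrary: m rule: less_induct)
    case less
    show ?case
    proof (cases "m = 1")
      case False
      then have "1 < m" using less.prems by simp
      moreover have "\<not> m dvd p" using p \<open>1 < m\<close> less.prems(2) unfolding prime_int_iff by (metis less_irrefl less_imp_le less_trans zero_less_one)
      ultimately obtain m' where "0 < m'" "m' < m" "two_norms (m' * p)" using quaternion_descent less.prems by blast
      then show ?thesis using less by auto
    qed (use less in simp)
  qed
  then show ?thesis using ex by blast
qed

theorem two_norms_universal: "two_norms (int n)"
proof (induction n rule: less_induct)
  case (less n)
  consider "n = 0" | "n = 1" | "1 < n" by linarith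
  then show ?case
  proof cases
    case 3
    then obtain p where p: "prime p" "p dvd n" by (metis prime_factor_nat less_irrefl)
    then obtain k where k: "n = p * k" by (elim dvdE)
    then have "k < n" using 3 p prime_gt_1_nat[of p] by (cases "k = 0") auto
    then show ?thesis using less two_norms_mult[OF two_norms_prime] p k by (simp add: prime_nat_int_transfer)
  qed (use two_normsI[of 0 0 0 0] two_normsI[of 1 0 0 0] in \<open>auto simp: eisenstein_norm_def\<close>)
qed

section \<open>Cores from the abacus\<close>

text \<open>
  On runner \<open>i\<close>, the integers \<open>b\<close> with \<open>(b - 1) mod d =
  i\<close>, all positions below \<open>n i\<close> are occupied. The offset 1 makes the
  empty abacus the beta set of the empty partition with charge 0.
\<close>
definition abacus :: "nat \<Rightarrow> (nat \<Rightarrow> int) \<Rightarrow> int set" where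
  "abacus d n = {b. (b - 1) div int d < n (nat ((b - 1) mod int d))}"

lemma sum_below: fixes n K :: int assumes "- K \<le> n"
  shows "2 * (\<Sum>q\<in>{-K..<n}. q) = n*(n-1) - K*(K+1)"
  using assms
proof (induction n rule: int_ge_induct)
  case (step i)
  have "{-K..<i+1} = insert i {-K..<i}" using step by auto
  then show ?case using step by (simp add: algebra_simps)
qed (simp add: algebra_simps)

text \<open>
  The abacus is closed under subtracting \<open>d\<close>, hence the beta set of a core.
  Counting the entries above a level far below all runners yields its charge
  \<open>\<Sum> n i\<close>, and summing them yields its size.
\<close>
lemma exists_core:
  fixes n :: "nat \<Rightarrow> int" assumes d: "0 < d"
  shows "\<exists>p. core d p \<and> 2 * int (psize p) = (\<Sum>i<d. int d * (n i * (n i - 1)) + 2 * int i * n i) - sum n {..<d} * (sum n {..<d} - 1)"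
proof -
  let ?S = "abacus d n"
  have d0: "0 < int d" using d by simp
  obtain K where K: "\<And>i. i < d \<Longrightarrow> \<bar>n i\<bar> \<le> K" "0 \<le> K"
  proof (rule that)
    show "\<bar>n i\<bar> \<le> (\<Sum>i<d. \<bar>n i\<bar>)" if "i < d" for i using that member_le_sum[of i "{..<d}" "\<lambda>i. \<bar>n i\<bar>"] by simp
    show "0 \<le> (\<Sum>i<d. \<bar>n i\<bar>)" by (simp add: sum_nonneg)
  qed
  \<comment> \<open>The entry at position \<open>q\<close> of runner \<open>i\<close>.\<close>
  define code where "code = (\<lambda>(i,q). int d * q + int i + 1)"
  have code: "(code (i,q) - 1) div int d = q" "nat ((code (i,q) - 1) mod int d) = i" if "i < d" for i q
    using that by (auto simp: code_def)
  have decode: "\<exists>i q. i < d \<and> b = code (i,q)" for b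
  proof (intro exI conjI)
    let ?i = "(b - 1) mod int d"
    have "0 \<le> ?i" "?i < int d" using d0 by simp_all
    then show "nat ?i < d" by linarith
    show "b = code (nat ?i, (b - 1) div int d)" using \<open>0 \<le> ?i\<close> by (simp add: code_def)
  qed
  have mem: "code (i,q) \<in> ?S \<longleftrightarrow> q < n i" if "i < d" for i q using code[OF that] by (simp add: abacus_def)
  have low: "code (i,q) < - int d * K + 1 \<longleftrightarrow> q < - K" if "i < d" for i q
  proof
    assume "code (i,q) < - int d * K + 1"
    then have "int d * q + int d * K < 0" by (simp add: code_def)
    then have "int d * (q + K) < 0" by (simp add: distrib_left)
    then show "q < - K" using d0 by (simp add: mult_less_0_iff)
  next
    assume "q < - K"
    then have "int d * (q + 1) \<le> int d * (- K)" using d0 by (intro mult_left_mono) auto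
    then show "code (i,q) < - int d * K + 1" using that by (simp add: code_def distrib_left)
  qed
  have full: "{..<- int d * K + 1} \<subseteq> ?S"
  proof
    fix b assume b: "b \<in> {..<- int d * K + 1}"
    obtain i q where iq: "i < d" "b = code (i,q)" using decode by blast
    then have "q < - K" using b low by simp
    then show "b \<in> ?S" using iq mem K(1)[of i] by auto
  qed
  have "?S \<subseteq> {..int d * (K + 1)}"
  proof
    fix b assume b: "b \<in> ?S"
    obtain i q where iq: "i < d" "b = code (i,q)" using decode by blast
    then have "q \<le> K" using b mem K(1)[of i] by auto
    then have "int d * q \<le> int d * K" by (intro mult_left_mono) auto
    moreover have "b = int d * q + int i + 1" using iq(2) by (simp add: code_def)
    ultimately have "b \<le> int d * K + int d" using iq(1) by linarith
    then show "b \<in> {..int d * (K + 1)}" by (simp add: distrib_left)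
  qed
  then have "is_beta ?S" using full unfolding is_beta_def by blast
  then obtain p s where p: "is_partition p" "range (beta p s) = ?S" using beta_surj by blast
  have "closed_down d ?S" unfolding closed_down_def
  proof
    fix b assume b: "b \<in> ?S"
    obtain i q where iq: "i < d" "b = code (i,q)" using decode by blast
    have "b - int d = code (i, q - 1)" unfolding iq by (simp add: code_def right_diff_distrib)
    then show "b - int d \<in> ?S" using b iq mem by simp
  qed
  then have core: "core d p" using core_iff_closed[of d p s] p by simp
  have set: "{b \<in> ?S. - int d * K + 1 \<le> b} = code ` (SIGMA i:{..<d}. {-K..<n i})"
  proof
    show "{b \<in> ?S. - int d * K + 1 \<le> b} \<subseteq> code ` (SIGMA i:{..<d}. {-K..<n i})"
    proof
      fix b assume b: "b \<in> {b \<in> ?S. - int d * K + 1 \<le> b}"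
      obtain i q where iq: "i < d" "b = code (i,q)" using decode by blast
      then have "(i,q) \<in> (SIGMA i:{..<d}. {-K..<n i})" using b mem[of i q] low[of i q] by auto
      then show "b \<in> code ` (SIGMA i:{..<d}. {-K..<n i})" using iq by blast
    qed
    show "code ` (SIGMA i:{..<d}. {-K..<n i}) \<subseteq> {b \<in> ?S. - int d * K + 1 \<le> b}"
    proof clarify
      fix i q assume "i < d" "q \<in> {-K..<n i}"
      then show "code (i,q) \<in> ?S \<and> - int d * K + 1 \<le> code (i,q)" using mem[of i q] low[of i q] by auto
    qed
  qed
  have inj: "inj_on code (SIGMA i:{..<d}. {-K..<n i})"
  proof (rule inj_onI)
    fix x y assume xy: "x \<in> (SIGMA i:{..<d}. {-K..<n i})" "y \<in> (SIGMA i:{..<d}. {-K..<n i})" "code x = code y"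
    obtain i q j r where e: "x = (i,q)" "y = (j,r)" by (cases x, cases y)
    show "x = y" using xy code[of i q] code[of j r] unfolding e by auto
  qed
  let ?C = "sum n {..<d}"
  have "int (card {b \<in> ?S. - int d * K + 1 \<le> b}) = (\<Sum>i<d. int (card {-K..<n i}))"
    unfolding set by (subst card_image[OF inj]) simp
  also have "\<dots> = (\<Sum>i<d. n i + K)"
  proof (rule sum.cong)
    fix i assume "i \<in> {..<d}"
    then show "int (card {-K..<n i}) = n i + K" using K(1)[of i] by auto
  qed simp
  finally have "int (card {b \<in> ?S. - int d * K + 1 \<le> b}) = ?C + int d * K" by (simp add: sum.distrib)
  then have s: "s = ?C" using beta_level_card(2)[OF p(1) full[folded p(2)]] p(2) by simp
  \<comment> \<open>The sum of an arithmetic progression, by which the full lower part is subtracted.\<close>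
  have arith: "2 * (\<Sum>k<m. c - int k) = 2 * c * int m - int m * (int m - 1)" for c m
    by (induction m) (simp_all add: algebra_simps)
  have "0 \<le> ?C + int d * K"
  proof -
    have "(\<Sum>i<d. - K) \<le> ?C"
    proof (rule sum_mono)
      fix i assume "i \<in> {..<d}" then show "- K \<le> n i" using K(1)[of i] by auto
    qed
    then show ?thesis by simp
  qed
  then have nat: "int (nat (s - (- int d * K + 1) + 1)) = ?C + int d * K" using s by simp
  have "2 * (\<Sum>b | b \<in> ?S \<and> - int d * K + 1 \<le> b. b) = 2 * (\<Sum>(i,q)\<in>(SIGMA i:{..<d}. {-K..<n i}). code (i,q))"
    unfolding set by (subst sum.reindex[OF inj]) (simp add: case_prod_unfold)
  also have "\<dots> = (\<Sum>i<d. 2 * (\<Sum>q\<in>{-K..<n i}. code (i,q)))" by (subst sum.Sigma[symmetric]) (simp_all add: sum_distrib_left)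
  also have "\<dots> = (\<Sum>i<d. int d * (n i * (n i - 1)) + 2 * int i * n i + 2 * n i + (2 * K * (int i + 1) - int d * (K * (K + 1))))"
  proof (rule sum.cong)
    fix i assume "i \<in> {..<d}"
    then have i: "- K \<le> n i" using K(1)[of i] by auto
    have "(\<Sum>q\<in>{-K..<n i}. code (i,q)) = int d * (\<Sum>q\<in>{-K..<n i}. q) + (n i + K) * (int i + 1)"
      using i by (simp add: code_def sum.distrib sum_distrib_left distrib_left)
    then have "2 * (\<Sum>q\<in>{-K..<n i}. code (i,q)) = int d * (2 * (\<Sum>q\<in>{-K..<n i}. q)) + 2 * (n i + K) * (int i + 1)" by algebra
    then show "2 * (\<Sum>q\<in>{-K..<n i}. code (i,q)) = int d * (n i * (n i - 1)) + 2 * int i * n i + 2 * n i + (2 * K * (int i + 1) - int d * (K * (K + 1)))"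
      unfolding sum_below[OF i] by (simp add: algebra_simps)
  qed simp
  also have "\<dots> = (\<Sum>i<d. int d * (n i * (n i - 1)) + 2 * int i * n i) + 2 * ?C + (\<Sum>i<d. 2 * K * (int i + 1) - int d * (K * (K + 1)))"
    by (simp only: sum.distrib sum_distrib_left)
  also have "(\<Sum>i<d. 2 * K * (int i + 1) - int d * (K * (K + 1))) = K * (int d * (int d + 1)) - int d * (int d * (K * (K + 1)))"
  proof -
    have "(\<Sum>i<m. 2 * K * (int i + 1) - c) = K * (int m * (int m + 1)) - int m * c" for m c
      by (induction m) (simp_all add: algebra_simps)
    then show ?thesis .
  qed
  finally have 1: "2 * (\<Sum>b | b \<in> ?S \<and> - int d * K + 1 \<le> b. b) =
    (\<Sum>i<d. int d * (n i * (n i - 1)) + 2 * int i * n i) + 2 * ?C + (K * (int d * (int d + 1)) - int d * (int d * (K * (K + 1))))" .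
  have "2 * (\<Sum>b | b \<in> ?S \<and> - int d * K + 1 \<le> b. b) = 2 * int (psize p) + 2 * (\<Sum>k<nat (s - (- int d * K + 1) + 1). s - int k)"
    using beta_level_card(3)[OF p(1) full[folded p(2)]] p(2) by simp
  also have "2 * (\<Sum>k<nat (s - (- int d * K + 1) + 1). s - int k) = 2 * ?C * (?C + int d * K) - (?C + int d * K) * (?C + int d * K - 1)"
    unfolding s arith nat[unfolded s] ..
  finally have "2 * int (psize p) = (\<Sum>i<d. int d * (n i * (n i - 1)) + 2 * int i * n i) - ?C * (?C - 1)"
    unfolding 1 by algebra
  then show ?thesis using core by blast
qed

section \<open>Existence of cuspidals\<close>

lemma zero_core: "0 < d \<Longrightarrow> core d (\<lambda>_. 0)" "psize (\<lambda>_. 0) = 0"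
proof -
  show "psize (\<lambda>_. 0) = 0" by (simp add: psize_def)
  have "closed_down d (range (beta (\<lambda>_. 0) 0))"
  proof -
    have "beta (\<lambda>_. 0) 0 k - int d = beta (\<lambda>_. 0) 0 (k + d)" for k by (simp add: beta_def)
    then show ?thesis unfolding closed_down_def by (metis (mono_tags, lifting) rangeE rangeI)
  qed
  then show "core d (\<lambda>_. 0)" using core_iff_closed[of d "\<lambda>_. 0" 0] by (simp add: is_partition_def antimono_def)
qed

text \<open>
  A beta set closed under subtracting 1 consists of all integers up to its largest
  element.
\<close>
lemma core_1: assumes "core 1 p" shows "psize p = 0"
proof -
  have p: "is_partition p" and c: "closed_down 1 (range (beta p 0))" using assms core_iff_closed[of 1 p 0] by auto
  have down: "beta p 0 0 - int k \<in> range (beta p 0)" for k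
  proof (induction k)
    case (Suc k)
    then have "beta p 0 0 - int k - int 1 \<in> range (beta p 0)" using c unfolding closed_down_def by blast
    then show ?case by (simp add: algebra_simps)
  qed simp
  obtain N where N: "\<And>k. N \<le> k \<Longrightarrow> p k = 0" using partition_zero[OF p] by blast
  have dec: "\<And>j k. j < k \<Longrightarrow> beta p 0 k < beta p 0 j" using beta_decreasing[OF p] .
  have "range (beta p 0) = range (\<lambda>k. beta p 0 0 - int k)"
  proof
    show "range (beta p 0) \<subseteq> range (\<lambda>k. beta p 0 0 - int k)"
    proof clarify
      fix k
      have "beta p 0 k \<le> beta p 0 0" using dec[of 0 k] by (cases "k = 0") auto
      then have "beta p 0 k = beta p 0 0 - int (nat (beta p 0 0 - beta p 0 k))" by simp
      then show "beta p 0 k \<in> range (\<lambda>k. beta p 0 0 - int k)" by blast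
    qed
  qed (use down in blast)
  then have "beta p 0 = (\<lambda>k. beta p 0 0 - int k)" by (intro decreasing_unique dec) auto
  then have "beta p 0 N = beta p 0 0 - int N" by metis
  then have "p 0 = 0" using N[of N] by (simp add: beta_def)
  then have "p k = 0" for k using p by (auto simp: is_partition_def antimono_def) (metis le_zero_eq zero_le)
  then show ?thesis by (simp add: psize_def)
qed

text \<open>
  The charges \<open>a\<close> and \<open>1 - a\<close> contribute \<open>a * (a -
  1)\<close> to the rank.
\<close>
lemma two_cores:
  assumes l: "2 \<le> l" and d: "0 < d" and pq: "core d p" "core d q"
    and N: "int N = int (psize p) + int (psize q) + a * (a - 1)"
  shows "Phi_cuspidals l (d * l) N \<noteq> {}"
proof -
  obtain k where k: "l = Suc (Suc k)" using l by (metis add_2_eq_Suc le_Suc_ex)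
  let ?s = "[a, 1 - a] @ replicate k 0" and ?ps = "[p, q] @ replicate k (\<lambda>_. 0)"
  have "2 * int N = 2 * (\<Sum>j<l. int (psize (?ps ! j))) + (\<Sum>j<l. (?s ! j)^2) - 1"
    unfolding k N by (simp add: sum.lessThan_Suc_shift zero_core(2) power2_eq_square algebra_simps del: sum.lessThan_Suc)
  moreover have "sum_list ?s = 1" "length ?s = l" "length ?ps = l" "\<forall>p\<in>set ?ps. core d p"
    using pq zero_core(1)[OF d] k by (auto simp: sum_list_replicate)
  ultimately have "\<exists>s ps. length s = l \<and> length ps = l \<and> sum_list s = (1::int) \<and> (\<forall>p\<in>set ps. core d p) \<and>
       2 * int N = 2 * (\<Sum>j<l. int (psize (ps ! j))) + (\<Sum>j<l. (s ! j)^2) - 1" by blast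
  then show ?thesis using cuspidal_exists_iff[of l d N] l d by simp
qed

text \<open>
  If the charges of the two rows are those of their abaci, the terms in the charges
  cancel.
\<close>
lemma two_abaci:
  fixes n m :: "nat \<Rightarrow> int"
  assumes l: "2 \<le> l" and d: "0 < d" and one: "(\<Sum>i<d. n i + m i) = 1"
    and N: "2 * int N = (\<Sum>i<d. int d * (n i * (n i - 1) + m i * (m i - 1)) + 2 * int i * (n i + m i))"
  shows "Phi_cuspidals l (d * l) N \<noteq> {}"
proof -
  obtain p where p: "core d p" "2 * int (psize p) = (\<Sum>i<d. int d * (n i * (n i - 1)) + 2 * int i * n i) - sum n {..<d} * (sum n {..<d} - 1)"
    using exists_core[OF d] by blast
  obtain q where q: "core d q" "2 * int (psize q) = (\<Sum>i<d. int d * (m i * (m i - 1)) + 2 * int i * m i) - sum m {..<d} * (sum m {..<d} - 1)"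
    using exists_core[OF d] by blast
  define a where "a = sum n {..<d}"
  have b: "sum m {..<d} = 1 - a" using one unfolding a_def by (simp add: sum.distrib)
  have "2 * int N = 2 * int (psize p) + a * (a - 1) + 2 * int (psize q) + (1 - a) * (1 - a - 1)"
    unfolding N p(2) q(2) b a_def[symmetric] by (simp add: sum.distrib[symmetric] algebra_simps)
  then have "2 * int N = 2 * (int (psize p) + int (psize q) + a * (a - 1))" by (simp add: algebra_simps)
  then have "int N = int (psize p) + int (psize q) + a * (a - 1)" by simp
  then show ?thesis using two_cores[OF l d p(1) q(1)] by blast
qed

text \<open>
  Write \<open>8N + 3 = x^2 + y^2 + z^2\<close> with odd numbers and choose the sign of
  \<open>z\<close> such that 4 divides \<open>1 + x + y + z\<close>. Half the 4-by-4
  Hadamard matrix is orthogonal and maps \<open>(1, x, y, z) / 2\<close> to four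
  integers with sum 1 and square sum \<open>2N + 1\<close>.
\<close>
lemma four_rows:
  assumes l: "4 \<le> l" and d: "0 < d" shows "Phi_cuspidals l (d * l) N \<noteq> {}"
proof -
  obtain i j k where N: "N = tri i + tri j + tri k" using three_triangular by blast
  define x where "x = 2 * int i + 1"
  define y where "y = 2 * int j + 1"
  define z where "z = (if 4 dvd 1 + x + y + (2 * int k + 1) then 2 * int k + 1 else - (2 * int k + 1))"
  have dv: "4 dvd 1 + x + y + z" unfolding x_def y_def z_def by auto presburger
  then obtain a where a: "1 + x + y + z = 4 * a" by (elim dvdE)
  have o: "odd x" "odd y" "odd z" by (auto simp: x_def y_def z_def)
  obtain u v where "x = 2*u+1" "y = 2*v+1" using o by (elim oddE)
  then obtain b c e where bce: "1 + x - y - z = 4 * b" "1 - x + y - z = 4 * c" "1 - x - y + z = 4 * e"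
  proof -
    have "1 + x - y - z = 4 * (1 + u - a + 0*v) + 0" "1 - x + y - z = 4 * (1 + v - a)" "1 - x - y + z = 4 * (a - u - v - 1)"
      using a \<open>x = 2*u+1\<close> \<open>y = 2*v+1\<close> by auto
    then show ?thesis using that by (metis add.right_neutral)
  qed
  have s1: "a + b + c + e = 1" using a bce by linarith
  have "16 * (a^2 + b^2 + c^2 + e^2) = (4*a)^2 + (4*b)^2 + (4*c)^2 + (4*e)^2" by (simp add: power2_eq_square)
  also have "\<dots> = 4 * (1 + x^2 + y^2 + z^2)" unfolding a[symmetric] bce[symmetric] by (simp add: power2_eq_square algebra_simps)
  also have "\<dots> = 16 * (2 * int N + 1)"
  proof -
    have "z^2 = (2 * int k + 1)^2" unfolding z_def by (simp add: power2_eq_square algebra_simps)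
    then show ?thesis using int_tri[of i] int_tri[of j] int_tri[of k] unfolding N x_def y_def by (simp add: power2_eq_square algebra_simps)
  qed
  finally have sq: "a^2 + b^2 + c^2 + e^2 = 2 * int N + 1" by simp
  obtain r where r: "l = Suc (Suc (Suc (Suc r)))" using l by (metis Suc_le_D numeral_eq_Suc pred_numeral_simps(2) pred_numeral_simps(3) BitM.simps Suc_le_mono eval_nat_numeral(3) numeral_2_eq_2)
  let ?s = "[a, b, c, e] @ replicate r 0" and ?ps = "replicate l (\<lambda>_. 0) :: (nat \<Rightarrow> nat) list"
  have "2 * int N = 2 * (\<Sum>j<l. int (psize (?ps ! j))) + (\<Sum>j<l. (?s ! j)^2) - 1"
    using sq by (simp add: zero_core(2)) (simp add: r sum.lessThan_Suc_shift del: sum.lessThan_Suc)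
  moreover have "sum_list ?s = 1" "length ?s = l" "length ?ps = l" "\<forall>p\<in>set ?ps. core d p"
    using zero_core(1)[OF d] r s1 by (auto simp: sum_list_replicate)
  ultimately have "\<exists>s ps. length s = l \<and> length ps = l \<and> sum_list s = (1::int) \<and> (\<forall>p\<in>set ps. core d p) \<and>
       2 * int N = 2 * (\<Sum>j<l. int (psize (ps ! j))) + (\<Sum>j<l. (s ! j)^2) - 1" by blast
  then show ?thesis using cuspidal_exists_iff[of l d N] l d by simp
qed

text \<open>
  For \<open>2n = 2 * tri i + tri j + tri k\<close>, completing squares writes \<open>8n
  + 2\<close> as \<open>A^2 + B^2 + W^2\<close> with \<open>A\<close>, \<open>B\<close>
  odd. Modulo 8 the even number \<open>W\<close> is divisible by 4, and \<open>(A + B) /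
  2\<close>, \<open>(A - B) / 2\<close> are an odd and an even number whose squares add
  up to \<open>4n + 1 - 8 (W/4)^2\<close>.
\<close>
lemma square_double_square_pronic: "\<exists>x c t. int n = x^2 + 2 * c^2 + t * (t + 1)"
proof -
  obtain i j k where n: "2 * n = 2 * tri i + tri j + tri k" using two_triangular_and_double by blast
  define A where "A = 2 * int i + 1"
  have q: "8 * int n + 2 = A^2 + (int j + int k + 1)^2 + (int j - int k)^2"
  proof -
    have "2 * int n = 2 * int (tri i) + int (tri j) + int (tri k)" using n by (metis of_nat_add of_nat_mult of_nat_numeral)
    then show ?thesis using int_tri[of i] int_tri[of j] int_tri[of k] by (simp add: A_def power2_eq_square algebra_simps)
  qed
  obtain B W where BW: "8 * int n + 2 = A^2 + B^2 + W^2" "odd B" "even W"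
  proof (cases "even (int j - int k)")
    case True
    then show ?thesis using q by (intro that[of "int j + int k + 1" "int j - int k"]) auto
  next
    case False
    then show ?thesis using q by (intro that[of "int j - int k" "int j + int k + 1"]) auto
  qed
  obtain w where w: "W = 2 * w" using BW by blast
  obtain u where u: "B = 2 * u + 1" using BW by (elim oddE)
  have "4 * w^2 = 8 * int n - 4 * (int i * (int i + 1)) - 4 * (u * (u + 1))" using BW(1) unfolding w u A_def by (simp add: power2_eq_square algebra_simps)
  then have "w^2 = 2 * int n - int i * (int i + 1) - u * (u + 1)" by simp
  moreover have "even (int i * (int i + 1))" "even (u * (u + 1))" by simp_all
  ultimately have "even (w^2)" by (metis dvd_diff dvd_triv_left)
  then obtain c where c: "w = 2 * c" by auto
  have e: "4 * int n + 1 = (int i + u + 1)^2 + (int i - u)^2 + 8 * c^2" using BW(1) unfolding w u A_def c by (simp add: power2_eq_square algebra_simps)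
  show ?thesis
  proof (cases "even (int i - u)")
    case True
    then obtain x where x: "int i - u = 2 * x" by blast
    then have "int i + u + 1 = 2 * (u + x) + 1" by simp
    then have "4 * int n = 4 * (x^2 + 2 * c^2 + (u + x) * (u + x + 1))" using e unfolding x by (simp add: power2_eq_square algebra_simps)
    then show ?thesis by (intro exI[of _ x] exI[of _ c] exI[of _ "u + x"]) simp
  next
    case False
    then obtain x where x: "int i - u = 2 * x + 1" by (elim oddE)
    then have "int i + u + 1 = 2 * (u + x + 1)" by simp
    then have "4 * int n = 4 * ((u + x + 1)^2 + 2 * c^2 + x * (x + 1))" using e unfolding x by (simp add: power2_eq_square algebra_simps)
    then show ?thesis by (intro exI[of _ "u + x + 1"] exI[of _ c] exI[of _ x]) simp
  qed
qed

text \<open>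
  Opposite positions \<open>x\<close>, \<open>- x\<close> on the same runner of the two
  abaci add \<open>d x^2\<close> to the rank; the positions \<open>t + 1\<close>,
  \<open>- t\<close> on runner \<open>i\<close> add \<open>d t (t + 1) + i\<close>. The
  runner \<open>i\<close> realises the residue of \<open>N\<close> modulo
  \<open>d\<close>, and three further runners carry the squares of \<open>x\<close>,
  \<open>c\<close> and \<open>c\<close>.
\<close>
lemma two_rows_4:
  assumes l: "2 \<le> l" and d: "4 \<le> d" shows "Phi_cuspidals l (d * l) N \<noteq> {}"
proof -
  define i where "i = N mod d"
  have i: "i < d" using d by (simp add: i_def)
  obtain x c t where q: "int (N div d) = x^2 + 2 * c^2 + t * (t + 1)" using square_double_square_pronic by blast
  have N: "int N = int d * int (N div d) + int i" unfolding i_def by (metis div_mult_mod_eq mult.commute of_nat_add of_nat_mult)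
  have "3 \<le> card ({..<d} - {i})" using i d by simp
  then obtain T where T: "T \<subseteq> {..<d} - {i}" "card T = 3" by (meson obtain_subset_with_card_n)
  then obtain u v w where uvw: "T = {u,v,w}" "u \<noteq> v" "u \<noteq> w" "v \<noteq> w" by (auto simp: card_3_iff)
  define n where "n k = (if k = i then t + 1 else if k = u then x else if k = v \<or> k = w then c else 0)" for k
  define m where "m k = (if k = i then - t else - n k)" for k
  have k4: "u < d" "v < d" "w < d" "u \<noteq> i" "v \<noteq> i" "w \<noteq> i" using T uvw by auto
  show ?thesis
  proof (rule two_abaci[OF l])
    show "0 < d" using d by simp
    have "(\<Sum>k<d. n k + m k) = (\<Sum>k<d. if k = i then 1 else 0)" by (rule sum.cong) (auto simp: n_def m_def)
    then show "(\<Sum>k<d. n k + m k) = 1" using i by simp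
    have "(\<Sum>k<d. int d * (n k * (n k - 1) + m k * (m k - 1)) + 2 * int k * (n k + m k)) =
      (\<Sum>k<d. (if k = i then 2 * int d * (t * (t + 1)) + 2 * int i else 0) + (if k = u then 2 * int d * x^2 else 0)
        + (if k = v then 2 * int d * c^2 else 0) + (if k = w then 2 * int d * c^2 else 0))"
      by (rule sum.cong) (use k4 uvw in \<open>auto simp: n_def m_def power2_eq_square algebra_simps\<close>)
    also have "\<dots> = 2 * int N" using i k4 unfolding N q by (simp add: sum.distrib algebra_simps)
    finally show "2 * int N = (\<Sum>k<d. int d * (n k * (n k - 1) + m k * (m k - 1)) + 2 * int k * (n k + m k))" ..
  qed
qed

text \<open>
  These are the staircases; on two runners at positions \<open>- u\<close> and
  \<open>u\<close> they have size \<open>u (2u + 1)\<close>, which is the triangular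
  number of index \<open>2u\<close> or \<open>- 2u - 1\<close>.
\<close>
lemma triangular_2_core: "\<exists>p. core 2 p \<and> psize p = tri k"
proof -
  obtain u :: int where u: "2 * u = int k \<or> 2 * u = - int k - 1"
    by (metis add.commute diff_minus_eq_add evenE even_minus minus_add_distrib odd_add odd_one uminus_add_conv_diff)
  obtain p where p: "core 2 p" "2 * int (psize p) = 4 * u^2 + 2 * u"
    using exists_core[of 2 "\<lambda>i. if i = 0 then - u else u"] by (auto simp: eval_nat_numeral power2_eq_square algebra_simps)
  have "2 * int (psize p) = (2 * u) * (2 * u + 1)" unfolding p(2) by (simp add: power2_eq_square algebra_simps)
  also have "\<dots> = int k * (int k + 1)" using u by (elim disjE; simp only:) (simp_all add: algebra_simps)
  finally have "psize p = tri k" using int_tri[of k] by simp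
  then show ?thesis using p(1) by blast
qed

lemma two_rows_2: assumes l: "2 \<le> l" shows "Phi_cuspidals l (2 * l) N \<noteq> {}"
proof -
  obtain i j k where N: "N = 2 * tri i + tri j + tri k" using two_triangular_and_double by blast
  obtain p q where "core 2 p" "psize p = tri j" "core 2 q" "psize q = tri k" using triangular_2_core by metis
  moreover have "int N = int (tri j) + int (tri k) + (int i + 1) * (int i + 1 - 1)" using int_tri[of i] unfolding N by (simp add: algebra_simps)
  ultimately show ?thesis using two_cores[OF l, of 2 p q N "int i + 1"] by simp
qed

text \<open>
  Three runners at positions \<open>- a - b\<close>, \<open>a\<close>, \<open>b\<close>
  form a core of size \<open>m\<close> where \<open>3m + 1\<close> is the norm of
  \<open>(3a, 3b + 1)\<close>. The units and the conjugation of the Eisenstein integers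
  bring every element whose norm is 1 modulo 3 into this form.
\<close>
lemma eisenstein_3_core:
  assumes "eisenstein_norm x y mod 3 = 1" shows "\<exists>p. core 3 p \<and> eisenstein_norm x y = 3 * int (psize p) + 1"
proof -
  have eq: "eisenstein_norm x y = (x - y)^2 + 3 * (x * y)" by (simp add: eisenstein_norm_def power2_eq_square algebra_simps)
  have ne: "x mod 3 \<noteq> y mod 3"
  proof
    assume "x mod 3 = y mod 3"
    then have "3 dvd x - y" by (simp add: mod_eq_dvd_iff)
    then have "3 dvd eisenstein_norm x y" unfolding eq by (simp add: power2_eq_square)
    then show False using assms by presburger
  qed
  have "\<exists>a b. eisenstein_norm x y = eisenstein_norm (3*a) (3*b+1)"
  proof -
    have sym: "eisenstein_norm x y = eisenstein_norm y x" "eisenstein_norm x y = eisenstein_norm (-x) (-y)"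
      "eisenstein_norm x y = eisenstein_norm y (-x-y)" for x y by (simp_all add: eisenstein_norm_def power2_eq_square algebra_simps)
    have *: "\<exists>a b. eisenstein_norm u v = eisenstein_norm (3*a) (3*b+1)" if u3: "3 dvd u" and v3: "\<not> 3 dvd v" for u v
    proof -
      obtain a where a: "u = 3 * a" using u3 by (elim dvdE)
      have "v mod 3 = 1 \<or> v mod 3 = 2" using v3 by presburger
      then consider "v mod 3 = 1" | "v mod 3 = 2" by blast
      then show ?thesis
      proof cases
        case 1 then have "v = 3 * (v div 3) + 1" by presburger
        then show ?thesis unfolding a by metis
      next
        case 2 then have "- v = 3 * (- (v div 3) - 1) + 1" by presburger
        moreover have "- u = 3 * (- a)" by (simp add: a)
        ultimately show ?thesis using sym(2)[of u v] by metis
      qed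
    qed
    consider "3 dvd x" | "3 dvd y" | "\<not> 3 dvd x" "\<not> 3 dvd y" by blast
    then show ?thesis
    proof cases
      case 1 then show ?thesis using * ne by (metis mod_0_imp_dvd dvd_imp_mod_0)
    next
      case 2 then show ?thesis using *[of y x] ne sym(1) by (metis mod_0_imp_dvd dvd_imp_mod_0)
    next
      case 3
      then have "3 dvd - x - y" using ne by presburger
      then show ?thesis using *[of "- x - y" y] 3 sym(1,3) by metis
    qed
  qed
  then obtain a b where ab: "eisenstein_norm x y = eisenstein_norm (3*a) (3*b+1)" by blast
  obtain p where p: "core 3 p" "2 * int (psize p) = 6 * (a^2 + a*b + b^2) + 2 * a + 4 * b"
    using exists_core[of 3 "\<lambda>i. if i = 0 then - a - b else if i = 1 then a else b"] by (auto simp: eval_nat_numeral power2_eq_square algebra_simps)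
  have "2 * eisenstein_norm x y = 2 * (3 * int (psize p) + 1)" using p(2) unfolding ab unfolding eisenstein_norm_def by algebra
  then show ?thesis using p(1) by auto
qed

text \<open>
  Norms are 0 or 1 modulo 3, so two norms with sum \<open>3N + 2\<close> are both 1
  modulo 3.
\<close>
lemma two_rows_3: assumes l: "2 \<le> l" shows "Phi_cuspidals l (3 * l) N \<noteq> {}"
proof -
  have "int (3 * N + 2) = 3 * int N + 2" by simp
  then have "two_norms (3 * int N + 2)" using two_norms_universal[of "3 * N + 2"] by (simp only:)
  then obtain x y z w where e: "3 * int N + 2 = eisenstein_norm x y + eisenstein_norm z w" unfolding two_norms_def by blast
  have m: "eisenstein_norm x y mod 3 \<noteq> 2" for x y
  proof -
    have "eisenstein_norm x y = (x - y)^2 + 3 * (x * y)" by (simp add: eisenstein_norm_def power2_eq_square algebra_simps)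
    then have "eisenstein_norm x y mod 3 = (x - y)^2 mod 3" by simp
    moreover have "(x - y) mod 3 = 0 \<or> (x - y) mod 3 = 1 \<or> (x - y) mod 3 = 2" by presburger
    then have "(x - y)^2 mod 3 \<noteq> 2" using power_mod[of "x - y" 3 2] by auto
    ultimately show ?thesis by simp
  qed
  have "eisenstein_norm x y mod 3 = 1" "eisenstein_norm z w mod 3 = 1" using e m[of x y] m[of z w] by presburger+
  then obtain p q where "core 3 p" "eisenstein_norm x y = 3 * int (psize p) + 1" "core 3 q" "eisenstein_norm z w = 3 * int (psize q) + 1"
    using eisenstein_3_core by metis
  then show ?thesis using e two_cores[OF l, of 3 p q N 0] by simp
qed

text \<open>
  The numbers 3 and 7 are not sums of two and three squares, respectively.
\<close>
lemma missing_cuspidals: "Phi_cuspidals 2 (1 * 2) 1 = {}" "Phi_cuspidals 3 (1 * 3) 3 = {}"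
proof -
  have small: "a^2 = 0 \<or> a^2 = 1 \<or> a^2 = 4" if "a^2 \<le> 7" for a :: int
  proof -
    have "\<bar>a\<bar> < 3"
    proof (rule ccontr)
      assume "\<not> \<bar>a\<bar> < 3"
      then have "3^2 \<le> \<bar>a\<bar>^2" by (intro power_mono) auto
      then show False using that by simp
    qed
    then have "a = -2 \<or> a = -1 \<or> a = 0 \<or> a = 1 \<or> a = 2" by linarith
    then show ?thesis by auto
  qed
  have none: "Phi_cuspidals l (1 * l) N = {}" if l: "0 < l" and no: "\<And>s. length s = l \<Longrightarrow> (\<Sum>j<l. (s ! j)^2) \<noteq> (2 * int N + 1)" for l N
  proof (rule ccontr)
    assume "Phi_cuspidals l (1 * l) N \<noteq> {}"
    then obtain s ps where s: "length s = l" "length ps = l" "\<forall>p\<in>set ps. core 1 p"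
      "2 * int N = 2 * (\<Sum>j<l. int (psize (ps ! j))) + (\<Sum>j<l. (s ! j)^2) - 1"
      using cuspidal_exists_iff[OF l zero_less_one, THEN iffD1] by blast
    have "(\<Sum>j<l. int (psize (ps ! j))) = 0" using s core_1 by (intro sum.neutral) simp
    then show False using s no[OF s(1)] by simp
  qed
  show "Phi_cuspidals 2 (1 * 2) 1 = {}"
  proof (rule none)
    fix s :: "int list"
    show "(\<Sum>j<2. (s ! j)^2) \<noteq> 2 * int 1 + 1"
    proof
      assume "(\<Sum>j<2. (s ! j)^2) = 2 * int 1 + 1"
      then have e: "(s ! 0)^2 + (s ! 1)^2 = 3" by (simp add: eval_nat_numeral)
      then show False using small[of "s ! 0"] small[of "s ! 1"] zero_le_power2[of "s ! 0"] zero_le_power2[of "s ! 1"] by linarith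
    qed
  qed simp
  show "Phi_cuspidals 3 (1 * 3) 3 = {}"
  proof (rule none)
    fix s :: "int list"
    show "(\<Sum>j<3. (s ! j)^2) \<noteq> 2 * int 3 + 1"
    proof
      assume "(\<Sum>j<3. (s ! j)^2) = 2 * int 3 + 1"
      then have e: "(s ! 0)^2 + (s ! 1)^2 + (s ! 2)^2 = 7" by (simp add: numeral_3_eq_3 numeral_2_eq_2)
      then show False using small[of "s ! 0"] small[of "s ! 1"] small[of "s ! 2"]
        zero_le_power2[of "s ! 0"] zero_le_power2[of "s ! 1"] zero_le_power2[of "s ! 2"] by linarith
    qed
  qed simp
qed

theorem corollary4p23:
  fixes l d e :: nat
  assumes "l \<ge> 2" and "d \<ge> 1" and "e = d * l"
  shows "((\<forall>n. finite (Phi_cuspidals l e n)) \<and>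
          Abs_fps (\<lambda>n. rat_of_nat (card (Phi_cuspidals l e n)))
            = fps_const (1 / rat_of_nat l) * charge_rank_gf1 l * core_gf d ^ l)
       \<and> ((\<forall>n. Phi_cuspidals l e n \<noteq> {}) \<longleftrightarrow> e \<ge> 4)"
proof (intro conjI allI iffI)
  have pos: "0 < l" "0 < d" using assms by auto
  show "finite (Phi_cuspidals l e n)" for n unfolding assms(3) by (rule cuspidal_count(1)[OF pos])
  show "Abs_fps (\<lambda>n. rat_of_nat (card (Phi_cuspidals l e n))) = fps_const (1 / rat_of_nat l) * charge_rank_gf1 l * core_gf d ^ l"
    unfolding assms(3) by (rule cuspidal_gf[OF pos])
  show "e \<ge> 4" if all: "\<forall>n. Phi_cuspidals l e n \<noteq> {}"
  proof (rule ccontr)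
    assume "\<not> e \<ge> 4"
    then have lt: "d * l < 4" by (simp add: assms(3))
    have "d = 1"
    proof (rule ccontr)
      assume "d \<noteq> 1"
      then have "2 * 2 \<le> d * l" using assms by (intro mult_le_mono) auto
      then show False using lt by simp
    qed
    then have "l = 2 \<or> l = 3" "e = 1 * l" using lt assms by auto
    then show False using all missing_cuspidals by metis
  qed
  show "Phi_cuspidals l e n \<noteq> {}" if e: "e \<ge> 4" for n
  proof (cases "4 \<le> l")
    case True then show ?thesis using four_rows pos unfolding assms(3) by blast
  next
    case False
    then have "d \<noteq> 1" using e assms by auto
    then consider "d = 2" | "d = 3" | "4 \<le> d" using assms(2) by linarith
    then show ?thesis
      using two_rows_2 two_rows_3 two_rows_4 assms(1) unfolding assms(3) by cases auto
  qed
qed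

end
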